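(* Let $d\ge2$ be even and let $n>d+2$. The number of different labeled combinatorial types of neighborly Delaunay triangulations of configurations of $n-1$ labeled points in $\mathbb{R}^{d-1}$ is at least $$\prod_{i=1}^{d/2}\frac{(n-d-1+2i)!}{(2i)!}\ \ge\ \frac{(n-1)^{\left(\frac{n-1}{2}\right)^2}}{(n-d-1)^{\left(\frac{n-d-1}{2}\right)^2}\,d^{\left(\frac d2\right)^2}\,\mathrm{e}^{\frac{3d(n-d-1)}{4}}}\ \ge\ \left(\frac{n-1}{\mathrm{e}^{3/2}}\right)^{\frac12 d(n-d-1)}.$$
   Context: A triangulation of a point configuration $X\subset\mathbb{R}^m$ is a collection of simplices (cells) with vertices in $X$, closed under taking faces, that cover $\operatorname{conv}(X)$ and such that any two intersect in a common face. It is neighborly if $\operatorname{conv}(S)$ is a cell for each $S\subset X$ of size $\lfloor (m+1)/2\rfloor$. The points of a configuration of $N$ points are labeled by $\{1,\dots,N\}$, and two triangulations of labeled configurations are combinatorially equivalent (have the same labeled combinatorial type) if they have the same poset of cells, viewed as subsets of labels. The Delaunay subdivision of $X$ consists of all $\operatorname{conv}(S)$, $S\subseteq X$, for which some sphere contains $S$ and has all points of $X\setminus S$ outside the corresponding closed ball; it is called the Delaunay triangulation when it is a triangulation. *)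

theory Defs
  imports "HOL-Analysis.Analysis"
begin

text \<open>
  Point configurations are finite sets in a Euclidean space, and cells are closed point sets. The
  library predicate \<^const>\<open>simplicial_complex\<close> says that a finite collection consists of simplices,
  is closed under faces (the empty one included), and that any two members meet in a common face.
\<close>

definition triangulation_of :: "'a::euclidean_space set \<Rightarrow> 'a set set \<Rightarrow> bool" where
  "triangulation_of X T \<longleftrightarrow>
     simplicial_complex T \<and>
     (\<forall>C\<in>T. \<forall>v. v extreme_point_of C \<longrightarrow> v \<in> X) \<and>
     \<Union>T = convex hull X"

definition neighborly :: "'a::euclidean_space set \<Rightarrow> 'a set set \<Rightarrow> bool" where
  "neighborly X T \<longleftrightarrow>
     (\<forall>S\<subseteq>X. card S = (DIM('a) + 1) div 2 \<longrightarrow> convex hull S \<in> T)"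

definition delaunay_subdivision :: "'a::euclidean_space set \<Rightarrow> 'a set set" where
  "delaunay_subdivision X =
     {convex hull S | S. S \<subseteq> X \<and>
        (\<exists>c r. 0 < r \<and> S \<subseteq> sphere c r \<and> (\<forall>x\<in>X - S. x \<notin> cball c r))}"

definition delaunay_triangulation :: "'a::euclidean_space set \<Rightarrow> 'a set set \<Rightarrow> bool" where
  "delaunay_triangulation X T \<longleftrightarrow> T = delaunay_subdivision X \<and> triangulation_of X T"

text \<open>
  A configuration of \<open>N\<close> labeled points is a map \<open>p\<close> that is injective on the labels \<open>{1..N}\<close>; its
  values elsewhere are irrelevant. A cell is viewed as the set of labels of its vertices. The poset
  of cells is ordered by inclusion, so it is determined by its underlying set of label sets.
\<close>

definition labeled_configuration :: "nat \<Rightarrow> (nat \<Rightarrow> 'a::euclidean_space) \<Rightarrow> bool" where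
  "labeled_configuration N p \<longleftrightarrow> inj_on p {1..N}"

definition cell_labels :: "nat \<Rightarrow> (nat \<Rightarrow> 'a::euclidean_space) \<Rightarrow> 'a set \<Rightarrow> nat set" where
  "cell_labels N p C = {i \<in> {1..N}. p i extreme_point_of C}"

definition labeled_type :: "nat \<Rightarrow> (nat \<Rightarrow> 'a::euclidean_space) \<Rightarrow> 'a set set \<Rightarrow> nat set set" where
  "labeled_type N p T = cell_labels N p ` T"

definition neighborly_delaunay_types :: "'a::euclidean_space itself \<Rightarrow> nat \<Rightarrow> nat set set set" where
  "neighborly_delaunay_types _ N =
     {labeled_type N p T | (p :: nat \<Rightarrow> 'a) T.
        labeled_configuration N p \<and>
        delaunay_triangulation (p ` {1..N}) T \<and>
        neighborly (p ` {1..N}) T}"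

end

theory Submission
  imports Defs "HOL-Combinatorics.Multiset_Permutations"
begin

text \<open>
  Write \<open>d = 2k\<close> and \<open>N = n - 1\<close>, so that the points lie in dimension \<open>2k - 1\<close>. Lifting them to the
  paraboloid and adding the vertical direction, the point at infinity, turns the Delaunay cells into
  the faces avoiding infinity of a configuration of \<open>N + 1\<close> vectors of rank \<open>2k + 1\<close>; a face is a set
  of labels on which some linear functional vanishes while it is positive on all other labels. The
  label \<open>0\<close> always stands for infinity, and the triangulation is neighborly as soon as all
  \<open>k\<close>-element sets of labels are faces. All combinatorics takes place for vector configurations in
  general position; \<open>delaunay_types_realized\<close> translates the result back to triangulations.

  Many neighborly configurations come from a lifting that raises the rank by two. Its input is a list
  of all \<open>N\<close> labels, ending in \<open>p\<close> and \<open>a\<close>, and a configuration of rank \<open>2k - 1\<close> on the labels other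
  than \<open>a\<close>. The points receive a new coordinate whose values are chosen along the list, each huge
  compared with everything before it (\<open>lift_exists\<close>). A functional that vanishes on \<open>2k\<close> earlier labels,
  among which infinity is counted, then has the sign of its leading coefficient at every new label. This
  property alone implies that the lifted configuration is neighborly (\<open>neighborly_lift\<close>), that the
  cells with \<open>2k\<close> labels through \<open>p\<close> and \<open>a\<close> correspond to the facets of the input that avoid \<open>p\<close>
  (\<open>link_face\<close>), and that the last label of every initial segment of the list is inseparable, within
  that segment, from its predecessor and from infinity: in every linear relation on \<open>2k + 2\<close> labels
  that contain both, they have opposite signs.

  It remains to see how many inputs produce the same cells (\<open>unfolds_fibre\<close>). A label of a
  configuration of rank \<open>r\<close> with at least \<open>r + 2\<close> labels is inseparable from at most two others,
  because the relations on \<open>r + 2\<close> vectors form a plane (\<open>inseparable_at_most_two\<close>). The last label \<open>a\<close> is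
  inseparable from infinity, and enough of this is visible in the cells (\<open>apex_pair\<close>) to leave at most
  two candidates for \<open>a\<close>. Once \<open>a\<close> is known, its only partner besides infinity is \<open>p\<close>, and so on down
  the list, until \<open>2k\<close> labels are left; the last of these has at most \<open>k\<close> candidates and the others
  are arbitrary. The input configuration is recovered as a link. So at most \<open>2 * k * (2k - 1)! = (2k)!\<close>
  inputs give the same type. As a stereographic projection makes a point at infinity an ordinary
  label (\<open>delaunay_types_subset_polytope_types\<close>), the number of types for \<open>N\<close> points in rank \<open>2k + 1\<close> is at
  least \<open>N! / (2k)!\<close> times a bound for \<open>N - 2\<close> points in rank \<open>2k - 1\<close>, which iterates to the product.

  The logarithm of the product is bounded below by comparing it with an integral of the
  increments of \<open>x ln x - x\<close> (\<open>sum_ln_fact_bound\<close>), and the last inequality only uses that \<open>ln\<close> is increasing.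
\<close>

section \<open>Vector configurations and their faces\<close>

text \<open>
  A configuration of vectors of rank \<open>r\<close> is given by its coordinate functions \<open>\<psi> 0, \<dots>, \<psi> (r - 1)\<close> on
  the labels. The following is the linear functional with coefficients \<open>c\<close>, evaluated at label \<open>e\<close>.
\<close>

definition lin :: "nat \<Rightarrow> (nat \<Rightarrow> 'a \<Rightarrow> real) \<Rightarrow> (nat \<Rightarrow> real) \<Rightarrow> 'a \<Rightarrow> real" where
  "lin r \<psi> c e = (\<Sum>i<r. c i * \<psi> i e)"

text \<open>
  Linear independence of any \<open>r\<close> vectors, in the form in which it is used: values can be
  prescribed. This form also says something about sets with fewer than \<open>r\<close> elements.
\<close>

definition generic :: "nat \<Rightarrow> (nat \<Rightarrow> 'a \<Rightarrow> real) \<Rightarrow> 'a set \<Rightarrow> bool" where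
  "generic r \<psi> V \<longleftrightarrow>
     (\<forall>W t. finite W \<and> W \<subseteq> V \<and> card W \<le> r \<longrightarrow> (\<exists>c. \<forall>e\<in>W. lin r \<psi> c e = t e))"

definition face :: "nat \<Rightarrow> (nat \<Rightarrow> 'a \<Rightarrow> real) \<Rightarrow> 'a set \<Rightarrow> 'a set \<Rightarrow> bool" where
  "face r \<psi> V S \<longleftrightarrow>
     S \<subseteq> V \<and> (\<exists>c. (\<forall>e\<in>S. lin r \<psi> c e = 0) \<and> (\<forall>e\<in>V - S. 0 < lin r \<psi> c e))"

definition all_faces :: "nat \<Rightarrow> (nat \<Rightarrow> 'a \<Rightarrow> real) \<Rightarrow> 'a set \<Rightarrow> nat \<Rightarrow> bool" where
  "all_faces r \<psi> V k \<longleftrightarrow> (\<forall>S\<subseteq>V. card S = k \<longrightarrow> face r \<psi> V S)"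

lemma homogeneous_system:
  fixes A :: "'i \<Rightarrow> 'w \<Rightarrow> real"
  assumes "finite I" "finite W" "card I < card W"
  shows "\<exists>l. (\<exists>e\<in>W. l e \<noteq> 0) \<and> (\<forall>i\<in>I. (\<Sum>e\<in>W. l e * A i e) = 0)"
  using assms
proof (induction I arbitrary: W A rule: finite_induct)
  case empty
  then have "W \<noteq> {}" by auto
  then show ?case by (intro exI[of _ "\<lambda>_. 1"]) auto
next
  case (insert i I)
  show ?case
  proof (cases "\<forall>e\<in>W. A i e = 0")
    case True
    have "card I < card W" using insert.prems insert.hyps by simp
    from insert.IH[OF insert.prems(1) this, of A]
    obtain l where l: "\<exists>e\<in>W. l e \<noteq> 0" "\<forall>j\<in>I. (\<Sum>e\<in>W. l e * A j e) = 0" by blast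
    have "(\<Sum>e\<in>W. l e * A i e) = 0" using True by (intro sum.neutral) simp
    with l show ?thesis by (intro exI[of _ l]) simp
  next
    case False
    then obtain z where z: "z \<in> W" "A i z \<noteq> 0" by blast
    \<comment> \<open>The equation \<open>i\<close> is solved for the unknown at \<open>z\<close>, which is eliminated from the others.\<close>
    define B where "B = (\<lambda>j e. A j e - A j z / A i z * A i e)"
    have "card I < card (W - {z})"
      using insert.prems insert.hyps z by auto
    from insert.IH[OF _ this, of B] insert.prems(1)
    obtain l where l: "\<exists>e\<in>W - {z}. l e \<noteq> 0" "\<forall>j\<in>I. (\<Sum>e\<in>W - {z}. l e * B j e) = 0" by blast
    define s where "s = (\<Sum>e\<in>W - {z}. l e * A i e)"
    define m where "m = l(z := - s / A i z)"
    have split: "(\<Sum>e\<in>W. m e * A j e) = - s / A i z * A j z + (\<Sum>e\<in>W - {z}. l e * A j e)" for j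
    proof -
      have "(\<Sum>e\<in>W. m e * A j e) = m z * A j z + (\<Sum>e\<in>W - {z}. m e * A j e)"
        using z insert.prems by (simp add: sum.remove)
      also have "(\<Sum>e\<in>W - {z}. m e * A j e) = (\<Sum>e\<in>W - {z}. l e * A j e)"
        by (rule sum.cong) (auto simp: m_def)
      finally show ?thesis by (simp add: m_def)
    qed
    have "(\<Sum>e\<in>W. m e * A i e) = 0"
      unfolding split using z by (simp add: s_def)
    moreover have "(\<Sum>e\<in>W. m e * A j e) = 0" if "j \<in> I" for j
    proof -
      have "(\<Sum>e\<in>W - {z}. l e * B j e) = (\<Sum>e\<in>W - {z}. l e * A j e) - A j z / A i z * s"
        unfolding B_def s_def sum_distrib_left sum_subtractf[symmetric]
        by (rule sum.cong) (auto simp: algebra_simps)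
      with l that show ?thesis unfolding split by (auto simp: algebra_simps)
    qed
    moreover have "\<exists>e\<in>W. m e \<noteq> 0" using l(1) by (auto simp: m_def)
    ultimately show ?thesis by (intro exI[of _ m]) simp
  qed
qed

lemma lin_add: "lin r \<psi> (\<lambda>i. c i + c' i) e = lin r \<psi> c e + lin r \<psi> c' e"
  by (simp add: lin_def sum.distrib algebra_simps)

lemma lin_scale: "lin r \<psi> (\<lambda>i. x * c i) e = x * lin r \<psi> c e"
  by (simp add: lin_def sum_distrib_left algebra_simps)

lemma lin_combine: "lin r \<psi> (\<lambda>i. x * c i + y * c' i) e = x * lin r \<psi> c e + y * lin r \<psi> c' e"
  by (simp add: lin_add lin_scale)

lemma lin_pencil: "lin r \<psi> (\<lambda>i. c i + t * c' i) e = lin r \<psi> c e + t * lin r \<psi> c' e"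
  by (simp add: lin_add lin_scale)

lemma lin_zero: "(\<And>i. i < r \<Longrightarrow> c i = 0) \<Longrightarrow> lin r \<psi> c e = 0"
  by (simp add: lin_def)

lemma lin_cong: "(\<And>i. i < r \<Longrightarrow> c i = c' i) \<Longrightarrow> lin r \<psi> c e = lin r \<psi> c' e"
  by (simp add: lin_def)

lemma vanishing_exists:
  assumes "finite W" "card W < r"
  shows "\<exists>c. (\<exists>i<r. c i \<noteq> 0) \<and> (\<forall>e\<in>W. lin r \<psi> c e = 0)"
  using homogeneous_system[of W "{..<r}" "\<lambda>e i. \<psi> i e"] assms
  by (auto simp: lin_def)

lemma generic_subset: "generic r \<psi> V \<Longrightarrow> V' \<subseteq> V \<Longrightarrow> generic r \<psi> V'"
  unfolding generic_def by blast

lemma genericD: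
  assumes "generic r \<psi> V" "finite W" "W \<subseteq> V" "card W \<le> r"
  obtains c where "\<And>e. e \<in> W \<Longrightarrow> lin r \<psi> c e = t e"
  using assms unfolding generic_def by meson

lemma generic_no_relation:
  assumes g: "generic r \<psi> V" and W: "finite W" "W \<subseteq> V" "card W \<le> r"
    and l: "\<And>c. (\<Sum>x\<in>W. l x * lin r \<psi> c x) = 0" and e: "e \<in> W"
  shows "l e = 0"
proof -
  obtain c where c: "\<And>x. x \<in> W \<Longrightarrow> lin r \<psi> c x = l x"
    using genericD[OF g W, of l] by blast
  have "(\<Sum>x\<in>W. l x * l x) = 0" using l[of c] c by simp
  then have "\<forall>x\<in>W. l x = 0" using W by (subst (asm) sum_nonneg_eq_0_iff) auto
  with e show ?thesis by simp
qed

text \<open>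
  A square matrix with independent rows has independent columns: a nonzero \<open>c\<close> would make one
  coordinate dependent on the others over \<open>W\<close>, so some relation among the vectors labeled by \<open>W\<close>
  would satisfy all equations.
\<close>

lemma generic_vanish:
  assumes g: "generic r \<psi> V" and W: "finite W" "W \<subseteq> V" "card W = r"
    and c: "\<And>e. e \<in> W \<Longrightarrow> lin r \<psi> c e = 0" and i: "i < r"
  shows "c i = 0"
proof (rule ccontr)
  assume ci: "c i \<noteq> 0"
  have "card ({..<r} - {i}) < card W" using W i by simp
  from homogeneous_system[OF _ W(1) this, of \<psi>]
  obtain l where l: "\<exists>e\<in>W. l e \<noteq> 0" "\<forall>j\<in>{..<r} - {i}. (\<Sum>e\<in>W. l e * \<psi> j e) = 0" by auto
  have sw: "(\<Sum>e\<in>W. l e * lin r \<psi> b e) = (\<Sum>j<r. b j * (\<Sum>e\<in>W. l e * \<psi> j e))" for b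
  proof -
    have "(\<Sum>e\<in>W. l e * lin r \<psi> b e) = (\<Sum>e\<in>W. \<Sum>j<r. b j * (l e * \<psi> j e))"
      by (simp add: lin_def sum_distrib_left algebra_simps)
    then show ?thesis by (subst (asm) sum.swap) (simp add: sum_distrib_left)
  qed
  have single: "(\<Sum>j<r. b j * (\<Sum>e\<in>W. l e * \<psi> j e)) = b i * (\<Sum>e\<in>W. l e * \<psi> i e)" for b
    using l i by (subst sum.remove[of _ i]) auto
  have "c i * (\<Sum>e\<in>W. l e * \<psi> i e) = 0"
    using sw[of c] single[of c] c by simp
  with ci have "(\<Sum>e\<in>W. l e * \<psi> i e) = 0" by simp
  then have "(\<Sum>e\<in>W. l e * lin r \<psi> b e) = 0" for b using sw single by simp
  from generic_no_relation[OF g W(1,2) _ this] W l show False by auto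
qed

lemma generic_vanish_card:
  assumes g: "generic r \<psi> V" and "finite W" "W \<subseteq> V" "r \<le> card W"
    and c: "\<And>e. e \<in> W \<Longrightarrow> lin r \<psi> c e = 0"
  shows "lin r \<psi> c x = 0"
proof -
  obtain U where U: "U \<subseteq> W" "card U = r" "finite U"
    using assms by (meson obtain_subset_with_card_n)
  have "c i = 0" if "i < r" for i
    using generic_vanish[OF g U(3) _ U(2) _ that] U assms by blast
  then show ?thesis by (rule lin_zero)
qed

text \<open>
  Functionals that vanish on \<open>r - 1\<close> labels are unique up to a factor. The factor is expressed by the
  values at one further label, so that both functionals may vanish.
\<close>

lemma generic_proportional:
  assumes g: "generic r \<psi> V" and W: "finite W" "W \<subseteq> V" "card W + 1 = r"
    and x: "x \<in> V" "x \<notin> W"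
    and c: "\<And>e. e \<in> W \<Longrightarrow> lin r \<psi> c e = 0" and d: "\<And>e. e \<in> W \<Longrightarrow> lin r \<psi> d e = 0"
    and i: "i < r"
  shows "lin r \<psi> d x * c i = lin r \<psi> c x * d i"
proof -
  define b where "b = (\<lambda>i. lin r \<psi> d x * c i + (- lin r \<psi> c x) * d i)"
  have lb: "lin r \<psi> b e = lin r \<psi> d x * lin r \<psi> c e + (- lin r \<psi> c x) * lin r \<psi> d e" for e
    unfolding b_def by (rule lin_combine)
  have "card (insert x W) = r" using W x by simp
  moreover have "lin r \<psi> b e = 0" if "e \<in> insert x W" for e
    using that c[of e] d[of e] by (auto simp: lb)
  ultimately have "b i = 0"
    using generic_vanish[OF g, of "insert x W" b i] W x i by blast
  then show ?thesis by (simp add: b_def)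
qed

lemma faceI:
  assumes "S \<subseteq> V" "\<forall>e\<in>S. lin r \<psi> c e = 0" "\<forall>e\<in>V - S. 0 < lin r \<psi> c e"
  shows "face r \<psi> V S"
  using assms unfolding face_def by blast

lemma faceE:
  assumes "face r \<psi> V S"
  obtains c where "S \<subseteq> V" "\<forall>e\<in>S. lin r \<psi> c e = 0" "\<forall>e\<in>V - S. 0 < lin r \<psi> c e"
  using assms unfolding face_def by blast

text \<open>
  Faces are simplices: add a small multiple of a functional that is \<open>0\<close> on \<open>S'\<close> and \<open>1\<close> on the rest
  of \<open>S\<close>.
\<close>

lemma face_subset:
  assumes g: "generic r \<psi> V" and V: "finite V" and f: "face r \<psi> V S"
    and S: "S' \<subseteq> S" "card S \<le> r"
  shows "face r \<psi> V S'"
proof -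
  obtain c where c: "S \<subseteq> V" "\<And>e. e \<in> S \<Longrightarrow> lin r \<psi> c e = 0" "\<And>e. e \<in> V - S \<Longrightarrow> 0 < lin r \<psi> c e"
    using f by (auto simp: face_def)
  have finS: "finite S" using V c(1) finite_subset by blast
  obtain b where b: "\<And>e. e \<in> S \<Longrightarrow> lin r \<psi> b e = (if e \<in> S' then 0 else 1)"
    using genericD[OF g finS c(1) S(2), of "\<lambda>e. if e \<in> S' then 0 else 1"] by blast
  have "\<forall>\<^sub>F t in at_right 0. \<forall>e\<in>V - S. 0 < lin r \<psi> c e + t * lin r \<psi> b e"
  proof (rule eventually_ball_finite)
    show "finite (V - S)" using V by simp
    show "\<forall>e\<in>V - S. \<forall>\<^sub>F t in at_right 0. 0 < lin r \<psi> c e + t * lin r \<psi> b e"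
    proof
      fix e assume e: "e \<in> V - S"
      have "((\<lambda>t. lin r \<psi> c e + t * lin r \<psi> b e) \<longlongrightarrow> lin r \<psi> c e + 0 * lin r \<psi> b e) (at_right 0)"
        by (intro tendsto_intros)
      then show "\<forall>\<^sub>F t in at_right 0. 0 < lin r \<psi> c e + t * lin r \<psi> b e"
        using c(3)[OF e] by (intro order_tendstoD(1)) auto
    qed
  qed
  moreover have "\<forall>\<^sub>F t in at_right 0. (0::real) < t" by (simp add: eventually_at_right_less)
  ultimately have "\<forall>\<^sub>F t in at_right 0. 0 < t \<and> (\<forall>e\<in>V - S. 0 < lin r \<psi> c e + t * lin r \<psi> b e)"
    by eventually_elim simp
  from eventually_happens'[OF trivial_limit_at_right_real this]
  obtain t where t: "0 < t" "\<And>e. e \<in> V - S \<Longrightarrow> 0 < lin r \<psi> c e + t * lin r \<psi> b e"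
    by blast
  define a where "a = (\<lambda>i. c i + t * b i)"
  have la: "lin r \<psi> a e = lin r \<psi> c e + t * lin r \<psi> b e" for e
    unfolding a_def by (rule lin_pencil)
  have "lin r \<psi> a e = 0" if "e \<in> S'" for e
    using that S(1) b[of e] c(2)[of e] by (auto simp: la)
  moreover have "0 < lin r \<psi> a e" if "e \<in> V - S'" for e
  proof (cases "e \<in> S")
    case True
    then show ?thesis using that t(1) b[of e] c(2)[of e] by (simp add: la)
  next
    case False
    then show ?thesis using that t(2)[of e] by (simp add: la)
  qed
  ultimately show ?thesis using S c(1) unfolding face_def by blast
qed

lemma face_card:
  assumes g: "generic r \<psi> V" and V: "finite V" and f: "face r \<psi> V S" and x: "x \<in> V - S"
  shows "card S < r"
proof (rule ccontr)
  assume "\<not> card S < r"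
  then have "r \<le> card S" by simp
  obtain c where c: "S \<subseteq> V" "\<And>e. e \<in> S \<Longrightarrow> lin r \<psi> c e = 0" "\<And>e. e \<in> V - S \<Longrightarrow> 0 < lin r \<psi> c e"
    using f by (auto simp: face_def)
  have "finite S" using V c(1) finite_subset by blast
  have "lin r \<psi> c x = 0"
    using generic_vanish_card[OF g \<open>finite S\<close> c(1) \<open>r \<le> card S\<close> c(2)] .
  with c(3)[OF x] show False by simp
qed

text \<open>
  A supporting functional of \<open>S\<close> is rotated about \<open>S\<close> and \<open>x\<close> until it hits another label. Its value
  at \<open>x\<close> does not change, so \<open>x\<close> stays off the face.
\<close>

lemma extend_to_facet:
  assumes g: "generic r \<psi> V" and V: "finite V" "r \<le> card V" and f: "face r \<psi> V S" and x: "x \<in> V - S"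
  shows "\<exists>F. S \<subseteq> F \<and> face r \<psi> V F \<and> x \<notin> F \<and> card F + 1 = r"
  using f x
proof (induction "r - card S" arbitrary: S rule: less_induct)
  case less
  have Scard: "card S < r" using face_card[OF g V(1) less.prems] .
  show ?case
  proof (cases "card S + 1 = r")
    case True
    with less.prems show ?thesis by auto
  next
    case False
    with Scard have S2: "card S + 2 \<le> r" by simp
    obtain c where c: "S \<subseteq> V" "\<And>e. e \<in> S \<Longrightarrow> lin r \<psi> c e = 0" "\<And>e. e \<in> V - S \<Longrightarrow> 0 < lin r \<psi> c e"
      using less.prems by (auto simp: face_def)
    have finS: "finite S" using V c(1) finite_subset by blast
    have "card (insert x S) < card V" using S2 V less.prems finS by auto
    then obtain y where y: "y \<in> V" "y \<notin> insert x S"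
      by (meson V(1) c(1) card_mono finS finite_insert leD subsetI)
    have cW: "card (insert y (insert x S)) \<le> r" using S2 y less.prems finS by auto
    have "finite (insert y (insert x S))" "insert y (insert x S) \<subseteq> V"
      using finS y less.prems c(1) by auto
    from genericD[OF g this cW, of "\<lambda>e. if e = y then -1 else 0"]
    obtain b where b: "\<And>e. e \<in> insert y (insert x S) \<Longrightarrow> lin r \<psi> b e = (if e = y then -1 else 0)" by blast
    define N where "N = {e \<in> V - S. lin r \<psi> b e < 0}"
    define t where "t = Min ((\<lambda>e. lin r \<psi> c e / (- lin r \<psi> b e)) ` N)"
    have N: "finite N" "y \<in> N" using V y b[of y] by (auto simp: N_def)
    have tle: "t \<le> lin r \<psi> c e / (- lin r \<psi> b e)" if "e \<in> N" for e
      unfolding t_def using N that by (intro Min_le) auto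
    have "t \<in> (\<lambda>e. lin r \<psi> c e / (- lin r \<psi> b e)) ` N"
      unfolding t_def using N by (intro Min_in) auto
    then obtain z where z: "z \<in> N" "t = lin r \<psi> c z / (- lin r \<psi> b z)" by auto
    have zN: "lin r \<psi> b z < 0" "0 < lin r \<psi> c z" "z \<in> V" "z \<notin> S"
      using z(1) c(3)[of z] by (auto simp: N_def)
    have tpos: "t > 0" unfolding z(2) using zN by (intro divide_pos_pos) auto
    have tz: "lin r \<psi> c z + t * lin r \<psi> b z = 0" unfolding z(2) using zN by simp
    define a where "a = (\<lambda>i. c i + t * b i)"
    have la: "lin r \<psi> a e = lin r \<psi> c e + t * lin r \<psi> b e" for e
      unfolding a_def by (rule lin_pencil)
    have nn: "lin r \<psi> a e \<ge> 0" if "e \<in> V - S" for e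
    proof (cases "lin r \<psi> b e < 0")
      case True
      with that have "e \<in> N" by (simp add: N_def)
      from tle[OF this] True show ?thesis unfolding la by (simp add: divide_simps algebra_simps split: if_splits)
    next
      case False
      then show ?thesis unfolding la using tpos c(3)[OF that] by simp
    qed
    define S' where "S' = {e \<in> V. lin r \<psi> a e = 0}"
    have "S \<subseteq> S'" using c b y by (auto simp: S'_def la)
    have "z \<in> S'" using zN tz by (simp add: S'_def la)
    have xS: "x \<notin> S'" using less.prems c(3)[of x] b[of x] y by (auto simp: S'_def la)
    have S'pos: "lin r \<psi> a e > 0" if "e \<in> V - S'" for e
      using that nn[of e] \<open>S \<subseteq> S'\<close> by (force simp: S'_def)
    have face: "face r \<psi> V S'" unfolding face_def
      using S'pos by (intro conjI exI[of _ a]) (auto simp: S'_def)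
    have "card S < card S'"
      using \<open>S \<subseteq> S'\<close> \<open>z \<in> S'\<close> zN V by (intro psubset_card_mono) (auto simp: S'_def)
    moreover have "x \<in> V - S'" using xS less.prems by simp
    moreover from face_card[OF g V(1) face this] have "card S' < r" .
    ultimately obtain F where "S' \<subseteq> F" "face r \<psi> V F" "x \<notin> F" "card F + 1 = r"
      using less.hyps[of S'] face by force
    with \<open>S \<subseteq> S'\<close> show ?thesis by blast
  qed
qed

definition faces_avoiding :: "nat \<Rightarrow> (nat \<Rightarrow> 'a \<Rightarrow> real) \<Rightarrow> 'a set \<Rightarrow> 'a \<Rightarrow> 'a set set" where
  "faces_avoiding r \<psi> V p = {R. R \<subseteq> V - {p} \<and> face r \<psi> V R}"

lemma face_restrict: "face r \<psi> V S \<Longrightarrow> S \<subseteq> V' \<Longrightarrow> V' \<subseteq> V \<Longrightarrow> face r \<psi> V' S"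
  unfolding face_def by blast

lemma all_faces_restrict: "all_faces r \<psi> V k \<Longrightarrow> V' \<subseteq> V \<Longrightarrow> all_faces r \<psi> V' k"
  unfolding all_faces_def by (auto intro!: face_restrict[of r \<psi> V _ V'])

lemma all_faces_le:
  assumes "generic r \<psi> V" "finite V" "all_faces r \<psi> V k" "k \<le> r" "k \<le> card V" "S \<subseteq> V" "card S \<le> k"
  shows "face r \<psi> V S"
proof -
  obtain T where T: "S \<subseteq> T" "T \<subseteq> V" "card T = k"
    using exists_subset_between[of S k V] assms(2,5-7) by blast
  then have "face r \<psi> V T" using assms(3) by (simp add: all_faces_def)
  from face_subset[OF assms(1,2) this T(1)] show ?thesis using T assms(4) by simp
qed

section \<open>Linear relations and inseparable labels\<close>

definition relation :: "nat \<Rightarrow> (nat \<Rightarrow> 'a \<Rightarrow> real) \<Rightarrow> 'a set \<Rightarrow> ('a \<Rightarrow> real) \<Rightarrow> bool" where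
  "relation r \<psi> W l \<longleftrightarrow>
     (\<exists>e\<in>W. l e \<noteq> 0) \<and> (\<forall>c. (\<Sum>e\<in>W. l e * lin r \<psi> c e) = 0)"

text \<open>
  Equivalently, no hyperplane spanned by other labels separates \<open>u\<close> from \<open>v\<close>, see \<open>inseparableI\<close>.
\<close>

definition inseparable :: "nat \<Rightarrow> (nat \<Rightarrow> 'a \<Rightarrow> real) \<Rightarrow> 'a set \<Rightarrow> 'a \<Rightarrow> 'a \<Rightarrow> bool" where
  "inseparable r \<psi> V u v \<longleftrightarrow>
     (\<forall>W l. W \<subseteq> V \<and> card W = r + 1 \<and> u \<in> W \<and> v \<in> W \<and> relation r \<psi> W l \<longrightarrow> l u * l v < 0)"

lemma relation_exists:
  assumes "finite W" "card W = r + 1"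
  shows "\<exists>l. relation r \<psi> W l"
proof -
  obtain l where l: "\<exists>e\<in>W. l e \<noteq> 0" "\<forall>i\<in>{..<r}. (\<Sum>e\<in>W. l e * \<psi> i e) = 0"
    using homogeneous_system[of "{..<r}" W \<psi>] assms by auto
  have "(\<Sum>e\<in>W. l e * lin r \<psi> c e) = 0" for c
  proof -
    have "(\<Sum>e\<in>W. l e * lin r \<psi> c e) = (\<Sum>e\<in>W. \<Sum>i<r. c i * (l e * \<psi> i e))"
      by (simp add: lin_def sum_distrib_left algebra_simps)
    also have "\<dots> = (\<Sum>i<r. c i * (\<Sum>e\<in>W. l e * \<psi> i e))"
      by (subst sum.swap) (simp add: sum_distrib_left)
    finally show ?thesis using l by simp
  qed
  with l show ?thesis by (auto simp: relation_def)
qed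

lemma relation_nonzero:
  assumes g: "generic r \<psi> V" and W: "finite W" "W \<subseteq> V" "card W = r + 1"
    and l: "relation r \<psi> W l" and e: "e \<in> W"
  shows "l e \<noteq> 0"
proof
  assume 0: "l e = 0"
  have "card (W - {e}) \<le> r" using W e by simp
  moreover have "finite (W - {e})" "W - {e} \<subseteq> V" using W by auto
  ultimately obtain c where c: "\<And>x. x \<in> W - {e} \<Longrightarrow> lin r \<psi> c x = l x"
    using genericD[OF g, of "W - {e}" l] by blast
  have "(\<Sum>x\<in>W. l x * lin r \<psi> c x) = (\<Sum>x\<in>W. l x * l x)"
    by (rule sum.cong) (use c 0 in auto)
  then have "(\<Sum>x\<in>W. l x * l x) = 0" using l by (simp add: relation_def)
  then have "\<forall>x\<in>W. l x = 0" using W by (subst (asm) sum_nonneg_eq_0_iff) auto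
  with l show False by (auto simp: relation_def)
qed

lemma relation_uminus: "relation r \<psi> W l \<Longrightarrow> relation r \<psi> W (\<lambda>e. - l e)"
  by (simp add: relation_def sum_negf)

text \<open>
  Pairing the relation with a supporting functional of \<open>S\<close> leaves a sum of nonpositive terms equal to
  zero.
\<close>

lemma relation_face:
  assumes l: "relation r \<psi> W l" and W: "finite W" "W \<subseteq> V" and S: "face r \<psi> V S"
    and pos: "{e \<in> W. 0 < l e} \<subseteq> S"
  shows "{e \<in> W. l e < 0} \<subseteq> S"
proof
  fix z assume z: "z \<in> {e \<in> W. l e < 0}"
  obtain c where c: "S \<subseteq> V" "\<And>e. e \<in> S \<Longrightarrow> lin r \<psi> c e = 0" "\<And>e. e \<in> V - S \<Longrightarrow> 0 < lin r \<psi> c e"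
    using S by (auto simp: face_def)
  have nn: "0 \<le> - (l e * lin r \<psi> c e)" if "e \<in> W" for e
  proof (cases "e \<in> S")
    case False
    then have "l e \<le> 0" "0 < lin r \<psi> c e" using that pos W c(3)[of e] by force+
    then show ?thesis by (simp add: mult_nonpos_nonneg)
  qed (simp add: c(2))
  have "(\<Sum>e\<in>W. - (l e * lin r \<psi> c e)) = 0" using l by (simp add: relation_def sum_negf)
  then have "- (l z * lin r \<psi> c z) = 0"
    using sum_nonneg_eq_0_iff[OF W(1), of "\<lambda>e. - (l e * lin r \<psi> c e)"] nn z by blast
  then have "lin r \<psi> c z = 0" using z by simp
  then show "z \<in> S" using c(3)[of z] z W by fastforce
qed

lemma relation_positive_card:
  assumes g: "generic (2 * k + 1) \<psi> V" and V: "finite V" and nb: "all_faces (2 * k + 1) \<psi> V k"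
    and W: "W \<subseteq> V" "card W = 2 * k + 2" and l: "relation (2 * k + 1) \<psi> W l"
  shows "k + 1 \<le> card {e \<in> W. 0 < l e}"
proof (rule ccontr)
  assume "\<not> ?thesis"
  then have small: "card {e \<in> W. 0 < l e} \<le> k" by simp
  have fW: "finite W" using V W(1) finite_subset by blast
  have "card W \<le> card V" using V W(1) card_mono by blast
  then obtain S where S: "{e \<in> W. 0 < l e} \<subseteq> S" "S \<subseteq> V" "card S = k"
    using exists_subset_between[of "{e \<in> W. 0 < l e}" k V] small W V by auto
  then have "face (2 * k + 1) \<psi> V S" using nb by (simp add: all_faces_def)
  from relation_face[OF l fW W(1) this S(1)] have "{e \<in> W. l e < 0} \<subseteq> S" .
  moreover have "l e \<noteq> 0" if "e \<in> W" for e
    using relation_nonzero[OF g fW W(1) _ l that] W(2) by simp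
  ultimately have "W \<subseteq> S" using S(1) by (auto simp: neq_iff)
  then have "card W \<le> k" using S card_mono[of S W] V finite_subset[of S V] by simp
  with W show False by simp
qed

text \<open>
  In a neighborly configuration every Radon partition is balanced, because a part with at most \<open>k\<close>
  labels would lie in a face that misses part of the other one.
\<close>

lemma relation_side:
  assumes g: "generic (2 * k + 1) \<psi> V" and V: "finite V" and nb: "all_faces (2 * k + 1) \<psi> V k"
    and W: "W \<subseteq> V" "card W = 2 * k + 2" and l: "relation (2 * k + 1) \<psi> W l"
  shows "card {e \<in> W. 0 < l e} = k + 1" "\<not> face (2 * k + 1) \<psi> V {e \<in> W. 0 < l e}"
proof -
  have fW: "finite W" using V W(1) finite_subset by blast
  have p: "k + 1 \<le> card {e \<in> W. 0 < l e}"
    using relation_positive_card[OF g V nb W l] .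
  have n: "k + 1 \<le> card {e \<in> W. l e < 0}"
    using relation_positive_card[OF g V nb W relation_uminus[OF l]] by simp
  have "card {e \<in> W. 0 < l e} + card {e \<in> W. l e < 0} = card ({e \<in> W. 0 < l e} \<union> {e \<in> W. l e < 0})"
    using fW by (subst card_Un_disjoint) auto
  also have "\<dots> \<le> card W" using fW by (intro card_mono) auto
  finally show "card {e \<in> W. 0 < l e} = k + 1" using p n W by simp
  show "\<not> face (2 * k + 1) \<psi> V {e \<in> W. 0 < l e}"
  proof
    assume "face (2 * k + 1) \<psi> V {e \<in> W. 0 < l e}"
    from relation_face[OF l fW W(1) this] have "{e \<in> W. l e < 0} = {}" by force
    then have "card {e \<in> W. l e < 0} = 0" by (simp only: card.empty)
    with n show False by linarith
  qed
qed

lemma inseparable_sym: "inseparable r \<psi> V u v \<Longrightarrow> inseparable r \<psi> V v u"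
  unfolding inseparable_def by (metis mult.commute)

text \<open>
  The relations on \<open>r + 2\<close> vectors form a plane: a combination of three of them can be made to vanish
  at two labels, and then it has too small a support to be nonzero.
\<close>

lemma relations_dependent:
  fixes l1 l2 l3 :: "'a \<Rightarrow> real"
  assumes g: "generic r \<psi> V" and U: "finite U" "U \<subseteq> V" "card U = r + 2"
    and l1: "\<And>c. (\<Sum>e\<in>U. l1 e * lin r \<psi> c e) = 0"
    and l2: "\<And>c. (\<Sum>e\<in>U. l2 e * lin r \<psi> c e) = 0"
    and l3: "\<And>c. (\<Sum>e\<in>U. l3 e * lin r \<psi> c e) = 0"
  shows "\<exists>x y z. \<not> (x = 0 \<and> y = 0 \<and> z = 0) \<and> (\<forall>e\<in>U. x * l1 e + y * l2 e + z * l3 e = 0)"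
proof -
  obtain T where T: "T \<subseteq> U" "card T = 2" "finite T"
    using obtain_subset_with_card_n[of 2 U] U by force
  define I where "I = {0, 1, 2::nat}"
  define L where "L = (\<lambda>e (j::nat). if j = 0 then l1 e else if j = 1 then l2 e else l3 e)"
  have sumI: "(\<Sum>j\<in>I. f j) = f 0 + f 1 + f 2" for f :: "nat \<Rightarrow> real"
    unfolding I_def by simp
  have "card T < card I" using T by (simp add: I_def)
  moreover have "finite I" by (simp add: I_def)
  ultimately obtain a where a: "\<exists>j\<in>I. a j \<noteq> 0" "\<forall>e\<in>T. (\<Sum>j\<in>I. a j * L e j) = 0"
    using homogeneous_system[OF T(3), of I L] by blast
  define m where "m = (\<lambda>e. a 0 * l1 e + a 1 * l2 e + a 2 * l3 e)"
  have mT: "m e = 0" if "e \<in> T" for e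
    using a(2) that unfolding sumI m_def L_def by simp
  have m0: "(\<Sum>e\<in>U. m e * lin r \<psi> c e) = 0" for c
  proof -
    have "(\<Sum>e\<in>U. m e * lin r \<psi> c e) = a 0 * (\<Sum>e\<in>U. l1 e * lin r \<psi> c e)
        + a 1 * (\<Sum>e\<in>U. l2 e * lin r \<psi> c e) + a 2 * (\<Sum>e\<in>U. l3 e * lin r \<psi> c e)"
      unfolding sum_distrib_left sum.distrib[symmetric] m_def
      by (rule sum.cong) (simp_all add: algebra_simps)
    then show ?thesis using l1 l2 l3 by simp
  qed
  have "m e = 0" if e: "e \<in> U" for e
  proof (cases "e \<in> T")
    case False
    have "(\<Sum>e\<in>U - T. m e * lin r \<psi> c e) = 0" for c
    proof -
      have "(\<Sum>e\<in>U - T. m e * lin r \<psi> c e) = (\<Sum>e\<in>U. m e * lin r \<psi> c e)"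
        using U T mT by (intro sum.mono_neutral_left) auto
      then show ?thesis using m0 by simp
    qed
    moreover have "card (U - T) \<le> r" using U T by (simp add: card_Diff_subset)
    ultimately show ?thesis
      using generic_no_relation[OF g, of "U - T" m e] U False e by blast
  qed (simp add: mT)
  then have "\<forall>e\<in>U. a 0 * l1 e + a 1 * l2 e + a 2 * l3 e = 0" by (simp add: m_def)
  moreover have "\<not> (a 0 = 0 \<and> a 1 = 0 \<and> a 2 = 0)" using a(1) by (auto simp: I_def)
  ultimately show ?thesis by blast
qed

lemma relation_extend:
  assumes "relation r \<psi> W l" "W \<subseteq> U" "finite U"
  shows "(\<Sum>e\<in>U. (if e \<in> W then l e else 0) * lin r \<psi> c e) = 0"
proof -
  have "(\<Sum>e\<in>U. (if e \<in> W then l e else 0) * lin r \<psi> c e) = (\<Sum>e\<in>W. l e * lin r \<psi> c e)"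
    using assms by (intro sum.mono_neutral_cong_right) auto
  then show ?thesis using assms by (simp add: relation_def)
qed

lemma relation_signed:
  assumes g: "generic r \<psi> V" and W: "finite W" "W \<subseteq> V" "card W = r + 1" and e: "e \<in> W"
  obtains l where "relation r \<psi> W l" "0 < l e"
proof -
  obtain l where l: "relation r \<psi> W l" using relation_exists W by blast
  have "l e \<noteq> 0" using relation_nonzero[OF g W l e] .
  then consider "0 < l e" | "0 < - l e" by linarith
  then show ?thesis using that[of l] that[of "\<lambda>e. - l e"] l relation_uminus[OF l] by cases auto
qed

lemma opposite_sgn:
  fixes a b x y :: real
  assumes "a * x + b * y = 0" "0 < x" "0 < y"
  shows "sgn a = - sgn b"
proof -
  have "a * x = - (b * y)" using assms by simp
  then have "sgn (a * x) = sgn (- (b * y))" by simp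
  then show ?thesis using assms by (simp add: sgn_mult sgn_minus)
qed

text \<open>
  On \<open>r + 2\<close> labels containing \<open>v\<close> and three partners, consider the three relations that omit one
  partner, normalized to be negative at \<open>v\<close> and hence positive at the other partners. In a linear
  dependency between them, any two coefficients have opposite signs, so all vanish.
\<close>

lemma inseparable_at_most_two:
  assumes g: "generic r \<psi> V" and V: "finite V" "r + 2 \<le> card V" and r: "2 \<le> r"
    and w: "v \<in> V" "w1 \<in> V" "w2 \<in> V" "w3 \<in> V"
    and dist: "v \<noteq> w1" "v \<noteq> w2" "v \<noteq> w3" "w1 \<noteq> w2" "w1 \<noteq> w3" "w2 \<noteq> w3"
    and i: "inseparable r \<psi> V v w1" "inseparable r \<psi> V v w2" "inseparable r \<psi> V v w3"
  shows False
proof -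
  have "card {v, w1, w2, w3} = 4" using dist by simp
  then obtain U where U: "{v, w1, w2, w3} \<subseteq> U" "U \<subseteq> V" "card U = r + 2"
    using exists_subset_between[of "{v, w1, w2, w3}" "r + 2" V] V r w by auto
  have fU: "finite U" using U V finite_subset by blast
  have rel: "\<exists>l. relation r \<psi> (U - {w}) l \<and> l v < 0" if "w \<in> {w1, w2, w3}" for w
  proof -
    have "w \<in> U" "v \<in> U - {w}" using that U dist by auto
    then have "card (U - {w}) = r + 1" using U fU by simp
    from relation_signed[OF g _ _ this \<open>v \<in> U - {w}\<close>] fU U
    obtain l where "relation r \<psi> (U - {w}) l" "0 < l v" by blast
    then show ?thesis using relation_uminus[of r \<psi> "U - {w}" l] by (intro exI[of _ "\<lambda>e. - l e"]) auto
  qed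
  obtain l1 where l1: "relation r \<psi> (U - {w1}) l1" "l1 v < 0" using rel[of w1] by blast
  obtain l2 where l2: "relation r \<psi> (U - {w2}) l2" "l2 v < 0" using rel[of w2] by blast
  obtain l3 where l3: "relation r \<psi> (U - {w3}) l3" "l3 v < 0" using rel[of w3] by blast
  have pos: "0 < l w'"
    if "relation r \<psi> (U - {w}) l" "l v < 0" "w \<in> {w1, w2, w3}" "w' \<in> {w1, w2, w3}" "w \<noteq> w'" for l w w'
  proof -
    have "w \<in> U" "v \<in> U - {w}" "w' \<in> U - {w}" using that U dist by auto
    moreover from this have "card (U - {w}) = r + 1" using U fU by simp
    moreover have "inseparable r \<psi> V v w'" using i that by auto
    ultimately have "l v * l w' < 0"
      unfolding inseparable_def using that(1) U(2) by (meson Diff_subset subset_trans)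
    with that(2) show ?thesis by (simp add: mult_less_0_iff)
  qed
  obtain x y z where xyz: "\<not> (x = 0 \<and> y = 0 \<and> z = 0)"
    "\<forall>e\<in>U. x * (if e \<in> U - {w1} then l1 e else 0) + y * (if e \<in> U - {w2} then l2 e else 0)
      + z * (if e \<in> U - {w3} then l3 e else 0) = 0"
    using relations_dependent[OF g fU U(2,3) relation_extend[OF l1(1) Diff_subset fU]
        relation_extend[OF l2(1) Diff_subset fU] relation_extend[OF l3(1) Diff_subset fU]] by blast
  have U': "w1 \<in> U" "w2 \<in> U" "w3 \<in> U" using U by auto
  have e1: "y * l2 w1 + z * l3 w1 = 0" using xyz(2)[rule_format, OF U'(1)] U' dist by simp
  have "sgn y = - sgn z"
    by (rule opposite_sgn[OF e1]) (use pos[OF l2, of w1] pos[OF l3, of w1] dist in auto)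
  moreover have e2: "x * l1 w2 + z * l3 w2 = 0" using xyz(2)[rule_format, OF U'(2)] U' dist by simp
  have "sgn x = - sgn z"
    by (rule opposite_sgn[OF e2]) (use pos[OF l1, of w2] pos[OF l3, of w2] dist in auto)
  moreover have e3: "x * l1 w3 + y * l2 w3 = 0" using xyz(2)[rule_format, OF U'(3)] U' dist by simp
  have "sgn x = - sgn y"
    by (rule opposite_sgn[OF e3]) (use pos[OF l1, of w3] pos[OF l2, of w3] dist in auto)
  ultimately have "sgn x = 0" "sgn y = 0" "sgn z = 0" by linarith+
  then show False using xyz(1) by (auto simp: sgn_0_0)
qed

text \<open>
  What the cells \<open>D\<close> on the label set \<open>E\<close> reveal about a pair of labels \<open>b\<close>, \<open>c\<close> such that \<open>b\<close> is
  inseparable both from infinity and from \<open>c\<close>. The list that defines a lifting has this property at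
  its end, and it must be recognized in another realization of the same cells.
\<close>

definition apex_pair :: "'a set set \<Rightarrow> 'a set \<Rightarrow> nat \<Rightarrow> 'a \<Rightarrow> 'a \<Rightarrow> bool" where
  "apex_pair D E k b c \<longleftrightarrow> b \<in> E \<and> c \<in> E \<and> b \<noteq> c \<and>
     (\<forall>F\<in>D. card F = 2 * k \<longrightarrow> b \<in> F \<longrightarrow> c \<in> F) \<and>
     (\<forall>R\<subseteq>E. card R = k + 1 \<longrightarrow> b \<in> R \<longrightarrow> c \<in> R \<longrightarrow> R \<in> D)"

text \<open>
  The label \<open>p\<close> plays the role of infinity. If \<open>b\<close> and \<open>p\<close> were on the same side of a Radon partition
  that has \<open>c\<close> elsewhere, then that side without \<open>p\<close> would extend to a facet missing \<open>c\<close>; the facet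
  cannot contain \<open>p\<close>, as sides are not faces, so it is a cell containing \<open>b\<close> but not \<open>c\<close>.
\<close>

lemma apex_pair_side:
  assumes g: "generic (2 * k + 1) \<psi> V" and V: "finite V" and nb: "all_faces (2 * k + 1) \<psi> V k"
    and p: "p \<in> V" and ap: "apex_pair (faces_avoiding (2 * k + 1) \<psi> V p) (V - {p}) k b c"
    and W: "W \<subseteq> V" "card W = 2 * k + 2" and l: "relation (2 * k + 1) \<psi> W l"
    and b: "b \<in> W" "0 < l b" and pW: "p \<in> W" "0 < l p"
  shows "c \<in> W \<and> 0 < l c"
proof (rule ccontr)
  assume c: "\<not> ?thesis"
  let ?A = "{e \<in> W. 0 < l e}"
  have fA: "finite ?A" using W V by (auto intro: finite_subset)
  note side = relation_side[OF g V nb W l]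
  have "card (?A - {p}) = k" using side(1) pW fA by simp
  moreover have "?A - {p} \<subseteq> V" using W(1) by auto
  ultimately have T: "face (2 * k + 1) \<psi> V (?A - {p})" using nb by (simp add: all_faces_def)
  have "c \<in> V - (?A - {p})" using c ap by (auto simp: apex_pair_def)
  moreover have "2 * k + 1 \<le> card V" using W(2) card_mono[OF V W(1)] by simp
  ultimately obtain F where F: "?A - {p} \<subseteq> F" "face (2 * k + 1) \<psi> V F" "c \<notin> F" "card F + 1 = 2 * k + 1"
    using extend_to_facet[OF g V _ T] by blast
  show False
  proof (cases "p \<in> F")
    case True
    with F have "?A \<subseteq> F" by auto
    from face_subset[OF g V F(2) this] F(4) side(2) show False by simp
  next
    case False
    with F have "F \<in> faces_avoiding (2 * k + 1) \<psi> V p" by (auto simp: faces_avoiding_def face_def)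
    moreover have "b \<in> F" using F(1) b ap by (auto simp: apex_pair_def)
    ultimately show False using ap F by (auto simp: apex_pair_def)
  qed
qed

lemma apex_pair_opposite:
  assumes g: "generic (2 * k + 1) \<psi> V" and V: "finite V" and nb: "all_faces (2 * k + 1) \<psi> V k"
    and ap: "apex_pair (faces_avoiding (2 * k + 1) \<psi> V p) (V - {p}) k b c"
    and W: "W \<subseteq> V" "card W = 2 * k + 2" and l: "relation (2 * k + 1) \<psi> W l"
    and bc: "b \<in> W" "c \<in> W" "0 < l b" and p: "p \<in> W \<Longrightarrow> l p \<le> 0"
  shows "l c < 0"
proof (rule ccontr)
  assume "\<not> l c < 0"
  moreover have fW: "finite W" using W V finite_subset by blast
  then have "l c \<noteq> 0" using relation_nonzero[OF g _ W(1) _ l bc(2)] W by simp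
  ultimately have c: "0 < l c" by linarith
  let ?A = "{e \<in> W. 0 < l e}"
  note side = relation_side[OF g V nb W l]
  have "?A \<subseteq> V - {p}" using p W by force
  then have "?A \<in> faces_avoiding (2 * k + 1) \<psi> V p"
    using ap side(1) bc c unfolding apex_pair_def by blast
  then show False using side(2) by (simp add: faces_avoiding_def)
qed

text \<open>
  By \<open>apex_pair_side\<close> only a relation that is positive at \<open>b\<close>, \<open>p\<close> and \<open>c\<close> has to be excluded. With an
  additional label \<open>z\<close>, two further relations omit \<open>c\<close> and \<open>p\<close> respectively, and their known signs
  contradict the linear dependency of the three.
\<close>

lemma apex_pair_inseparable_infinity:
  assumes g: "generic (2 * k + 1) \<psi> V" and V: "finite V" "2 * k + 3 \<le> card V"
    and nb: "all_faces (2 * k + 1) \<psi> V k"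
    and p: "p \<in> V" and ap: "apex_pair (faces_avoiding (2 * k + 1) \<psi> V p) (V - {p}) k b c"
  shows "inseparable (2 * k + 1) \<psi> V b p"
  unfolding inseparable_def
proof (intro allI impI, elim conjE)
  fix W l0 assume W: "W \<subseteq> V" "card W = 2 * k + 1 + 1" "b \<in> W" "p \<in> W" and l0: "relation (2 * k + 1) \<psi> W l0"
  let ?r = "2 * k + 1"
  have fW: "finite W" using W V finite_subset by blast
  have W2: "card W = 2 * k + 2" using W by simp
  have nz: "l0 b \<noteq> 0" "l0 p \<noteq> 0" using relation_nonzero[OF g fW W(1,2) l0] W by auto
  show "l0 b * l0 p < 0"
  proof (rule ccontr)
    assume same: "\<not> ?thesis"
    obtain l where l: "relation ?r \<psi> W l" "0 < l b" "0 < l p"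
    proof (cases "0 < l0 b")
      case True
      then have "0 < l0 p" using same nz by (simp add: mult_less_0_iff)
      with True l0 that show ?thesis by blast
    next
      case False
      then have "l0 b < 0" "l0 p < 0" using same nz by (auto simp: mult_less_0_iff)
      then show ?thesis using that[of "\<lambda>e. - l0 e"] relation_uminus[OF l0] by auto
    qed
    have c: "c \<in> W" "0 < l c"
      using apex_pair_side[OF g V(1) nb p ap W(1) W2 l(1) W(3) l(2) W(4) l(3)] by auto
    have bc: "b \<noteq> c" "b \<noteq> p" "c \<noteq> p" using ap by (auto simp: apex_pair_def)
    have "\<not> V \<subseteq> W" using card_mono[OF fW, of V] W(2) V(2) by linarith
    then obtain z where z: "z \<in> V" "z \<notin> W" by blast
    define U where "U = insert z W"
    have U: "finite U" "U \<subseteq> V" "card U = ?r + 2" using z W fW by (auto simp: U_def)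
    have Uc: "U - {c} \<subseteq> V" "card (U - {c}) = ?r + 1" "finite (U - {c})" "b \<in> U - {c}" "p \<in> U - {c}"
      using U c W bc by (auto simp: U_def)
    have Up: "U - {p} \<subseteq> V" "card (U - {p}) = ?r + 1" "finite (U - {p})" "b \<in> U - {p}" "c \<in> U - {p}"
      using U c W bc by (auto simp: U_def)
    obtain l1 where l1: "relation ?r \<psi> (U - {c}) l1" "0 < l1 b"
      using relation_signed[OF g Uc(3,1,2,4)] by blast
    obtain l2 where l2: "relation ?r \<psi> (U - {p}) l2" "0 < l2 b"
      using relation_signed[OF g Up(3,1,2,4)] by blast
    have "l1 p \<noteq> 0" using relation_nonzero[OF g Uc(3,1,2) l1(1) Uc(5)] .
    moreover have "\<not> 0 < l1 p"
      using apex_pair_side[OF g V(1) nb p ap Uc(1) _ l1(1) Uc(4) l1(2) Uc(5)] Uc(2) by auto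
    ultimately have l1p: "l1 p < 0" by linarith
    have l2c: "l2 c < 0"
      using apex_pair_opposite[OF g V(1) nb ap Up(1) _ l2(1) Up(4,5) l2(2)] Up(2) by auto
    have WU: "W \<subseteq> U" by (auto simp: U_def)
    obtain x1 x2 x3 where x: "\<not> (x1 = 0 \<and> x2 = 0 \<and> x3 = 0)"
      "\<forall>e\<in>U. x1 * (if e \<in> W then l e else 0) + x2 * (if e \<in> U - {c} then l1 e else 0)
        + x3 * (if e \<in> U - {p} then l2 e else 0) = 0"
      using relations_dependent[OF g U relation_extend[OF l(1) WU U(1)]
          relation_extend[OF l1(1) Diff_subset U(1)] relation_extend[OF l2(1) Diff_subset U(1)]] by blast
    have mU: "b \<in> U" "c \<in> U" "p \<in> U" using W c by (auto simp: U_def)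
    have "x1 * l c + x3 * l2 c = 0" using x(2)[rule_format, OF mU(2)] c bc mU by simp
    with opposite_sgn[of x1 "l c" "- x3" "- l2 c"] c l2c
    have s3: "sgn x1 = sgn x3" by (simp add: sgn_minus)
    have "x1 * l p + x2 * l1 p = 0" using x(2)[rule_format, OF mU(3)] W bc mU by simp
    with opposite_sgn[of x1 "l p" "- x2" "- l1 p"] l l1p
    have s2: "sgn x1 = sgn x2" by (simp add: sgn_minus)
    have b0: "x1 * l b + x2 * l1 b + x3 * l2 b = 0" using x(2)[rule_format, OF mU(1)] W bc mU by simp
    consider "x1 = 0" | "0 < x1" | "x1 < 0" by linarith
    then show False
    proof cases
      case 1
      then have "x2 = 0" "x3 = 0" using s2 s3 by (auto simp: sgn_0_0)
      with 1 x(1) show False by auto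
    next
      case 2
      then have "0 < x2" "0 < x3" using s2 s3 by (auto simp: sgn_1_pos)
      with 2 b0 l(2) l1(2) l2(2) show False
        using mult_pos_pos[of "x1" "l b"] mult_pos_pos[of "x2" "l1 b"] mult_pos_pos[of "x3" "l2 b"] by linarith
    next
      case 3
      then have "x2 < 0" "x3 < 0" using s2 s3 by (metis sgn_less)+
      with 3 b0 l(2) l1(2) l2(2) show False
        using mult_neg_pos[of "x1" "l b"] mult_neg_pos[of "x2" "l1 b"] mult_neg_pos[of "x3" "l2 b"] by linarith
    qed
  qed
qed

lemma apex_pair_inseparable:
  assumes g: "generic (2 * k + 1) \<psi> V" and V: "finite V"
    and nb: "all_faces (2 * k + 1) \<psi> V k"
    and i: "inseparable (2 * k + 1) \<psi> V b p" and ap: "apex_pair (faces_avoiding (2 * k + 1) \<psi> V p) (V - {p}) k b c"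
  shows "inseparable (2 * k + 1) \<psi> V b c"
  unfolding inseparable_def
proof (intro allI impI, elim conjE)
  fix W l assume W: "W \<subseteq> V" "card W = 2 * k + 1 + 1" "b \<in> W" "c \<in> W" and l: "relation (2 * k + 1) \<psi> W l"
  have fW: "finite W" using W V finite_subset by blast
  have W2: "card W = 2 * k + 2" using W by simp
  have "l b \<noteq> 0" using relation_nonzero[OF g fW W(1,2) l W(3)] .
  have p: "l b * l p < 0" if "p \<in> W" using i l W that unfolding inseparable_def by blast
  show "l b * l c < 0"
  proof (cases "0 < l b")
    case True
    then have "l p \<le> 0" if "p \<in> W" using p[OF that] by (simp add: mult_less_0_iff)
    with True have "l c < 0"
      using apex_pair_opposite[OF g V nb ap W(1) W2 l W(3,4)] by blast
    with True show ?thesis by (simp add: mult_less_0_iff)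
  next
    case False
    with \<open>l b \<noteq> 0\<close> have b: "0 < - l b" by simp
    then have "- l p \<le> 0" if "p \<in> W" using p[OF that] by (simp add: mult_less_0_iff)
    with b have "- l c < 0"
      using apex_pair_opposite[OF g V nb ap W(1) W2 relation_uminus[OF l] W(3,4)] by blast
    with b show ?thesis by (simp add: mult_less_0_iff)
  qed
qed

lemma apex_at_most_two:
  assumes g: "generic (2 * k + 1) \<psi> V" and V: "finite V" "2 * k + 3 \<le> card V" and k: "1 \<le> k"
    and nb: "all_faces (2 * k + 1) \<psi> V k" and p: "p \<in> V"
  shows "card {b. \<exists>c. apex_pair (faces_avoiding (2 * k + 1) \<psi> V p) (V - {p}) k b c} \<le> 2"
proof (rule ccontr)
  let ?B = "{b. \<exists>c. apex_pair (faces_avoiding (2 * k + 1) \<psi> V p) (V - {p}) k b c}"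
  assume "\<not> card ?B \<le> 2"
  then have "3 \<le> card ?B" by simp
  then obtain T where T: "T \<subseteq> ?B" "card T = 3" by (meson obtain_subset_with_card_n)
  then obtain b1 b2 b3 where b: "T = {b1, b2, b3}" "b1 \<noteq> b2" "b1 \<noteq> b3" "b2 \<noteq> b3"
    by (auto simp: card_3_iff)
  have *: "inseparable (2 * k + 1) \<psi> V p b \<and> b \<in> V \<and> p \<noteq> b" if bT: "b \<in> T" for b
  proof -
    obtain c where c: "apex_pair (faces_avoiding (2 * k + 1) \<psi> V p) (V - {p}) k b c" using bT T by blast
    show ?thesis
      using inseparable_sym[OF apex_pair_inseparable_infinity[OF g V nb p c]] c by (auto simp: apex_pair_def)
  qed
  show False
    by (rule inseparable_at_most_two[OF g V(1), of p b1 b2 b3]) (use * b V k p in auto)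
qed

lemma apex_partner_unique:
  assumes g: "generic (2 * k + 1) \<psi> V" and V: "finite V" "2 * k + 3 \<le> card V" and k: "1 \<le> k"
    and nb: "all_faces (2 * k + 1) \<psi> V k" and p: "p \<in> V"
    and c: "apex_pair (faces_avoiding (2 * k + 1) \<psi> V p) (V - {p}) k b c"
    and c': "apex_pair (faces_avoiding (2 * k + 1) \<psi> V p) (V - {p}) k b c'"
  shows "c = c'"
proof (rule ccontr)
  assume ne: "c \<noteq> c'"
  note i = apex_pair_inseparable_infinity[OF g V nb p c]
  note ic = apex_pair_inseparable[OF g V(1) nb i c] apex_pair_inseparable[OF g V(1) nb i c']
  show False
    by (rule inseparable_at_most_two[OF g V(1), of b p c c'])
      (use i ic c c' p ne V k in \<open>auto simp: apex_pair_def\<close>)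
qed

text \<open>
  With only \<open>2k + 2\<close> labels there is a single Radon partition. Its part opposite to \<open>b\<close> has \<open>k + 1\<close>
  labels, one of which is \<open>p\<close>, and contains all partners of \<open>b\<close>.
\<close>

lemma apex_partner_candidates:
  assumes g: "generic (2 * k + 1) \<psi> V" and V: "finite V" "card V = 2 * k + 2"
    and nb: "all_faces (2 * k + 1) \<psi> V k" and p: "p \<in> V" and b: "b \<in> V"
    and i: "inseparable (2 * k + 1) \<psi> V b p"
  shows "card {c. apex_pair (faces_avoiding (2 * k + 1) \<psi> V p) (V - {p}) k b c} \<le> k"
proof -
  have V': "card V = 2 * k + 1 + 1" using V by simp
  obtain l where l: "relation (2 * k + 1) \<psi> V l" "0 < l b"
    using relation_signed[OF g V(1) subset_refl V' b] by blast
  let ?B = "{e \<in> V. 0 < - l e}"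
  have "l b * l p < 0" using i l V' p b unfolding inseparable_def by blast
  then have "l p < 0" using l by (simp add: mult_less_0_iff)
  have "card ?B = k + 1" using relation_side(1)[OF g V(1) nb subset_refl V(2) relation_uminus[OF l(1)]] .
  moreover have "p \<in> ?B" using p \<open>l p < 0\<close> by simp
  ultimately have "card (?B - {p}) = k" using V by simp
  moreover have "{c. apex_pair (faces_avoiding (2 * k + 1) \<psi> V p) (V - {p}) k b c} \<subseteq> ?B - {p}"
  proof
    fix c assume "c \<in> {c. apex_pair (faces_avoiding (2 * k + 1) \<psi> V p) (V - {p}) k b c}"
    then have c: "apex_pair (faces_avoiding (2 * k + 1) \<psi> V p) (V - {p}) k b c" by simp
    then have "c \<in> V" "c \<noteq> p" by (auto simp: apex_pair_def)
    moreover have "l c < 0"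
      using apex_pair_opposite[OF g V(1) nb c subset_refl V(2) l(1) b \<open>c \<in> V\<close> l(2)] \<open>l p < 0\<close> by simp
    ultimately show "c \<in> ?B - {p}" by simp
  qed
  moreover have "finite (?B - {p})" using V by simp
  ultimately show ?thesis by (metis card_mono)
qed

section \<open>Lexicographic liftings\<close>

lemma opposite_product:
  fixes a b x y :: real
  assumes "a * x + b * y = 0" "0 < x * y" "b \<noteq> 0"
  shows "a * b < 0"
proof -
  have ax: "a * x = - (b * y)" using assms(1) by linarith
  have "(a * b) * (x * y) = (a * x) * (b * y)" by (simp add: mult_ac)
  also have "\<dots> = - (b * y)\<^sup>2" unfolding ax by (simp add: power2_eq_square)
  finally have e: "(a * b) * (x * y) = - (b * y)\<^sup>2" .
  have "b * y \<noteq> 0" using assms(2,3) by auto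
  then have "0 < (b * y)\<^sup>2" by simp
  with e have "(a * b) * (x * y) < 0" by linarith
  show ?thesis
  proof (rule ccontr)
    assume "\<not> a * b < 0"
    then have "0 \<le> (a * b) * (x * y)" using assms(2) mult_nonneg_nonneg[of "a * b" "x * y"] by linarith
    with \<open>(a * b) * (x * y) < 0\<close> show False by linarith
  qed
qed

lemma inseparableI:
  assumes g: "generic r \<psi> V" and V: "finite V" and uv: "u \<noteq> v"
    and *: "\<And>U c. U \<subseteq> V - {u, v} \<Longrightarrow> card U + 1 = r \<Longrightarrow> (\<And>e. e \<in> U \<Longrightarrow> lin r \<psi> c e = 0) \<Longrightarrow>
      \<exists>i<r. c i \<noteq> 0 \<Longrightarrow> 0 < lin r \<psi> c u * lin r \<psi> c v"
    and r: "1 \<le> r"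
  shows "inseparable r \<psi> V u v"
  unfolding inseparable_def
proof (intro allI impI, elim conjE)
  fix W l assume W: "W \<subseteq> V" "card W = r + 1" "u \<in> W" "v \<in> W" and l: "relation r \<psi> W l"
  have fW: "finite W" using W V finite_subset by blast
  define U where "U = W - {u, v}"
  have U: "U \<subseteq> V - {u, v}" "finite U" using W fW by (auto simp: U_def)
  have WU: "W = insert u (insert v U)" using W by (auto simp: U_def)
  have "u \<notin> insert v U" "v \<notin> U" using uv by (auto simp: U_def)
  then have "card U + 2 = card W" unfolding WU using U(2) by simp
  then have U1: "card U + 1 = r" using W by simp
  then have "card U < r" by simp
  from vanishing_exists[OF U(2) this, of \<psi>]
  obtain c where c: "\<exists>i<r. c i \<noteq> 0" "\<forall>e\<in>U. lin r \<psi> c e = 0" by blast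
  have pos: "0 < lin r \<psi> c u * lin r \<psi> c v" using *[OF U(1) U1 _ c(1)] c(2) by blast
  have "(\<Sum>e\<in>W. l e * lin r \<psi> c e) = l u * lin r \<psi> c u + l v * lin r \<psi> c v + (\<Sum>e\<in>U. l e * lin r \<psi> c e)"
    unfolding WU using \<open>u \<notin> insert v U\<close> \<open>v \<notin> U\<close> U(2) by simp
  also have "(\<Sum>e\<in>U. l e * lin r \<psi> c e) = 0" using c(2) by simp
  finally have "l u * lin r \<psi> c u + l v * lin r \<psi> c v = 0" using l by (simp add: relation_def)
  from opposite_product[OF this pos] show "l u * l v < 0"
    using relation_nonzero[OF g fW W(1,2) l W(4)] .
qed

text \<open>
  In the lifted configuration, \<open>c (r + 1)\<close> is the coefficient of the squared norm, which is also the
  value at infinity, and \<open>c r\<close> is the coefficient of the height.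
\<close>

definition lead :: "nat \<Rightarrow> (nat \<Rightarrow> real) \<Rightarrow> real" where
  "lead r c = (if c (r + 1) \<noteq> 0 then c (r + 1) else c r)"

text \<open>
  A configuration \<open>\<psi>\<close> of rank \<open>2k + 1 = r + 2\<close> on the labels of \<open>xs\<close> and \<open>0\<close> whose first \<open>r\<close> coordinates
  are \<open>\<phi>\<close> on finite labels and vanish at infinity. The decisive assumption \<open>lex\<close> says that every new
  label is dominated by the leading coefficient of functionals determined by earlier labels. The
  lower configuration is assumed to be generic only without the last label, because its vector there
  is arbitrary.
\<close>

locale lex_lift =
  fixes k r :: nat and \<phi> \<psi> :: "nat \<Rightarrow> nat \<Rightarrow> real" and xs :: "nat list"
  assumes rk: "r + 1 = 2 * k"
    and dist: "distinct xs" and zero: "0 \<notin> set xs" and len: "2 * k + 2 \<le> length xs"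
    and g_below: "generic r \<phi> (set (butlast xs))" and nb_below: "all_faces r \<phi> (set (butlast xs)) (k - 1)"
    and lin_finite: "\<And>c e. e \<in> set xs \<Longrightarrow>
      lin (2 * k + 1) \<psi> c e = lin r \<phi> c e + c r * \<psi> r e + c (r + 1) * \<psi> (r + 1) e"
    and lin_infinity: "\<And>c. lin (2 * k + 1) \<psi> c 0 = c (r + 1)"
    and g: "generic (2 * k + 1) \<psi> (insert 0 (set xs))"
    and lex: "\<And>j W c. j < length xs \<Longrightarrow> W \<subseteq> insert 0 (set (take j xs)) \<Longrightarrow> card W = 2 * k \<Longrightarrow>
      (\<And>e. e \<in> W \<Longrightarrow> lin (2 * k + 1) \<psi> c e = 0) \<Longrightarrow> \<exists>i<2 * k + 1. c i \<noteq> 0 \<Longrightarrow>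
      0 < lead r c * lin (2 * k + 1) \<psi> c (xs ! j)"
begin

abbreviation L :: "(nat \<Rightarrow> real) \<Rightarrow> nat \<Rightarrow> real" where
  "L \<equiv> lin (2 * k + 1) \<psi>"

abbreviation V :: "nat \<Rightarrow> nat set" where
  "V j \<equiv> insert 0 (set (take j xs))"

lemma k_pos: "1 \<le> k" using rk by simp

lemma take_Suc: "j < length xs \<Longrightarrow> set (take (Suc j) xs) = insert (xs ! j) (set (take j xs))"
  by (simp add: take_Suc_conv_app_nth)

lemma nth_notin: "j < length xs \<Longrightarrow> xs ! j \<notin> set (take j xs)"
  using dist by (auto simp: in_set_conv_nth nth_eq_iff_index_eq)

lemma take_butlast: "j < length xs \<Longrightarrow> set (take j xs) \<subseteq> set (butlast xs)"
  by (simp add: butlast_conv_take set_take_subset_set_take)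

lemma V_subset: "V j \<subseteq> V (length xs)"
  by (auto dest: in_set_takeD)

lemma gV: "generic (2 * k + 1) \<psi> (V j)"
  using generic_subset[OF g] V_subset[of j] by simp

lemma g_take: "j < length xs \<Longrightarrow> generic r \<phi> (set (take j xs))"
  using generic_subset[OF g_below take_butlast] .

lemma card_take: "j \<le> length xs \<Longrightarrow> card (set (take j xs)) = j"
  using dist by (simp add: distinct_card)

lemma zero_take: "0 \<notin> set (take j xs)"
  using zero by (auto dest: in_set_takeD)

lemma card_V: "j \<le> length xs \<Longrightarrow> card (V j) = j + 1"
  using card_take[of j] zero_take[of j] by simp

lemma vanish_zero:
  assumes "finite W" "W \<subseteq> V j" "card W = 2 * k + 1" "\<And>e. e \<in> W \<Longrightarrow> L c e = 0" "\<exists>i<2 * k + 1. c i \<noteq> 0"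
  shows False
  using generic_vanish[OF gV assms(1-4)] assms(5) by blast

lemma below_vanish_zero:
  assumes W: "finite W" "W \<subseteq> set (butlast xs)" "card W = r" and c: "\<And>e. e \<in> W \<Longrightarrow> L c e = 0"
    and z: "c r = 0" "c (r + 1) = 0" and nz: "\<exists>i<2 * k + 1. c i \<noteq> 0"
  shows False
proof -
  have "lin r \<phi> c e = 0" if "e \<in> W" for e
    using c[OF that] lin_finite[of e c] z subsetD[OF W(2) that] by (auto dest: in_set_butlastD)
  then have "c i = 0" if "i < r" for i using generic_vanish[OF g_below W, of c i] that by blast
  moreover have "i < r \<or> i = r \<or> i = r + 1" if "i < 2 * k + 1" for i using that rk by linarith
  ultimately show False using nz z by metis
qed

text \<open>
  A functional that vanishes on \<open>2k\<close> earlier labels is nonzero at infinity by genericity, and its value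
  there is the leading coefficient.
\<close>

lemma inseparable_infinity:
  assumes j: "j < length xs"
  shows "inseparable (2 * k + 1) \<psi> (V (Suc j)) (xs ! j) 0"
proof (rule inseparableI[OF gV])
  show "xs ! j \<noteq> 0" using nth_mem[OF j] zero by metis
  fix U c
  assume U: "U \<subseteq> V (Suc j) - {xs ! j, 0}" "card U + 1 = 2 * k + 1"
    and c: "\<And>e. e \<in> U \<Longrightarrow> L c e = 0" "\<exists>i<2 * k + 1. c i \<noteq> 0"
  have U': "U \<subseteq> V j" using U j by (auto simp: take_Suc)
  have fU: "finite U" using U by (auto intro: finite_subset)
  have "c (r + 1) \<noteq> 0"
  proof
    assume "c (r + 1) = 0"
    then have "L c e = 0" if "e \<in> insert 0 U" for e using that c(1) lin_infinity by auto
    moreover have "0 \<notin> U" using U by blast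
    then have "card (insert 0 U) = 2 * k + 1" using U(2) fU by simp
    moreover have "insert 0 U \<subseteq> V j" using U' by auto
    ultimately show False using vanish_zero[of "insert 0 U" j c] fU c(2) by blast
  qed
  then have "lead r c = L c 0" unfolding lead_def lin_infinity by simp
  then show "0 < L c (xs ! j) * L c 0"
    using lex[OF j U' _ c] U(2) by (simp add: mult.commute)
qed simp_all

lemma inseparable_next:
  assumes j: "Suc j < length xs"
  shows "inseparable (2 * k + 1) \<psi> (V (Suc (Suc j))) (xs ! Suc j) (xs ! j)"
proof (rule inseparableI[OF gV])
  show "xs ! Suc j \<noteq> xs ! j" using j dist by (simp add: nth_eq_iff_index_eq)
  fix U c
  assume U: "U \<subseteq> V (Suc (Suc j)) - {xs ! Suc j, xs ! j}" "card U + 1 = 2 * k + 1"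
    and c: "\<And>e. e \<in> U \<Longrightarrow> L c e = 0" "\<exists>i<2 * k + 1. c i \<noteq> 0"
  have U': "U \<subseteq> V j" "U \<subseteq> V (Suc j)" using U j by (auto simp: take_Suc)
  have "0 < lead r c * L c (xs ! j)" using lex[OF _ U'(1) _ c] U j by simp
  moreover have "0 < lead r c * L c (xs ! Suc j)" using lex[OF j U'(2) _ c] U by simp
  ultimately show "0 < L c (xs ! Suc j) * L c (xs ! j)" by (auto simp: zero_less_mult_iff)
qed simp_all

lemma below_nonzero:
  assumes j: "j < length xs" and R: "R \<subseteq> set (take j xs)" "card R + 1 = r"
    and a: "\<And>e. e \<in> R \<Longrightarrow> lin r \<phi> a e = 0" "\<exists>i<r. a i \<noteq> 0" and e: "e \<in> set (take j xs) - R"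
  shows "lin r \<phi> a e \<noteq> 0"
proof
  assume "lin r \<phi> a e = 0"
  then have "lin r \<phi> a x = 0" if "x \<in> insert e R" for x using that a by auto
  moreover have "finite R" using R by (auto intro: finite_subset)
  moreover have "card (insert e R) = r" using R e \<open>finite R\<close> by simp
  moreover have "insert e R \<subseteq> set (take j xs)" using R e by auto
  ultimately have "\<forall>i<r. a i = 0" using generic_vanish[OF g_take[OF j], of "insert e R" a] by blast
  with a(2) show False by blast
qed

text \<open>
  For each label \<open>e\<close> let \<open>b\<close> vanish on \<open>R\<close>, \<open>e\<close> and infinity. Eliminating the height coordinate from \<open>c\<close>
  and \<open>b\<close> gives a lower functional vanishing on \<open>R\<close>, hence a multiple of \<open>a\<close>. Its values at \<open>e\<close>, where \<open>b\<close>
  vanishes, and at \<open>xs ! j\<close>, where \<open>c\<close> vanishes and \<open>lex\<close> determines the sign of \<open>b\<close>, then relate the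
  sign of \<open>c\<close> at \<open>e\<close> to those of \<open>a\<close>. The factor \<open>x\<close> also covers the case that \<open>c\<close> has no height
  coordinate and is itself a multiple of \<open>a\<close>.
\<close>

lemma sign_below:
  assumes j: "j < length xs" and R: "R \<subseteq> set (take j xs)" "card R + 1 = r"
    and a: "\<And>e. e \<in> R \<Longrightarrow> lin r \<phi> a e = 0" "\<exists>i<r. a i \<noteq> 0"
    and c: "\<And>e. e \<in> R \<Longrightarrow> L c e = 0" "L c 0 = 0" "L c (xs ! j) = 0" "\<exists>i<2 * k + 1. c i \<noteq> 0"
  shows "\<exists>x. x \<noteq> 0 \<and> (\<forall>e\<in>set (take j xs) - R. sgn (L c e) = sgn x * sgn (lin r \<phi> a e)) \<and>
    (c r \<noteq> 0 \<longrightarrow> (\<forall>e\<in>set (take j xs) - R. sgn (L c e) = - sgn (c r) * sgn (lin r \<phi> a (xs ! j)) * sgn (lin r \<phi> a e)))"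
proof -
  let ?E = "set (take j xs)"
  have fR: "finite R" using R by (auto intro: finite_subset)
  have c1: "c (r + 1) = 0" using c(2) lin_infinity by simp
  have inxs: "e \<in> set xs" if "e \<in> ?E" for e using that by (auto dest: in_set_takeD)
  have anz: "lin r \<phi> a e \<noteq> 0" if "e \<in> ?E - R" for e
    using below_nonzero[OF j R _ a(2) that] a(1) by blast
  show ?thesis
  proof (cases "c r = 0")
    case True
    have Lc: "L c e = lin r \<phi> c e" if "e \<in> ?E" for e
      using lin_finite[OF inxs[OF that], of c] True c1 by simp
    obtain i where i: "i < r" "a i \<noteq> 0" using a by blast
    have ratio: "lin r \<phi> a e * c i = L c e * a i" if "e \<in> ?E - R" for e
    proof -
      have "lin r \<phi> c x = 0" if "x \<in> R" for x using c(1)[OF that] Lc R that by auto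
      then have "lin r \<phi> a e * c i = lin r \<phi> c e * a i"
        using generic_proportional[OF g_take[OF j] fR R, of e c a i] a that i by blast
      then show ?thesis using Lc that by simp
    qed
    define x where "x = (if ?E - R = {} then 1 else c i / a i)"
    have Lx: "L c e = x * lin r \<phi> a e" if e: "e \<in> ?E - R" for e
      using ratio[OF e] i e by (auto simp: x_def field_simps)
    have "x \<noteq> 0"
    proof (cases "?E - R = {}")
      case True
      then show ?thesis by (simp add: x_def)
    next
      case False
      then obtain e where e: "e \<in> ?E - R" by blast
      have "L c e \<noteq> 0"
      proof
        assume "L c e = 0"
        then have "\<And>y. y \<in> insert e R \<Longrightarrow> L c y = 0" using c(1) by auto
        moreover have "insert e R \<subseteq> set (butlast xs)" using e R take_butlast[OF j] by auto
        moreover have "card (insert e R) = r" using e R fR by simp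
        ultimately show False using below_vanish_zero[of "insert e R" c] fR True c1 c(4)
          \<open>c r = 0\<close> by blast
      qed
      with Lx[OF e] show ?thesis by auto
    qed
    then show ?thesis using Lx True by (intro exI[of _ x]) (simp add: sgn_mult)
  next
    case False
    have main: "sgn (L c e) * sgn (lin r \<phi> a (xs ! j)) = - sgn (c r) * sgn (lin r \<phi> a e)"
      if e: "e \<in> ?E - R" for e
    proof -
      have "0 \<notin> insert e R" using e R zero_take[of j] by blast
      then have "card (insert 0 (insert e R)) = Suc (card (insert e R))" using fR by simp
      then have W: "insert 0 (insert e R) \<subseteq> V j" "card (insert 0 (insert e R)) = 2 * k" "finite (insert 0 (insert e R))"
        using e R fR rk by auto
      then have "card (insert 0 (insert e R)) < 2 * k + 1" by simp
      from vanishing_exists[OF W(3) this, of \<psi>]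
      obtain b where b: "\<exists>i<2 * k + 1. b i \<noteq> 0" "\<forall>y\<in>insert 0 (insert e R). L b y = 0" by blast
      have b1: "b (r + 1) = 0" using b(2) lin_infinity[of b] by simp
      have br: "b r \<noteq> 0"
      proof
        assume "b r = 0"
        moreover have "insert e R \<subseteq> set (butlast xs)" using e R take_butlast[OF j] by auto
        moreover have "card (insert e R) = r" using e R fR by simp
        ultimately show False using below_vanish_zero[of "insert e R" b] fR b1 b by blast
      qed
      have bpos: "0 < b r * L b (xs ! j)"
        using lex[OF j W(1,2) b(2)[rule_format] b(1)] b1 by (simp add: lead_def)
      \<comment> \<open>This combination of \<open>c\<close> and \<open>b\<close> has no height coordinate.\<close>
      define t where "t = - (c r / b r)"
      define h where "h = (\<lambda>i. c i + t * b i)"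
      have Lh: "L h y = L c y + t * L b y" for y unfolding h_def by (rule lin_pencil)
      have h0: "h r = 0" "h (r + 1) = 0" using br b1 c1 by (auto simp: h_def t_def)
      have Lphi: "lin r \<phi> h y = L h y" if "y \<in> set xs" for y using lin_finite[OF that, of h] h0 by simp
      have "lin r \<phi> h y = 0" if "y \<in> R" for y
        using that Lphi[of y] inxs[of y] R Lh[of y] c(1) b(2) by auto
      then have ratio: "lin r \<phi> a e * h i = lin r \<phi> h e * a i" if "i < r" for i
        using generic_proportional[OF g_take[OF j] fR R, of e h a i] a e that by blast
      have "lin r \<phi> (\<lambda>i. lin r \<phi> a e * h i) (xs ! j) = lin r \<phi> (\<lambda>i. lin r \<phi> h e * a i) (xs ! j)"
        by (rule lin_cong) (rule ratio)
      then have "lin r \<phi> a e * lin r \<phi> h (xs ! j) = lin r \<phi> h e * lin r \<phi> a (xs ! j)"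
        by (simp only: lin_scale)
      moreover have "lin r \<phi> h (xs ! j) = t * L b (xs ! j)" using Lphi[of "xs ! j"] j Lh c(3) by simp
      moreover have "lin r \<phi> h e = L c e" using Lphi[of e] inxs[of e] e Lh b(2) by simp
      ultimately have "lin r \<phi> a e * (t * L b (xs ! j)) = L c e * lin r \<phi> a (xs ! j)" by simp
      then have "sgn (lin r \<phi> a e * (t * L b (xs ! j))) = sgn (L c e * lin r \<phi> a (xs ! j))" by simp
      moreover have "sgn (t * L b (xs ! j)) = - sgn (c r)"
      proof -
        define w where "w = (b r * L b (xs ! j)) / (b r)\<^sup>2"
        have w: "0 < w" unfolding w_def using bpos br by simp
        have "t * L b (xs ! j) = - c r * w"
          using br by (simp add: w_def t_def field_simps power2_eq_square)
        then show ?thesis using w by (simp add: sgn_mult sgn_minus)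
      qed
      ultimately show ?thesis by (simp add: sgn_mult mult.commute)
    qed
    define s where "s = lin r \<phi> a (xs ! j)"
    have s: "sgn (L c e) = - sgn (c r) * sgn s * sgn (lin r \<phi> a e) \<and> s \<noteq> 0" if e: "e \<in> ?E - R" for e
    proof -
      have m: "sgn (L c e) * sgn s = - sgn (c r) * sgn (lin r \<phi> a e)" using main[OF e] by (simp add: s_def)
      have s0: "s \<noteq> 0" using m anz[OF e] False by (auto simp: sgn_0_0)
      then have "sgn s * sgn s = 1" by (simp add: sgn_mult_self_eq)
      then have "sgn (L c e) = (sgn (L c e) * sgn s) * sgn s" by (simp add: mult.assoc)
      with m s0 show ?thesis by simp
    qed
    define x where "x = (if ?E - R = {} then 1 else - c r * s)"
    have "x \<noteq> 0" using s False by (auto simp: x_def)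
    moreover have "sgn (L c e) = sgn x * sgn (lin r \<phi> a e)" if "e \<in> ?E - R" for e
    proof -
      have "x = - c r * s" using that by (auto simp: x_def)
      then show ?thesis using s[OF that] by (simp add: sgn_mult sgn_minus)
    qed
    ultimately show ?thesis using s by (intro exI[of _ x]) (auto simp: s_def)
  qed
qed


lemma nth_nonzero: "j < length xs \<Longrightarrow> xs ! j \<noteq> 0"
  using zero nth_mem by metis

lemma vanishing:
  assumes "finite W" "card W \<le> 2 * k"
  obtains c where "\<exists>i<2 * k + 1. c i \<noteq> 0" "\<And>e. e \<in> W \<Longrightarrow> L c e = 0"
proof -
  from assms have "card W < 2 * k + 1" by simp
  from vanishing_exists[OF assms(1) this, of \<psi>] that show ?thesis by blast
qed

lemma below_functional:
  assumes R: "finite R" "card R + 1 = r"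
  obtains a where "\<exists>i<r. a i \<noteq> 0" "\<And>e. e \<in> R \<Longrightarrow> lin r \<phi> a e = 0"
proof -
  from assms have "card R < r" by simp
  from vanishing_exists[OF assms(1) this, of \<phi>] that show ?thesis by blast
qed

lemma face_positive:
  assumes W: "W \<subseteq> V j" and c: "\<And>e. e \<in> W \<Longrightarrow> L c e = 0"
    and x: "x \<noteq> 0" "\<And>e. e \<in> V j - W \<Longrightarrow> sgn (L c e) = sgn x"
  shows "face (2 * k + 1) \<psi> (V j) W"
  unfolding face_def
proof (intro conjI exI[of _ "\<lambda>i. x * c i"] ballI)
  fix e assume "e \<in> V j - W"
  then have "sgn (x * L c e) = sgn x * sgn x" using x(2) by (simp add: sgn_mult)
  also have "\<dots> = 1" using x(1) by (simp add: sgn_mult_self_eq)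
  finally show "0 < L (\<lambda>i. x * c i) e" by (simp add: lin_scale sgn_1_pos)
qed (use W c in \<open>auto simp: lin_scale\<close>)

text \<open>
  By \<open>sign_below\<close>, the functional vanishing on \<open>R\<close>, \<open>xs ! j\<close> and infinity has the same sign at all
  other labels.
\<close>

lemma upper_facet:
  assumes j: "j < length xs" "r \<le> j" and R: "face r \<phi> (set (take j xs)) R" "card R + 1 = r"
  shows "face (2 * k + 1) \<psi> (V (Suc j)) (insert (xs ! j) (insert 0 R))"
proof -
  let ?E = "set (take j xs)"
  obtain a where a: "R \<subseteq> ?E" "\<And>e. e \<in> R \<Longrightarrow> lin r \<phi> a e = 0" "\<And>e. e \<in> ?E - R \<Longrightarrow> 0 < lin r \<phi> a e"
    using R(1) by (auto simp: face_def)
  have fR: "finite R" using a(1) by (auto intro: finite_subset)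
  have "card R < card ?E" using R(2) j card_take[of j] by simp
  then obtain e0 where "e0 \<in> ?E - R" using fR card_mono[OF fR, of ?E] by fastforce
  then have "0 < lin r \<phi> a e0" using a(3) by simp
  then have anz: "\<exists>i<r. a i \<noteq> 0" using lin_zero[of r a \<phi> e0] by (metis less_irrefl)
  let ?W = "insert (xs ! j) (insert 0 R)"
  have "card ?W \<le> Suc (Suc (card R))" using fR by (simp add: card_insert_if)
  then have "card ?W \<le> 2 * k" using R(2) rk by simp
  then obtain c where c: "\<exists>i<2 * k + 1. c i \<noteq> 0" "\<And>e. e \<in> ?W \<Longrightarrow> L c e = 0"
    using vanishing[of ?W] fR by blast
  obtain x where x: "x \<noteq> 0" "\<forall>e\<in>?E - R. sgn (L c e) = sgn x * sgn (lin r \<phi> a e)"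
    using sign_below[OF j(1) a(1) R(2) a(2) anz, of c] c by auto
  have "sgn (L c e) = sgn x" if "e \<in> V (Suc j) - ?W" for e
  proof -
    have e: "e \<in> ?E - R" using that take_Suc[OF j(1)] by auto
    then have "sgn (lin r \<phi> a e) = 1" using a(3) by simp
    then show ?thesis using x(2) e by simp
  qed
  moreover have "?W \<subseteq> V (Suc j)" using a(1) take_Suc[OF j(1)] by auto
  ultimately show ?thesis using face_positive[of ?W "Suc j" c x] c(2) x(1) by blast
qed

text \<open>
  The elimination argument of \<open>sign_below\<close>, now applied to the squared norm: \<open>c0\<close> vanishes on \<open>R\<close>, \<open>p\<close>
  and infinity, \<open>b\<close> vanishes on \<open>R\<close>, \<open>p\<close> and \<open>e\<close>. The functional obtained from \<open>c\<close> and \<open>b\<close> by eliminating the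
  value at infinity is a multiple of \<open>c0\<close>, whose signs come from \<open>sign_below\<close>.
\<close>

lemma link_sign:
  assumes j: "Suc j < length xs" and R: "R \<subseteq> set (take j xs)" "card R + 1 = r"
    and a: "\<And>e. e \<in> R \<Longrightarrow> lin r \<phi> a e = 0" "\<exists>i<r. a i \<noteq> 0"
    and c: "\<And>e. e \<in> R \<Longrightarrow> L c e = 0" "L c (xs ! j) = 0" "L c (xs ! Suc j) = 0" "\<exists>i<2 * k + 1. c i \<noteq> 0"
    and e: "e \<in> set (take j xs) - R"
  shows "sgn (L c e) * sgn (L c 0) = sgn (lin r \<phi> a e) * sgn (lin r \<phi> a (xs ! j))" "L c 0 \<noteq> 0"
proof -
  let ?E = "set (take j xs)"
  let ?p = "xs ! j" and ?s = "xs ! Suc j"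
  have j': "j < length xs" using j by simp
  have fR: "finite R" using R by (auto intro: finite_subset)
  have p: "?p \<notin> ?E" "?p \<noteq> 0" "?s \<notin> insert ?p ?E" "?s \<noteq> 0"
    using nth_notin[OF j'] nth_notin[OF j] nth_nonzero[OF j'] nth_nonzero[OF j]
    unfolding take_Suc[OF j'] by blast+
  have eE: "e \<in> ?E" "e \<notin> R" using e by auto
  have "e \<noteq> 0" "e \<noteq> ?p" using eE(1) zero_take[of j] p(1) by metis+
  moreover have "0 \<notin> R" "?p \<notin> R" "?s \<notin> R" using R(1) zero_take[of j] p(1,3) by auto
  ultimately have e0: "e \<noteq> 0" "e \<noteq> ?p" "0 \<notin> R" "?p \<notin> R" "?s \<notin> R" "e \<notin> R" using eE by auto
  have cards: "card (insert ?p R) = r" "card (insert 0 (insert ?p R)) = 2 * k"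
    "card (insert e (insert ?p R)) = 2 * k"
    "card (insert 0 (insert e (insert ?p R))) = 2 * k + 1"
    "card (insert 0 (insert ?s (insert ?p R))) = 2 * k + 1"
    using e0 p fR R(2) rk by simp_all
  obtain c0 where c0: "\<exists>i<2 * k + 1. c0 i \<noteq> 0" "\<And>y. y \<in> insert 0 (insert ?p R) \<Longrightarrow> L c0 y = 0"
    using vanishing[of "insert 0 (insert ?p R)"] fR cards(2) by auto
  have c01: "c0 (r + 1) = 0" using c0(2)[of 0] lin_infinity by simp
  have bl: "insert ?p R \<subseteq> set (butlast xs)"
    using take_butlast[OF j] take_Suc[OF j'] R by auto
  have c0r: "c0 r \<noteq> 0"
  proof
    assume "c0 r = 0"
    from below_vanish_zero[OF _ bl cards(1) _ this c01 c0(1)] fR c0(2) show False by blast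
  qed
  have sub: "insert 0 (insert ?p R) \<subseteq> V (Suc j)" "insert e (insert ?p R) \<subseteq> V (Suc j)"
    using R e take_Suc[OF j'] by auto
  have c0s: "0 < c0 r * L c0 ?s"
    using lex[OF j sub(1) cards(2) c0(2) c0(1)] c01 by (simp add: lead_def)
  have x1: "sgn (L c0 e) = - sgn (c0 r) * sgn (lin r \<phi> a ?p) * sgn (lin r \<phi> a e)"
    using sign_below[OF j' R a, of c0] c0 c0r e by blast
  obtain b where b: "\<exists>i<2 * k + 1. b i \<noteq> 0" "\<And>y. y \<in> insert e (insert ?p R) \<Longrightarrow> L b y = 0"
    using vanishing[of "insert e (insert ?p R)"] fR cards(3) by auto
  have b0: "L b 0 \<noteq> 0"
  proof
    assume "L b 0 = 0"
    then have v: "\<And>y. y \<in> insert 0 (insert e (insert ?p R)) \<Longrightarrow> L b y = 0" using b(2) by blast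
    have "finite (insert 0 (insert e (insert ?p R)))" "insert 0 (insert e (insert ?p R)) \<subseteq> V (Suc j)"
      using fR sub by auto
    from vanish_zero[OF this cards(4) v b(1)] show False by simp
  qed
  have bs: "0 < L b 0 * L b ?s"
    using lex[OF j sub(2) cards(3) b(2) b(1)] b0 unfolding lead_def lin_infinity by simp
  show cz: "L c 0 \<noteq> 0"
  proof
    assume "L c 0 = 0"
    then have v: "\<And>y. y \<in> insert 0 (insert ?s (insert ?p R)) \<Longrightarrow> L c y = 0" using c(1-3) by blast
    have "finite (insert 0 (insert ?s (insert ?p R)))"
      "insert 0 (insert ?s (insert ?p R)) \<subseteq> V (Suc (Suc j))"
      using fR sub take_Suc[OF j] by auto
    from vanish_zero[OF this cards(5) v c(4)] show False by simp
  qed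
  \<comment> \<open>This combination of \<open>c\<close> and \<open>b\<close> vanishes at infinity.\<close>
  define t where "t = - (L c 0 / L b 0)"
  define h where "h = (\<lambda>i. c i + t * b i)"
  have Lh: "L h y = L c y + t * L b y" for y unfolding h_def by (rule lin_pencil)
  have hz: "L h y = 0" if "y \<in> insert 0 (insert ?p R)" for y
  proof (cases "y = 0")
    case True
    then show ?thesis unfolding Lh t_def using b0 by simp
  next
    case False
    then have "L c y = 0" "L b y = 0" using that c(1,2) b(2) by auto
    then show ?thesis unfolding Lh by simp
  qed
  have ratio: "L c0 e * h i = L h e * c0 i" if "i < 2 * k + 1" for i
  proof (rule generic_proportional[OF gV, of "insert 0 (insert ?p R)" "Suc j" e h c0 i])
    show "finite (insert 0 (insert ?p R))" using fR by simp
    show "card (insert 0 (insert ?p R)) + 1 = 2 * k + 1" using cards(2) by simp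
    show "e \<in> V (Suc j)" using sub by blast
    show "e \<notin> insert 0 (insert ?p R)" using e0 by blast
  qed (use sub hz c0(2) that in blast)+
  have "L (\<lambda>i. L c0 e * h i) ?s = L (\<lambda>i. L h e * c0 i) ?s"
    by (rule lin_cong) (rule ratio)
  then have "L c0 e * L h ?s = L h e * L c0 ?s" by (simp only: lin_scale)
  moreover have "L h ?s = t * L b ?s" "L h e = L c e" using Lh c(3) b(2) by simp_all
  ultimately have "L c0 e * (t * L b ?s) = L c e * L c0 ?s" by simp
  then have eq: "sgn (L c0 e) * sgn (t * L b ?s) = sgn (L c e) * sgn (L c0 ?s)"
    by (metis sgn_mult)
  define w where "w = (L b 0 * L b ?s) / (L b 0)\<^sup>2"
  have w: "0 < w" unfolding w_def using bs b0 by simp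
  have "t * L b ?s = - L c 0 * w"
    using b0 by (simp add: w_def t_def field_simps power2_eq_square)
  then have st: "sgn (t * L b ?s) = - sgn (L c 0)" using w by (simp add: sgn_mult sgn_minus)
  have sc: "sgn (L c0 ?s) = sgn (c0 r)" using c0s by (auto simp: zero_less_mult_iff)
  define u v where "u = sgn (L c 0)" and "v = sgn (c0 r)"
  have uu: "u * u = 1" "v * v = 1" using cz c0r by (simp_all add: u_def v_def sgn_mult_self_eq)
  have "v * sgn (lin r \<phi> a ?p) * sgn (lin r \<phi> a e) * u = sgn (L c e) * v"
    using eq unfolding st sc x1 by (simp add: u_def v_def mult_ac)
  then have "(v * v) * (u * u) * (sgn (lin r \<phi> a ?p) * sgn (lin r \<phi> a e)) = (v * v) * (sgn (L c e) * u)"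
    by (simp add: mult_ac)
  then show "sgn (L c e) * sgn (L c 0) = sgn (lin r \<phi> a e) * sgn (lin r \<phi> a ?p)"
    using uu by (simp add: u_def mult.commute)
qed

text \<open>
  This recovers the input of a lifting from its cells, with \<open>p = xs ! j\<close> in the role of infinity: by
  \<open>link_sign\<close>, a functional on one side has the same sign at \<open>e\<close> and infinity if and only if the
  functional on the other side has the same sign at \<open>e\<close> and \<open>p\<close>.
\<close>

lemma link_face:
  assumes j: "Suc j < length xs" and R: "R \<subseteq> set (take j xs)" "card R + 1 = r"
  shows "face (2 * k + 1) \<psi> (V (Suc (Suc j))) (insert (xs ! j) (insert (xs ! Suc j) R)) \<longleftrightarrow>
    face r \<phi> (set (take (Suc j) xs)) R"
proof -
  let ?E = "set (take j xs)"
  let ?p = "xs ! j" and ?s = "xs ! Suc j"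
  let ?W = "insert ?p (insert ?s R)"
  have j': "j < length xs" using j by simp
  have fR: "finite R" using R by (auto intro: finite_subset)
  have p: "?p \<notin> ?E" "?s \<notin> insert ?p ?E" "?p \<noteq> 0" "?s \<noteq> 0"
    using nth_notin[OF j'] nth_notin[OF j] nth_nonzero[OF j'] nth_nonzero[OF j]
    unfolding take_Suc[OF j'] by blast+
  have z: "0 \<notin> ?W" using p zero_take[of j] R by auto
  have "card ?W \<le> 2 * k" using p R fR rk by (simp add: card_insert_if)
  then obtain c where c: "\<exists>i<2 * k + 1. c i \<noteq> 0" "\<And>e. e \<in> ?W \<Longrightarrow> L c e = 0"
    using vanishing[of ?W] fR by blast
  obtain a where a: "\<exists>i<r. a i \<noteq> 0" "\<And>e. e \<in> R \<Longrightarrow> lin r \<phi> a e = 0"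
    using below_functional[OF fR R(2)] by blast
  have V2: "V (Suc (Suc j)) - ?W = insert 0 (?E - R)"
    using take_Suc[OF j] take_Suc[OF j'] p z zero_take[of j] by auto
  have E1: "set (take (Suc j) xs) - R = insert ?p (?E - R)"
    using take_Suc[OF j'] p R by auto
  have link: "sgn (L b e) * sgn (L b 0) = sgn (lin r \<phi> d e) * sgn (lin r \<phi> d ?p)"
    if "e \<in> ?E - R" "\<And>y. y \<in> ?W \<Longrightarrow> L b y = 0" "\<exists>i<2 * k + 1. b i \<noteq> 0"
      "\<And>y. y \<in> R \<Longrightarrow> lin r \<phi> d y = 0" "\<exists>i<r. d i \<noteq> 0" for e b d
    using link_sign(1)[OF j R that(4,5), of b e] that by blast
  show ?thesis
  proof
    assume "face (2 * k + 1) \<psi> (V (Suc (Suc j))) ?W"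
    then obtain b where b: "\<And>e. e \<in> ?W \<Longrightarrow> L b e = 0" "\<And>e. e \<in> insert 0 (?E - R) \<Longrightarrow> 0 < L b e"
      unfolding face_def V2 by blast
    then have "0 < L b 0" by blast
    then have bnz: "\<exists>i<2 * k + 1. b i \<noteq> 0" using lin_zero[of "2 * k + 1" b \<psi> 0] by (metis less_irrefl)
    have anz: "lin r \<phi> a ?p \<noteq> 0"
      using below_nonzero[OF j _ R(2), of a ?p] a R take_Suc[OF j'] p by auto
    define x where "x = lin r \<phi> a ?p"
    have "sgn (x * lin r \<phi> a e) = 1" if "e \<in> ?E - R" for e
      using link[OF that b(1) bnz a(2,1)] b(2)[of e] b(2)[of 0] that by (simp add: x_def sgn_mult mult.commute)
    moreover have "0 < x * lin r \<phi> a ?p" using anz by (auto simp: x_def zero_less_mult_iff neq_iff)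
    ultimately have "0 < lin r \<phi> (\<lambda>i. x * a i) e" if "e \<in> set (take (Suc j) xs) - R" for e
      using that unfolding E1 by (auto simp: lin_scale sgn_1_pos)
    moreover have "R \<subseteq> set (take (Suc j) xs)" using R take_Suc[OF j'] by auto
    ultimately show "face r \<phi> (set (take (Suc j) xs)) R"
      unfolding face_def using a(2) by (intro conjI exI[of _ "\<lambda>i. x * a i"]) (auto simp: lin_scale)
  next
    assume "face r \<phi> (set (take (Suc j) xs)) R"
    then obtain d where d: "\<And>e. e \<in> R \<Longrightarrow> lin r \<phi> d e = 0" "\<And>e. e \<in> insert ?p (?E - R) \<Longrightarrow> 0 < lin r \<phi> d e"
      unfolding face_def E1 by blast
    then have "0 < lin r \<phi> d ?p" by blast
    then have dnz: "\<exists>i<r. d i \<noteq> 0" using lin_zero[of r d \<phi> ?p] by (metis less_irrefl)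
    have c0: "L c 0 \<noteq> 0"
    proof
      assume "L c 0 = 0"
      then have v: "\<And>y. y \<in> insert 0 ?W \<Longrightarrow> L c y = 0" using c(2) by blast
      have "finite (insert 0 ?W)" "insert 0 ?W \<subseteq> V (Suc (Suc j))"
        using fR R take_Suc[OF j] take_Suc[OF j'] by auto
      moreover have "?s \<notin> R" "?p \<notin> insert ?s R" using p R(1) by auto
      then have "card (insert 0 ?W) = 2 * k + 1" using z fR R(2) rk by simp
      ultimately show False using vanish_zero[OF _ _ _ v c(1)] by blast
    qed
    have "sgn (L c e) = sgn (L c 0)" if e: "e \<in> insert 0 (?E - R)" for e
    proof (cases "e = 0")
      case False
      then have "sgn (L c e) * sgn (L c 0) = 1"
        using link[OF _ c(2,1) d(1) dnz, of e] d(2)[of e] d(2)[of ?p] e by simp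
      moreover have "sgn (L c 0) * sgn (L c 0) = 1" using c0 by (simp add: sgn_mult_self_eq)
      ultimately show ?thesis using c0 by (metis mult_cancel_right sgn_0_0)
    qed simp
    moreover have "?W \<subseteq> V (Suc (Suc j))" using R take_Suc[OF j] take_Suc[OF j'] by auto
    ultimately show "face (2 * k + 1) \<psi> (V (Suc (Suc j))) ?W"
      using face_positive[of ?W "Suc (Suc j)" c "L c 0"] c(2) c0 unfolding V2 by blast
  qed
qed

text \<open>
  A later label does not destroy cells: at the new label the supporting functional of a facet that
  avoids infinity has the sign of its leading coefficient, its positive value at infinity.
\<close>

lemma cells_Suc:
  assumes j: "2 * k \<le> j" "j < length xs" and R: "R \<in> faces_avoiding (2 * k + 1) \<psi> (V j) 0"
  shows "R \<in> faces_avoiding (2 * k + 1) \<psi> (V (Suc j)) 0"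
proof -
  have f: "face (2 * k + 1) \<psi> (V j) R" "0 \<in> V j - R" using R by (auto simp: faces_avoiding_def)
  have "2 * k + 1 \<le> card (V j)" using j card_V[of j] by simp
  from extend_to_facet[OF gV _ this f]
  obtain F where F: "R \<subseteq> F" "face (2 * k + 1) \<psi> (V j) F" "0 \<notin> F" "card F + 1 = 2 * k + 1" by auto
  obtain c where c': "F \<subseteq> V j" "\<forall>e\<in>F. L c e = 0" "\<forall>e\<in>V j - F. 0 < L c e"
    using F(2) by (rule faceE)
  note c = c'(1) c'(2)[rule_format] c'(3)[rule_format]
  have c0: "0 < L c 0" using c(3) F(3) by blast
  then have "\<exists>i<2 * k + 1. c i \<noteq> 0" using lin_zero[of "2 * k + 1" c \<psi> 0] by (metis less_irrefl)
  from lex[OF j(2) c(1) _ c(2) this] F(4) have "0 < lead r c * L c (xs ! j)" by simp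
  moreover have "lead r c = L c 0" using c0 unfolding lead_def lin_infinity by simp
  ultimately have "0 < L c (xs ! j)" using c0 by (simp add: zero_less_mult_iff)
  then have "face (2 * k + 1) \<psi> (V (Suc j)) F"
    unfolding face_def using c take_Suc[OF j(2)] by (intro conjI exI[of _ c]) auto
  from face_subset[OF gV _ this F(1)] F(4) have "face (2 * k + 1) \<psi> (V (Suc j)) R" by simp
  moreover have "R \<subseteq> V (Suc j) - {0}" using R take_Suc[OF j(2)] by (auto simp: faces_avoiding_def)
  ultimately show ?thesis by (simp add: faces_avoiding_def)
qed

lemma cells_mono:
  assumes "2 * k \<le> i" "i \<le> j" "j \<le> length xs" "R \<in> faces_avoiding (2 * k + 1) \<psi> (V i) 0"
  shows "R \<in> faces_avoiding (2 * k + 1) \<psi> (V j) 0"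
  using assms(2,3)
proof (induction j rule: dec_induct)
  case (step n)
  then show ?case using cells_Suc[of n R] assms(1) by simp
qed (use assms(4) in simp)

lemma cells_take:
  assumes "2 * k \<le> j" "j \<le> length xs"
  shows "faces_avoiding (2 * k + 1) \<psi> (V j) 0 = {R \<in> faces_avoiding (2 * k + 1) \<psi> (V (length xs)) 0. R \<subseteq> set (take j xs)}"
    (is "?A = ?B")
proof (intro subset_antisym subsetI)
  fix R assume R: "R \<in> ?A"
  then have "R \<subseteq> set (take j xs)" by (auto simp: faces_avoiding_def)
  with cells_mono[OF assms(1,2) order_refl R] show "R \<in> ?B" by blast
next
  fix R assume R: "R \<in> ?B"
  then have "face (2 * k + 1) \<psi> (V j) R"
    using face_restrict[of "2 * k + 1" \<psi> "V (length xs)" R "V j"] V_subset[of j] by (auto simp: faces_avoiding_def)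
  then show "R \<in> ?A" using R zero_take[of j] by (auto simp: faces_avoiding_def)
qed

lemma lower_face:
  assumes j: "j < length xs" and S: "S \<subseteq> set (take j xs)" "card S \<le> k - 1"
  shows "face r \<phi> (set (take j xs)) S"
proof -
  have "card (set (butlast xs)) = length xs - 1" using dist by (simp add: distinct_card distinct_butlast)
  then have "k - 1 \<le> card (set (butlast xs))" using len by simp
  then have "face r \<phi> (set (butlast xs)) S"
    using all_faces_le[OF g_below _ nb_below, of S] rk S take_butlast[OF j] by auto
  then show ?thesis using face_restrict S(1) take_butlast[OF j] by blast
qed

lemma lower_facet:
  assumes j: "j < length xs" "r \<le> j" and S: "S \<subseteq> set (take j xs)" "card S \<le> k - 1"
    and x: "x \<in> set (take j xs) - S"
  obtains R where "S \<subseteq> R" "face r \<phi> (set (take j xs)) R" "x \<notin> R" "card R + 1 = r"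
  using extend_to_facet[OF g_take[OF j(1)] _ _ lower_face[OF j(1) S] x] card_take[of j] j that by auto

lemma upper_face:
  assumes j: "j < length xs" "r \<le> j" and S: "S \<subseteq> set (take j xs)" "card S \<le> k - 1"
  shows "\<exists>F. insert (xs ! j) (insert 0 S) \<subseteq> F \<and> face (2 * k + 1) \<psi> (V (Suc j)) F \<and> card F \<le> 2 * k + 1"
proof -
  have "card S < card (set (take j xs))" using S(2) j card_take[of j] rk by simp
  then obtain x where x: "x \<in> set (take j xs) - S"
    using card_mono[of S "set (take j xs)"] S(1) finite_subset[OF S(1)] by fastforce
  obtain R where R: "S \<subseteq> R" "face r \<phi> (set (take j xs)) R" "card R + 1 = r"
    using lower_facet[OF j S x] by blast
  have "R \<subseteq> set (take j xs)" using R(2) by (simp add: face_def)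
  then have fR: "finite R" by (auto intro: finite_subset)
  have "card (insert (xs ! j) (insert 0 R)) \<le> 2 * k + 1"
    using fR R(3) rk by (simp add: card_insert_if)
  with upper_facet[OF j R(2,3)] R(1) show ?thesis
    by (intro exI[of _ "insert (xs ! j) (insert 0 R)"]) auto
qed

text \<open>
  A set \<open>S\<close> avoiding infinity whose last label is \<open>s\<close> lies in a facet through \<open>s\<close> and infinity of the
  configuration up to \<open>s\<close>, since \<open>S\<close> without \<open>s\<close> is a lower face by neighborliness in rank \<open>r\<close>. It is
  therefore a cell there and remains one. If \<open>S\<close> contains infinity, the last label of the list replaces
  \<open>s\<close>. Among the first \<open>2k\<close> labels every set is a cell.
\<close>

lemma neighborly_lift: "all_faces (2 * k + 1) \<psi> (insert 0 (set xs)) k"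
  unfolding all_faces_def
proof (intro allI impI)
  fix S assume S: "S \<subseteq> insert 0 (set xs)" "card S = k"
  have Vall: "V (length xs) = insert 0 (set xs)" by simp
  have fS: "finite S" using S by (auto intro: finite_subset)
  show "face (2 * k + 1) \<psi> (insert 0 (set xs)) S"
  proof (cases "0 \<in> S")
    case True
    define j where "j = length xs - 1"
    have j: "j < length xs" "r \<le> j" "Suc j = length xs" using len rk by (auto simp: j_def)
    have sx: "set xs = insert (xs ! j) (set (take j xs))" using take_Suc[OF j(1)] j(3) by simp
    define T where "T = S - {0, xs ! j}"
    have "T \<subseteq> S - {0}" by (auto simp: T_def)
    then have "card T \<le> card (S - {0})" using fS by (intro card_mono) auto
    then have Tc: "card T \<le> k - 1" using S(2) True by simp
    have Tj: "T \<subseteq> set (take j xs)" using S(1) sx by (auto simp: T_def)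
    obtain F where F: "insert (xs ! j) (insert 0 T) \<subseteq> F" "face (2 * k + 1) \<psi> (V (Suc j)) F" "card F \<le> 2 * k + 1"
      using upper_face[OF j(1,2) Tj Tc] by blast
    have "S \<subseteq> F" using F(1) by (auto simp: T_def)
    from face_subset[OF gV _ F(2) this F(3)] show ?thesis using j(3) by simp
  next
    case False
    have Sx: "S \<subseteq> set xs" using S False by auto
    define J where "J = {i. i < length xs \<and> xs ! i \<in> S}"
    have "S \<noteq> {}" using S k_pos by auto
    then obtain x where "x \<in> S" by blast
    then obtain i where "i < length xs" "x = xs ! i" using Sx by (metis in_set_conv_nth subsetD)
    then have "J \<noteq> {}" "finite J" using \<open>x \<in> S\<close> by (auto simp: J_def)
    define j where "j = Max J"
    have j: "j < length xs" "xs ! j \<in> S" using Max_in[OF \<open>finite J\<close> \<open>J \<noteq> {}\<close>] by (auto simp: j_def J_def)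
    have St: "S \<subseteq> set (take (Suc j) xs)"
    proof
      fix x assume x: "x \<in> S"
      then obtain i where i: "i < length xs" "x = xs ! i" using Sx by (metis in_set_conv_nth subsetD)
      then have "i \<in> J" using x by (simp add: J_def)
      then have "i \<le> j" using \<open>finite J\<close> by (simp add: j_def)
      then show "x \<in> set (take (Suc j) xs)" using i j(1) by (auto simp: in_set_conv_nth intro!: exI[of _ i])
    qed
    have "S \<in> faces_avoiding (2 * k + 1) \<psi> (V (length xs)) 0"
    proof (cases "j < 2 * k")
      case True
      then have S2: "S \<subseteq> set (take (2 * k) xs)"
        using St set_take_subset_set_take[of "Suc j" "2 * k" xs] by auto
      have "card (V (2 * k)) \<le> 2 * k + 1" using card_V[of "2 * k"] len by simp
      from genericD[OF gV _ subset_refl this, of "\<lambda>e. if e \<in> S then 0 else 1"]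
      obtain c where c: "\<And>e. e \<in> V (2 * k) \<Longrightarrow> L c e = (if e \<in> S then 0 else 1)" by blast
      have "face (2 * k + 1) \<psi> (V (2 * k)) S"
        unfolding face_def using S2 c by (intro conjI exI[of _ c]) auto
      then have "S \<in> faces_avoiding (2 * k + 1) \<psi> (V (2 * k)) 0" using S2 zero_take[of "2 * k"] by (auto simp: faces_avoiding_def)
      from cells_mono[OF order_refl _ order_refl this] len show ?thesis by simp
    next
      case False
      then have rj: "r \<le> j" using rk by simp
      define T where "T = S - {xs ! j}"
      have Tc: "card T \<le> k - 1" using S j fS by (simp add: T_def)
      have Tj: "T \<subseteq> set (take j xs)" using St take_Suc[OF j(1)] by (auto simp: T_def)
      obtain F where F: "insert (xs ! j) (insert 0 T) \<subseteq> F" "face (2 * k + 1) \<psi> (V (Suc j)) F" "card F \<le> 2 * k + 1"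
        using upper_face[OF j(1) rj Tj Tc] by blast
      have "S \<subseteq> F" using F(1) by (auto simp: T_def)
      from face_subset[OF gV _ F(2) this F(3)] have "face (2 * k + 1) \<psi> (V (Suc j)) S" by simp
      then have "S \<in> faces_avoiding (2 * k + 1) \<psi> (V (Suc j)) 0" using St zero_take[of "Suc j"] by (auto simp: faces_avoiding_def)
      from cells_mono[OF _ _ order_refl this] False j(1) show ?thesis by simp
    qed
    then show ?thesis by (simp add: faces_avoiding_def)
  qed
qed

text \<open>
  A cell with \<open>2k\<close> labels through \<open>s\<close> that misses \<open>p\<close> gives a relation on the cell, \<open>p\<close> and infinity with
  opposite signs at \<open>p\<close> and infinity, although \<open>s\<close> is inseparable from both. A set with \<open>k + 1\<close> labels
  containing \<open>s\<close> and \<open>p\<close> extends to a cell by \<open>link_face\<close> and neighborliness in rank \<open>r\<close>.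
\<close>

lemma apex_pair_next:
  assumes j: "Suc j < length xs" "2 * k \<le> Suc j"
  shows "apex_pair (faces_avoiding (2 * k + 1) \<psi> (V (Suc (Suc j))) 0) (set (take (Suc (Suc j)) xs)) k (xs ! Suc j) (xs ! j)"
proof -
  let ?p = "xs ! j" and ?s = "xs ! Suc j" and ?U = "V (Suc (Suc j))"
  have j': "j < length xs" using j by simp
  have p: "?p \<notin> set (take j xs)" "?s \<notin> insert ?p (set (take j xs))" "?p \<noteq> 0" "?s \<noteq> 0"
    using nth_notin[OF j'] nth_notin[OF j(1)] nth_nonzero[OF j'] nth_nonzero[OF j(1)]
    unfolding take_Suc[OF j'] by blast+
  have E2: "set (take (Suc (Suc j)) xs) = insert ?s (insert ?p (set (take j xs)))"
    using take_Suc[OF j'] take_Suc[OF j(1)] by simp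
  have facets: "?p \<in> F" if F: "F \<in> faces_avoiding (2 * k + 1) \<psi> ?U 0" "card F = 2 * k" "?s \<in> F" for F
  proof (rule ccontr)
    assume pF: "?p \<notin> F"
    have F': "F \<subseteq> ?U" "0 \<notin> F" "face (2 * k + 1) \<psi> ?U F" using F(1) by (auto simp: faces_avoiding_def)
    have fF: "finite F" using F'(1) by (auto intro: finite_subset)
    obtain c where c': "F \<subseteq> ?U" "\<forall>e\<in>F. L c e = 0" "\<forall>e\<in>?U - F. 0 < L c e"
      using F'(3) by (rule faceE)
    note c = c'(2)[rule_format] c'(3)[rule_format]
    define W where "W = insert ?p (insert 0 F)"
    have W: "W \<subseteq> ?U" "card W = 2 * k + 1 + 1" "finite W" "?s \<in> W" "?p \<in> W" "0 \<in> W"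
      using F' pF p fF F(2,3) E2 by (auto simp: W_def)
    obtain l where l: "relation (2 * k + 1) \<psi> W l" using relation_exists[OF W(3,2)] by blast
    have i: "l ?s * l 0 < 0" "l ?s * l ?p < 0"
      using inseparable_infinity[OF j(1)] inseparable_next[OF j(1)] W l unfolding inseparable_def by blast+
    have "(\<Sum>e\<in>W. l e * L c e) = l ?p * L c ?p + l 0 * L c 0 + (\<Sum>e\<in>F. l e * L c e)"
      unfolding W_def using F'(2) pF p fF by simp
    also have "(\<Sum>e\<in>F. l e * L c e) = 0" using c(1) by simp
    finally have "l ?p * L c ?p + l 0 * L c 0 = 0" using l by (simp add: relation_def)
    moreover have "0 < L c ?p" "0 < L c 0" using c(2) pF F'(2) E2 by auto
    moreover have "l 0 \<noteq> 0" using i(1) by auto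
    ultimately have "l ?p * l 0 < 0"
      using opposite_product[of "l ?p" "L c ?p" "l 0" "L c 0"] mult_pos_pos by blast
    with i show False by (auto simp: mult_less_0_iff)
  qed
  have faces: "T \<in> faces_avoiding (2 * k + 1) \<psi> ?U 0"
    if T: "T \<subseteq> set (take (Suc (Suc j)) xs)" "card T = k + 1" "?s \<in> T" "?p \<in> T" for T
  proof -
    define S where "S = T - {?s, ?p}"
    have fT: "finite T" using T(1) by (auto intro: finite_subset)
    have Sj: "S \<subseteq> set (take j xs)" using T(1) E2 by (auto simp: S_def)
    then have S1: "S \<subseteq> set (take (Suc j) xs)" "?p \<in> set (take (Suc j) xs) - S"
      using take_Suc[OF j'] by (auto simp: S_def)
    have TS: "T = insert ?s (insert ?p S)" using T by (auto simp: S_def)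
    have "card T = card S + 2" unfolding TS using p Sj fT by (simp add: S_def)
    then have "card S \<le> k - 1" using T(2) by simp
    moreover have "r \<le> Suc j" using j rk by simp
    ultimately obtain R where R: "S \<subseteq> R" "face r \<phi> (set (take (Suc j) xs)) R" "?p \<notin> R" "card R + 1 = r"
      using lower_facet[OF j(1) _ S1(1) _ S1(2)] by blast
    have Rj: "R \<subseteq> set (take j xs)" using R take_Suc[OF j'] by (auto simp: face_def)
    then have fR: "finite R" by (auto intro: finite_subset)
    have f: "face (2 * k + 1) \<psi> ?U (insert ?p (insert ?s R))" using link_face[OF j(1) Rj R(4)] R(2) by blast
    have "T \<subseteq> insert ?p (insert ?s R)" using TS R(1) by auto
    moreover have "card (insert ?p (insert ?s R)) \<le> 2 * k + 1" using fR R(4) rk by (simp add: card_insert_if)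
    ultimately have "face (2 * k + 1) \<psi> ?U T" using face_subset[OF gV _ f] by blast
    then show ?thesis using T(1) zero_take[of "Suc (Suc j)"] by (auto simp: faces_avoiding_def)
  qed
  show ?thesis unfolding apex_pair_def
    using p facets faces by (auto simp: E2)
qed

end

section \<open>Existence of lexicographic liftings\<close>

text \<open>
  Label \<open>0\<close> is the point at infinity \<open>(0, \<dots>, 0, 1)\<close>. The coordinate \<open>\<phi> 0\<close> is meant to be the constant
  \<open>1\<close>, so it does not contribute to the squared norm in the last coordinate.
\<close>

definition lift :: "nat \<Rightarrow> (nat \<Rightarrow> nat \<Rightarrow> real) \<Rightarrow> (nat \<Rightarrow> real) \<Rightarrow> nat \<Rightarrow> nat \<Rightarrow> real" where
  "lift r \<phi> h i e = (if e = 0 then (if i = r + 1 then 1 else 0)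
     else if i < r then \<phi> i e else if i = r then h e
     else (\<Sum>j\<in>{1..<r}. (\<phi> j e)\<^sup>2) + (h e)\<^sup>2)"

lemma lin_lift_0: "lin (r + 2) (lift r \<phi> h) c 0 = c (r + 1)"
  by (simp add: lin_def lift_def)

lemma lin_lift:
  assumes "e \<noteq> 0"
  shows "lin (r + 2) (lift r \<phi> h) c e =
    lin r \<phi> c e + c r * h e + c (r + 1) * ((\<Sum>j\<in>{1..<r}. (\<phi> j e)\<^sup>2) + (h e)\<^sup>2)"
proof -
  have "lin (r + 2) (lift r \<phi> h) c e = (\<Sum>i<r. c i * lift r \<phi> h i e) + c r * lift r \<phi> h r e
      + c (r + 1) * lift r \<phi> h (r + 1) e"
    by (simp add: lin_def)
  also have "(\<Sum>i<r. c i * lift r \<phi> h i e) = lin r \<phi> c e"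
    unfolding lin_def using assms by (intro sum.cong) (auto simp: lift_def)
  moreover have "lift r \<phi> h r e = h e"
    "lift r \<phi> h (r + 1) e = (\<Sum>j\<in>{1..<r}. (\<phi> j e)\<^sup>2) + (h e)\<^sup>2"
    using assms by (simp_all add: lift_def)
  ultimately show ?thesis by presburger
qed

lemma lin_lift_upd:
  "e \<noteq> s \<Longrightarrow> lin (r + 2) (lift r \<phi> (h(s := t))) c e = lin (r + 2) (lift r \<phi> h) c e"
  by (simp add: lin_def lift_def)

lemma quadratic_eventually_pos:
  fixes p q e :: real
  assumes "0 < p \<or> p = 0 \<and> 0 < q"
  shows "\<forall>\<^sub>F t in at_top. 0 < p * t\<^sup>2 + q * t + e"
proof (cases "0 < p")
  case True
  show ?thesis
  proof (rule eventually_at_top_linorderI)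
    fix t :: real assume t: "1 + (\<bar>q\<bar> + \<bar>e\<bar>) / p \<le> t"
    have t1: "1 \<le> t" using t True by (smt (verit) divide_nonneg_pos abs_ge_zero)
    have "p * (1 + (\<bar>q\<bar> + \<bar>e\<bar>) / p) \<le> p * t" using t True by (intro mult_left_mono) auto
    moreover have "p * (1 + (\<bar>q\<bar> + \<bar>e\<bar>) / p) = p + \<bar>q\<bar> + \<bar>e\<bar>" using True by (simp add: field_simps)
    ultimately have "p + \<bar>q\<bar> + \<bar>e\<bar> \<le> p * t" by linarith
    then have "(p + \<bar>q\<bar> + \<bar>e\<bar>) * t \<le> (p * t) * t" using t1 by (intro mult_right_mono) auto
    moreover have "\<bar>e\<bar> * 1 \<le> \<bar>e\<bar> * t" using t1 by (intro mult_left_mono) auto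
    moreover have "- \<bar>q\<bar> * t \<le> q * t" using t1 by (intro mult_right_mono) auto
    moreover have "0 < p * t" using True t1 by (intro mult_pos_pos) auto
    ultimately show "0 < p * t\<^sup>2 + q * t + e" by (simp add: power2_eq_square algebra_simps)
  qed
next
  case False
  then have q: "p = 0" "0 < q" using assms by auto
  show ?thesis
  proof (rule eventually_at_top_linorderI)
    fix t :: real assume t: "1 - e / q \<le> t"
    have "q * (1 - e / q) \<le> q * t" using t q by (intro mult_left_mono) auto
    then show "0 < p * t\<^sup>2 + q * t + e" using q by (simp add: algebra_simps)
  qed
qed

lemma lift_lead_eventually:
  fixes c :: "nat \<Rightarrow> real"
  assumes "lead r c \<noteq> 0"
  shows "\<forall>\<^sub>F t in at_top. 0 < lead r c * (a + c r * t + c (r + 1) * (w + t\<^sup>2))"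
proof -
  have "0 < lead r c * c (r + 1) \<or> lead r c * c (r + 1) = 0 \<and> 0 < lead r c * c r"
    using assms by (auto simp: lead_def zero_less_mult_iff neq_iff split: if_splits)
  from quadratic_eventually_pos[OF this, of "lead r c * (a + c (r + 1) * w)"]
  show ?thesis by eventually_elim (simp add: algebra_simps)
qed

text \<open>
  If \<open>W\<close> has at most \<open>r\<close> finite labels, the heights on them are interpolated by a lower functional, which
  gives \<open>c r = 1\<close> and the value \<open>0\<close> at infinity. Otherwise any nonzero functional vanishing on \<open>W\<close>
  works, because without its last two coefficients it would be a lower functional vanishing on more than
  \<open>r\<close> labels.
\<close>

lemma lead_vanishing_exists:
  assumes g: "generic r \<phi> E" and E: "finite E" "0 \<notin> E" and W: "W \<subseteq> insert 0 E" "card W \<le> r + 1"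
  shows "\<exists>c. lead r c \<noteq> 0 \<and> (\<forall>e\<in>W. lin (r + 2) (lift r \<phi> h) c e = 0)"
proof (cases "card (W - {0}) \<le> r")
  case True
  have W0: "finite (W - {0})" "W - {0} \<subseteq> E" using W E by (auto intro: finite_subset)
  obtain d where d: "\<And>e. e \<in> W - {0} \<Longrightarrow> lin r \<phi> d e = - h e"
    using genericD[OF g W0 True, of "\<lambda>e. - h e"] by blast
  define c where "c = (\<lambda>i. if i < r then d i else if i = r then 1 else (0::real))"
  have dc: "lin r \<phi> c e = lin r \<phi> d e" for e by (rule lin_cong) (simp add: c_def)
  have "lin (r + 2) (lift r \<phi> h) c e = 0" if "e \<in> W" for e
  proof (cases "e = 0")
    case True
    then show ?thesis using lin_lift_0[of r \<phi> h c] by (simp add: c_def)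
  next
    case False
    then show ?thesis unfolding lin_lift[OF False] dc using that d by (simp add: c_def)
  qed
  moreover have "lead r c \<noteq> 0" by (simp add: lead_def c_def)
  ultimately show ?thesis by blast
next
  case False
  have fW: "finite W" using W E finite_subset by blast
  have "card (W - {0}) \<le> card W" using fW by (simp add: card_mono)
  then have cW: "card W = r + 1" "card (W - {0}) = card W" using False W by auto
  then have W0: "0 \<notin> W" using fW by (metis card_Diff1_less less_irrefl)
  then have WE: "W \<subseteq> E" using W by auto
  have "card W < r + 2" using cW by simp
  from vanishing_exists[OF fW this, of "lift r \<phi> h"]
  obtain c where c: "\<exists>i<r + 2. c i \<noteq> 0" "\<forall>e\<in>W. lin (r + 2) (lift r \<phi> h) c e = 0" by blast
  have "lead r c \<noteq> 0"
  proof
    assume "lead r c = 0"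
    then have z: "c r = 0" "c (r + 1) = 0" by (auto simp: lead_def split: if_splits)
    obtain T where T: "T \<subseteq> W" "card T = r" "finite T"
      using obtain_subset_with_card_n[of r W] cW by auto
    have "lin r \<phi> c e = 0" if "e \<in> T" for e
    proof -
      have "e \<in> W" using that T by auto
      then have e: "e \<in> W" "e \<noteq> 0" using W0 by metis+
      from c(2) e(1) have "lin (r + 2) (lift r \<phi> h) c e = 0" by blast
      then show ?thesis unfolding lin_lift[OF e(2)] using z by simp
    qed
    then have "c i = 0" if "i < r" for i
      using generic_vanish[OF g T(3) _ T(2), of c i] T(1) WE that by blast
    moreover obtain i where i: "i < r + 2" "c i \<noteq> 0" using c(1) by blast
    moreover have "i < r \<or> i = r \<or> i = r + 1" using i by linarith
    ultimately show False using z by metis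
  qed
  with c(2) show ?thesis by blast
qed

text \<open>
  Induction along the list. For the height \<open>t\<close> of a new label \<open>s\<close>, the value at \<open>s\<close> of each of the
  finitely many relevant functionals is a polynomial in \<open>t\<close> whose top coefficient is the leading
  coefficient of the functional; so every sufficiently large \<open>t\<close> is suitable. Genericity with \<open>s\<close>
  follows because these values are nonzero.
\<close>

lemma lift_exists:
  assumes "distinct xs" "0 \<notin> set xs" "generic r \<phi> (set (butlast xs))"
  shows "\<exists>h. generic (r + 2) (lift r \<phi> h) (insert 0 (set xs)) \<and>
    (\<forall>j<length xs. \<forall>W c. W \<subseteq> insert 0 (set (take j xs)) \<longrightarrow> card W = r + 1 \<longrightarrow>
      (\<forall>e\<in>W. lin (r + 2) (lift r \<phi> h) c e = 0) \<longrightarrow> (\<exists>i<r + 2. c i \<noteq> 0) \<longrightarrow>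
      0 < lead r c * lin (r + 2) (lift r \<phi> h) c (xs ! j))"
  using assms
proof (induction xs rule: rev_induct)
  case Nil
  have "\<exists>c. \<forall>e\<in>W. lin (r + 2) (lift r \<phi> h) c e = t e" if "W \<subseteq> {0}" for W t h
  proof (intro exI[of _ "\<lambda>i. t 0"] ballI)
    fix e assume "e \<in> W"
    then have "e = 0" using that by auto
    then show "lin (r + 2) (lift r \<phi> h) (\<lambda>i. t 0) e = t e" by (simp only: lin_lift_0)
  qed
  then show ?case by (auto simp: generic_def)
next
  case (snoc s xs)
  let ?U = "insert 0 (set xs)"
  have s: "s \<noteq> 0" "s \<notin> set xs" "s \<notin> ?U" and d: "distinct xs" "0 \<notin> set xs"
    using snoc.prems(1,2) by auto
  have gxs: "generic r \<phi> (set xs)" using snoc.prems(3) by simp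
  then have "generic r \<phi> (set (butlast xs))" using generic_subset by (metis in_set_butlastD subsetI)
  from snoc.IH[OF d this] obtain h where gh: "generic (r + 2) (lift r \<phi> h) ?U"
    and lex: "\<forall>j<length xs. \<forall>W c. W \<subseteq> insert 0 (set (take j xs)) \<longrightarrow> card W = r + 1 \<longrightarrow>
      (\<forall>e\<in>W. lin (r + 2) (lift r \<phi> h) c e = 0) \<longrightarrow> (\<exists>i<r + 2. c i \<noteq> 0) \<longrightarrow>
      0 < lead r c * lin (r + 2) (lift r \<phi> h) c (xs ! j)" by blast
  define \<W> where "\<W> = {W. W \<subseteq> ?U \<and> card W \<le> r + 1}"
  have fin: "finite \<W>" unfolding \<W>_def by (rule finite_subset[of _ "Pow ?U"]) auto
  have "\<forall>W\<in>\<W>. \<exists>c. lead r c \<noteq> 0 \<and> (\<forall>e\<in>W. lin (r + 2) (lift r \<phi> h) c e = 0)"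
    using lead_vanishing_exists[OF gxs _ d(2)] by (auto simp: \<W>_def)
  from bchoice[OF this] obtain C where
    C: "\<forall>W\<in>\<W>. lead r (C W) \<noteq> 0 \<and> (\<forall>e\<in>W. lin (r + 2) (lift r \<phi> h) (C W) e = 0)" by blast
  let ?w = "\<Sum>j\<in>{1..<r}. (\<phi> j s)\<^sup>2"
  have "\<forall>\<^sub>F t in at_top. \<forall>W\<in>\<W>.
      0 < lead r (C W) * (lin r \<phi> (C W) s + C W r * t + C W (r + 1) * (?w + t\<^sup>2))"
    using C by (intro eventually_ball_finite fin ballI lift_lead_eventually) blast
  then obtain t where "\<forall>W\<in>\<W>. 0 < lead r (C W) * (lin r \<phi> (C W) s + C W r * t + C W (r + 1) * (?w + t\<^sup>2))"
    using eventually_happens'[OF trivial_limit_at_top_linorder] by blast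
  note t = this[rule_format]
  define \<psi> where "\<psi> = lift r \<phi> (h(s := t))"
  let ?L = "lin (r + 2) \<psi>"
  have old: "?L c e = lin (r + 2) (lift r \<phi> h) c e" if "e \<in> ?U" for c e
    unfolding \<psi>_def using that s by (intro lin_lift_upd) auto
  have Cs: "0 < lead r (C W) * ?L (C W) s" if "W \<in> \<W>" for W
    using t[OF that] unfolding \<psi>_def lin_lift[OF s(1)] by simp
  have CW: "?L (C W) e = 0" if "W \<in> \<W>" "e \<in> W" for W e
    using C old[of e "C W"] that by (auto simp: \<W>_def)
  have gen: "generic (r + 2) \<psi> (insert 0 (set (xs @ [s])))"
    unfolding generic_def
  proof (intro allI impI, elim conjE)
    fix W :: "nat set" and y :: "nat \<Rightarrow> real"
    assume W: "finite W" "W \<subseteq> insert 0 (set (xs @ [s]))" "card W \<le> r + 2"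
    show "\<exists>c. \<forall>e\<in>W. ?L c e = y e"
    proof (cases "s \<in> W")
      case False
      then have WU: "W \<subseteq> ?U" using W by auto
      obtain c where "\<And>e. e \<in> W \<Longrightarrow> lin (r + 2) (lift r \<phi> h) c e = y e"
        using genericD[OF gh W(1) WU W(3), of y] by blast
      then show ?thesis using old WU by (intro exI[of _ c]) auto
    next
      case True
      define W' where "W' = W - {s}"
      have W': "finite W'" "W' \<subseteq> ?U" "card W' \<le> r + 1" using W True by (auto simp: W'_def)
      then have W'W: "W' \<in> \<W>" by (simp add: \<W>_def)
      have "card W' \<le> r + 2" using W' by simp
      from genericD[OF gh W'(1,2) this, of y]
      obtain c where c: "\<And>e. e \<in> W' \<Longrightarrow> lin (r + 2) (lift r \<phi> h) c e = y e" by blast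
      define x where "x = (y s - ?L c s) / ?L (C W') s"
      have nz: "?L (C W') s \<noteq> 0" using Cs[OF W'W] by auto
      define b where "b = (\<lambda>i. c i + x * C W' i)"
      have b: "?L b e = ?L c e + x * ?L (C W') e" for e unfolding b_def by (rule lin_pencil)
      have "?L b e = y e" if e: "e \<in> W" for e
      proof (cases "e = s")
        case True
        then show ?thesis unfolding b x_def using nz by simp
      next
        case False
        then have e': "e \<in> W'" using e by (simp add: W'_def)
        then have "?L c e = y e" using c old W' by auto
        then show ?thesis unfolding b using CW[OF W'W e'] by simp
      qed
      then show ?thesis by blast
    qed
  qed
  have main: "0 < lead r c * ?L c ((xs @ [s]) ! j)"
    if j: "j < length (xs @ [s])" and W: "W \<subseteq> insert 0 (set (take j (xs @ [s])))" "card W = r + 1"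
      and c: "\<forall>e\<in>W. ?L c e = 0" "\<exists>i<r + 2. c i \<noteq> 0" for j W c
  proof (cases "j < length xs")
    case True
    then have W': "W \<subseteq> insert 0 (set (take j xs))" using W(1) by simp
    then have "W \<subseteq> ?U" by (auto dest: in_set_takeD)
    then have "lin (r + 2) (lift r \<phi> h) c e = 0" if "e \<in> W" for e
      using c(1) old[of e c] that by (metis subsetD)
    then have "0 < lead r c * lin (r + 2) (lift r \<phi> h) c (xs ! j)"
      using lex[rule_format, OF True W' W(2)] c(2) by blast
    then show ?thesis using True old[of "xs ! j" c] by (simp add: nth_append)
  next
    case False
    then have j: "j = length xs" using j by simp
    have WU: "W \<subseteq> ?U" using W(1) j by simp
    then have WW: "W \<in> \<W>" using W by (simp add: \<W>_def)
    have fW: "finite W" using WU finite_subset by blast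
    define y z where "y = ?L c s" and "z = ?L (C W) s"
    have z: "0 < lead r (C W) * z" using Cs[OF WW] by (simp add: z_def)
    define b where "b = (\<lambda>i. z * c i + (- y) * C W i)"
    have b: "?L b e = z * ?L c e + (- y) * ?L (C W) e" for e unfolding b_def by (rule lin_combine)
    have "?L b e = 0" if "e \<in> insert s W" for e
    proof (cases "e = s")
      case True
      then show ?thesis unfolding b y_def z_def by simp
    next
      case False
      then show ?thesis unfolding b using that c(1) CW[OF WW] by simp
    qed
    moreover have "s \<notin> W" using s(3) WU by blast
    then have "card (insert s W) = r + 2" using fW W(2) by simp
    moreover have "insert s W \<subseteq> insert 0 (set (xs @ [s]))" "finite (insert s W)" using WU fW by auto
    ultimately have "b i = 0" if "i < r + 2" for i
      using generic_vanish[OF gen, of "insert s W" b i] that by blast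
    then have eq: "z * c i = y * C W i" if "i < r + 2" for i using that by (simp add: b_def)
    have z0: "z \<noteq> 0" using z by auto
    have "y \<noteq> 0"
    proof
      assume "y = 0"
      with eq z0 have "c i = 0" if "i < r + 2" for i using that by simp
      with c(2) show False by blast
    qed
    have e1: "z * c (r + 1) = y * C W (r + 1)" and e2: "z * c r = y * C W r" using eq by auto
    then have "c (r + 1) = 0 \<longleftrightarrow> C W (r + 1) = 0" using z0 \<open>y \<noteq> 0\<close> by (metis mult_eq_0_iff)
    then have ld: "z * lead r c = y * lead r (C W)" using e1 e2 unfolding lead_def by presburger
    have "z\<^sup>2 * (lead r c * y) = (z * lead r c) * (z * y)" by (simp add: power2_eq_square mult_ac)
    also have "\<dots> = y\<^sup>2 * (lead r (C W) * z)" unfolding ld by (simp add: power2_eq_square mult_ac)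
    finally have "0 < z\<^sup>2 * (lead r c * y)" using z \<open>y \<noteq> 0\<close> by simp
    then have "0 < lead r c * y" using z0 by (simp add: zero_less_mult_iff)
    then show ?thesis using j by (simp add: y_def)
  qed
  show ?case
  proof (intro exI[of _ "h(s := t)"] conjI allI impI)
    show "generic (r + 2) (lift r \<phi> (h(s := t))) (insert 0 (set (xs @ [s])))"
      using gen by (simp only: \<psi>_def)
  qed (rule main[unfolded \<psi>_def])
qed

text \<open>
  The form of a configuration that comes from points of dimension \<open>2k - 1\<close>, with coordinates
  \<open>\<psi> 1, \<dots>, \<psi> (2k - 1)\<close>, together with infinity.
\<close>

definition paraboloid :: "nat \<Rightarrow> (nat \<Rightarrow> nat \<Rightarrow> real) \<Rightarrow> nat set \<Rightarrow> bool" where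
  "paraboloid k \<psi> E \<longleftrightarrow> (\<forall>i<2 * k + 1. \<psi> i 0 = (if i = 2 * k then 1 else 0)) \<and>
     (\<forall>e\<in>E. \<psi> 0 e = 1 \<and> \<psi> (2 * k) e = (\<Sum>i\<in>{1..<2 * k}. (\<psi> i e)\<^sup>2))"

text \<open>
  The combinatorial types that are available as input of a lifting: the constant \<open>1\<close> is a coordinate,
  so all labels are affine points, and the label \<open>p\<close> takes the role of infinity.
\<close>

definition polytope_types :: "nat \<Rightarrow> nat set \<Rightarrow> nat \<Rightarrow> nat set set set" where
  "polytope_types k V p = {faces_avoiding (2 * k + 1) \<psi> V p | \<psi>.
     generic (2 * k + 1) \<psi> V \<and> all_faces (2 * k + 1) \<psi> V k \<and> (\<forall>e\<in>V. \<psi> 0 e = 1)}"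

definition delaunay_types :: "nat \<Rightarrow> nat set \<Rightarrow> nat set set set" where
  "delaunay_types k E = {faces_avoiding (2 * k + 1) \<psi> (insert 0 E) 0 | \<psi>.
     paraboloid k \<psi> E \<and> generic (2 * k + 1) \<psi> (insert 0 E) \<and> all_faces (2 * k + 1) \<psi> (insert 0 E) k}"

text \<open>
  The cells \<open>D\<close> of a configuration \<open>\<psi>\<close> that is a lifting along \<open>xs\<close> of a configuration with cells \<open>D'\<close>,
  described only by the consequences that matter for recovering \<open>xs\<close> and \<open>D'\<close> from \<open>D\<close>: cells of
  initial segments, apex pairs, and the link of the last two labels.
\<close>

definition unfolds :: "nat \<Rightarrow> nat list \<Rightarrow> nat set set \<Rightarrow> (nat \<Rightarrow> nat \<Rightarrow> real) \<Rightarrow> nat set set \<Rightarrow> bool" where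
  "unfolds k xs D' \<psi> D \<longleftrightarrow>
     paraboloid k \<psi> (set xs) \<and> generic (2 * k + 1) \<psi> (insert 0 (set xs)) \<and>
     all_faces (2 * k + 1) \<psi> (insert 0 (set xs)) k \<and>
     D = faces_avoiding (2 * k + 1) \<psi> (insert 0 (set xs)) 0 \<and>
     (\<forall>j. 2 * k \<le> j \<longrightarrow> j \<le> length xs \<longrightarrow>
       faces_avoiding (2 * k + 1) \<psi> (insert 0 (set (take j xs))) 0 = {R \<in> D. R \<subseteq> set (take j xs)}) \<and>
     (\<forall>j. 2 * k \<le> Suc j \<longrightarrow> Suc j < length xs \<longrightarrow>
       apex_pair {R \<in> D. R \<subseteq> set (take (Suc (Suc j)) xs)} (set (take (Suc (Suc j)) xs)) k (xs ! Suc j) (xs ! j)) \<and>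
     inseparable (2 * k + 1) \<psi> (insert 0 (set (take (Suc (2 * k)) xs))) (xs ! (2 * k)) 0 \<and>
     (\<forall>R. R \<subseteq> set (take (length xs - 2) xs) \<longrightarrow> card R + 2 = 2 * k \<longrightarrow>
       (insert (xs ! (length xs - 2)) (insert (xs ! (length xs - 1)) R) \<in> D \<longleftrightarrow> R \<in> D'))"

lemma generic_cong:
  assumes same: "\<And>i e. i < r \<Longrightarrow> e \<in> V \<Longrightarrow> \<psi> i e = \<psi>' i e" and g: "generic r \<psi>' V"
  shows "generic r \<psi> V"
  unfolding generic_def
proof (intro allI impI, elim conjE)
  fix W t assume W: "finite W" "W \<subseteq> V" "card W \<le> r"
  obtain c where c: "\<And>e. e \<in> W \<Longrightarrow> lin r \<psi>' c e = t e" using genericD[OF g W, of t] by blast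
  have "lin r \<psi> c e = t e" if "e \<in> W" for e
  proof -
    have "lin r \<psi> c e = lin r \<psi>' c e"
      unfolding lin_def using same W(2) that by (intro sum.cong) auto
    then show ?thesis using c[OF that] by simp
  qed
  then show "\<exists>c. \<forall>e\<in>W. lin r \<psi> c e = t e" by blast
qed

lemma face_cong:
  assumes "\<And>i e. i < r \<Longrightarrow> e \<in> V \<Longrightarrow> \<psi> i e = \<psi>' i e"
  shows "face r \<psi> V S \<longleftrightarrow> face r \<psi>' V S"
proof -
  have "lin r \<psi> c e = lin r \<psi>' c e" if "e \<in> V" for c e
    unfolding lin_def using assms that by (intro sum.cong) auto
  then show ?thesis unfolding face_def by (metis DiffD1 subsetD)
qed

lemma unfolds_exists:
  assumes k: "1 \<le> k" and xs: "distinct xs" "0 \<notin> set xs" "2 * k + 2 \<le> length xs"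
    and D': "D' \<in> polytope_types (k - 1) (set (butlast xs)) (xs ! (length xs - 2))"
  shows "\<exists>\<psi> D. unfolds k xs D' \<psi> D"
proof -
  define r where "r = 2 * k - 1"
  have r: "r + 1 = 2 * k" "2 * (k - 1) + 1 = r" "r + 2 = 2 * k + 1" "1 \<le> r" using k by (auto simp: r_def)
  let ?V = "set (butlast xs)"
  define a where "a = last xs"
  have "xs \<noteq> []" using xs by auto
  then have xs_eq: "xs = butlast xs @ [a]" by (simp add: a_def)
  then have aV: "a \<notin> ?V" using xs(1) by (metis distinct_append distinct.simps(2) disjoint_iff list.set_intros(1))
  have set_xs: "set xs = insert a ?V" using xs_eq by (metis insert_is_Un list.set(1) list.simps(15) set_append sup_commute)
  obtain \<phi>0 where \<phi>0: "D' = faces_avoiding r \<phi>0 ?V (xs ! (length xs - 2))"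
    "generic r \<phi>0 ?V" "all_faces r \<phi>0 ?V (k - 1)" "\<And>e. e \<in> ?V \<Longrightarrow> \<phi>0 0 e = 1"
    using D' unfolding polytope_types_def r(2) by blast
  \<comment> \<open>The lower coordinates of \<open>a\<close> are arbitrary, except that \<open>\<phi> 0\<close> must be \<open>1\<close>.\<close>
  define \<phi> where "\<phi> = (\<lambda>i e. if e = a then 1 else \<phi>0 i e)"
  have same: "\<phi> i e = \<phi>0 i e" if "e \<in> ?V" for i e using that aV by (auto simp: \<phi>_def)
  have g: "generic r \<phi> ?V" using generic_cong[OF _ \<phi>0(2), of \<phi>] same by blast
  have fc: "face r \<phi> ?V S \<longleftrightarrow> face r \<phi>0 ?V S" for S using face_cong[of r ?V \<phi> \<phi>0] same by blast
  have nb: "all_faces r \<phi> ?V (k - 1)" using \<phi>0(3) fc by (simp add: all_faces_def)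
  have one: "\<phi> 0 e = 1" if "e \<in> set xs" for e using that \<phi>0(4) by (auto simp: \<phi>_def set_xs)
  obtain h where h: "generic (r + 2) (lift r \<phi> h) (insert 0 (set xs))"
    "\<forall>j<length xs. \<forall>W c. W \<subseteq> insert 0 (set (take j xs)) \<longrightarrow> card W = r + 1 \<longrightarrow>
      (\<forall>e\<in>W. lin (r + 2) (lift r \<phi> h) c e = 0) \<longrightarrow> (\<exists>i<r + 2. c i \<noteq> 0) \<longrightarrow>
      0 < lead r c * lin (r + 2) (lift r \<phi> h) c (xs ! j)"
    using lift_exists[OF xs(1,2) g] by blast
  define \<psi> where "\<psi> = lift r \<phi> h"
  interpret lex_lift k r \<phi> \<psi> xs
  proof
    show "lin (2 * k + 1) \<psi> c e = lin r \<phi> c e + c r * \<psi> r e + c (r + 1) * \<psi> (r + 1) e"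
      if "e \<in> set xs" for c e
    proof -
      have "e \<noteq> 0" using that xs(2) by metis
      then show ?thesis using lin_lift[of e r \<phi> h c] r(3) by (simp add: \<psi>_def lift_def)
    qed
    show "lin (2 * k + 1) \<psi> c 0 = c (r + 1)" for c
      using lin_lift_0[of r \<phi> h c] r(3) by (simp add: \<psi>_def)
    show "generic (2 * k + 1) \<psi> (insert 0 (set xs))" using h(1) r(3) by (simp add: \<psi>_def)
    show "0 < lead r c * lin (2 * k + 1) \<psi> c (xs ! j)"
      if "j < length xs" "W \<subseteq> insert 0 (set (take j xs))" "card W = 2 * k"
        "\<And>e. e \<in> W \<Longrightarrow> lin (2 * k + 1) \<psi> c e = 0" "\<exists>i<2 * k + 1. c i \<noteq> 0" for j W c
      using h(2)[rule_format, of j W c] that unfolding r(3) r(1) \<psi>_def by blast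
  qed (use r xs g nb in auto)
  define N where "N = length xs"
  have "N \<ge> 4" using xs(3) k by (simp add: N_def)
  define j where "j = N - 2"
  have j: "Suc j < length xs" "Suc (Suc j) = length xs" "length xs - 2 = j" "length xs - 1 = Suc j"
    using \<open>N \<ge> 4\<close> by (auto simp: j_def N_def)
  define D where "D = faces_avoiding (2 * k + 1) \<psi> (insert 0 (set xs)) 0"
  have par: "paraboloid k \<psi> (set xs)"
  proof -
    have "{1..<2 * k} = insert r {1..<r}" using r by auto
    then have sm: "(\<Sum>i\<in>{1..<2 * k}. (\<psi> i e)\<^sup>2) = (\<psi> r e)\<^sup>2 + (\<Sum>i\<in>{1..<r}. (\<psi> i e)\<^sup>2)" for e
      by simp
    have "\<psi> (2 * k) e = (\<Sum>i\<in>{1..<2 * k}. (\<psi> i e)\<^sup>2)" "\<psi> 0 e = 1" if e: "e \<in> set xs" for e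
    proof -
      have e0: "e \<noteq> 0" using e xs(2) by metis
      have "(\<Sum>i\<in>{1..<r}. (\<psi> i e)\<^sup>2) = (\<Sum>i\<in>{1..<r}. (\<phi> i e)\<^sup>2)"
        using e0 by (intro sum.cong) (auto simp: \<psi>_def lift_def)
      moreover have "\<psi> (2 * k) e = (\<Sum>i\<in>{1..<r}. (\<phi> i e)\<^sup>2) + (h e)\<^sup>2" "\<psi> r e = h e"
        using e0 r(1)[symmetric] by (simp_all add: \<psi>_def lift_def)
      ultimately show "\<psi> (2 * k) e = (\<Sum>i\<in>{1..<2 * k}. (\<psi> i e)\<^sup>2)" unfolding sm by simp
      show "\<psi> 0 e = 1" using e0 r(4) one[OF e] by (simp add: \<psi>_def lift_def)
    qed
    moreover have "\<psi> i 0 = (if i = 2 * k then 1 else 0)" if "i < 2 * k + 1" for i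
      using r(1)[symmetric] by (simp add: \<psi>_def lift_def)
    ultimately show ?thesis by (simp add: paraboloid_def)
  qed
  have restrict: "faces_avoiding (2 * k + 1) \<psi> (insert 0 (set (take i xs))) 0 = {R \<in> D. R \<subseteq> set (take i xs)}"
    if "2 * k \<le> i" "i \<le> length xs" for i
    using cells_take[OF that] by (simp add: D_def)
  have apex: "apex_pair {R \<in> D. R \<subseteq> set (take (Suc (Suc i)) xs)} (set (take (Suc (Suc i)) xs)) k (xs ! Suc i) (xs ! i)"
    if "2 * k \<le> Suc i" "Suc i < length xs" for i
    using apex_pair_next[OF that(2,1)] restrict[of "Suc (Suc i)"] that by simp
  have link: "insert (xs ! j) (insert (xs ! Suc j) R) \<in> D \<longleftrightarrow> R \<in> D'"
    if R: "R \<subseteq> set (take j xs)" "card R + 2 = 2 * k" for R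
  proof -
    have bl: "set (take (Suc j) xs) = ?V" by (simp only: butlast_conv_take j(4))
    have xj: "xs ! j \<notin> R" using R(1) nth_notin[of j] j by auto
    have "card R + 1 = r" using R r by simp
    from link_face[OF j(1) R(1) this] j(2) bl
    have "face (2 * k + 1) \<psi> (insert 0 (set xs)) (insert (xs ! j) (insert (xs ! Suc j) R)) \<longleftrightarrow> face r \<phi> ?V R"
      by simp
    moreover have "0 \<notin> insert (xs ! j) (insert (xs ! Suc j) R)"
      using nth_nonzero[OF Suc_lessD[OF j(1)]] nth_nonzero[OF j(1)] R(1) zero_take[of j] by (metis insert_iff subsetD)
    moreover have "R \<subseteq> ?V" using R(1) take_butlast[of j] j(1) by auto
    ultimately show ?thesis
      using xj R(1) unfolding D_def \<phi>0(1) faces_avoiding_def j(3) fc[symmetric]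
      by (auto simp: face_def)
  qed
  have "unfolds k xs D' \<psi> D"
    unfolding unfolds_def
    using par g neighborly_lift restrict apex link j inseparable_infinity[of "2 * k"] xs(3) lex_lift.g[OF lex_lift_axioms]
    by (auto simp: D_def)
  then show ?thesis by blast
qed

section \<open>Counting labeled types\<close>

text \<open>
  Dividing all vectors by \<open>1 + |x|\<^sup>2\<close>, which is \<open>1\<close> at infinity, is a stereographic projection to the
  sphere. It makes \<open>1\<close> a coordinate and does not change the signs of functionals. Infinity becomes the
  ordinary label \<open>p\<close>.
\<close>

lemma delaunay_types_subset_polytope_types:
  assumes k: "1 \<le> k" and E: "0 \<notin> E" "p \<notin> E"
  shows "delaunay_types k E \<subseteq> polytope_types k (insert p E) p"
proof
  fix D assume "D \<in> delaunay_types k E"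
  then obtain \<psi> where D: "D = faces_avoiding (2 * k + 1) \<psi> (insert 0 E) 0" and par: "paraboloid k \<psi> E"
    and g: "generic (2 * k + 1) \<psi> (insert 0 E)" and nb: "all_faces (2 * k + 1) \<psi> (insert 0 E) k"
    by (auto simp: delaunay_types_def)
  define \<sigma> where "\<sigma> = (\<lambda>e. if e = p then 0 else e)"
  define w where "w = (\<lambda>x. \<psi> 0 x + \<psi> (2 * k) x)"
  define \<psi>' where "\<psi>' = (\<lambda>i e. if i = 0 then 1 else \<psi> i (\<sigma> e) / w (\<sigma> e))"
  have wpos: "0 < w x" if "x \<in> insert 0 E" for x
  proof (cases "x = 0")
    case True
    then show ?thesis using par k by (simp add: w_def paraboloid_def)
  next
    case False
    then have "\<psi> 0 x = 1" "\<psi> (2 * k) x = (\<Sum>i\<in>{1..<2 * k}. (\<psi> i x)\<^sup>2)"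
      using par that by (auto simp: paraboloid_def)
    then show ?thesis by (simp add: w_def sum_nonneg add_pos_nonneg)
  qed
  have \<sigma>: "\<sigma> e \<in> insert 0 E" if "e \<in> insert p E" for e using that by (auto simp: \<sigma>_def)
  have fixE: "\<sigma> e = e" if "e \<in> E" for e
  proof -
    have "e \<noteq> p" using that E(2) by blast
    then show ?thesis by (simp add: \<sigma>_def)
  qed
  have inj: "inj_on \<sigma> (insert p E)"
  proof (rule inj_onI)
    fix x y assume xy: "x \<in> insert p E" "y \<in> insert p E" "\<sigma> x = \<sigma> y"
    have p: "\<sigma> p = 0" by (simp add: \<sigma>_def)
    show "x = y" using xy fixE p E by (metis insertE)
  qed
  have \<sigma>E: "\<sigma> ` R = R" if "R \<subseteq> E" for R
  proof -
    have "\<sigma> ` R = id ` R" using that fixE by (intro image_cong) auto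
    then show ?thesis by simp
  qed
  have im: "\<sigma> ` insert p E = insert 0 E" unfolding image_insert \<sigma>E[OF order_refl] by (simp add: \<sigma>_def)
  have lin: "lin (2 * k + 1) \<psi>' c e = lin (2 * k + 1) \<psi> (c(2 * k := c (2 * k) + c 0)) (\<sigma> e) / w (\<sigma> e)"
    if e: "e \<in> insert p E" for c e
  proof -
    let ?x = "\<sigma> e"
    have w0: "w ?x \<noteq> 0" using wpos[OF \<sigma>[OF e]] by simp
    have split: "{..<2 * k + 1} = insert 0 (insert (2 * k) {1..<2 * k})" using k by auto
    have "lin (2 * k + 1) \<psi>' c e = c 0 + c (2 * k) * (\<psi> (2 * k) ?x / w ?x) + (\<Sum>i\<in>{1..<2 * k}. c i * (\<psi> i ?x / w ?x))"
      unfolding lin_def split using k by (simp add: \<psi>'_def)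
    also have "\<dots> = (c 0 * w ?x + c (2 * k) * \<psi> (2 * k) ?x + (\<Sum>i\<in>{1..<2 * k}. c i * \<psi> i ?x)) / w ?x"
      using w0 by (simp add: add_divide_distrib sum_divide_distrib)
    also have "c 0 * w ?x + c (2 * k) * \<psi> (2 * k) ?x + (\<Sum>i\<in>{1..<2 * k}. c i * \<psi> i ?x)
        = lin (2 * k + 1) \<psi> (c(2 * k := c (2 * k) + c 0)) ?x"
      unfolding lin_def split w_def using k by (simp add: algebra_simps)
    finally show ?thesis .
  qed
  have lin': "lin (2 * k + 1) \<psi> c (\<sigma> e) = w (\<sigma> e) * lin (2 * k + 1) \<psi>' (c(2 * k := c (2 * k) - c 0)) e"
    if e: "e \<in> insert p E" for c e
  proof -
    have "w (\<sigma> e) \<noteq> 0" using wpos[OF \<sigma>[OF e]] by simp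
    moreover have "(c(2 * k := c (2 * k) - c 0)) (2 * k := (c(2 * k := c (2 * k) - c 0)) (2 * k) + (c(2 * k := c (2 * k) - c 0)) 0) = c"
      using k by auto
    ultimately show ?thesis using lin[OF e, of "c(2 * k := c (2 * k) - c 0)"] by simp
  qed
  have face: "face (2 * k + 1) \<psi>' (insert p E) S \<longleftrightarrow> face (2 * k + 1) \<psi> (insert 0 E) (\<sigma> ` S)"
    if S: "S \<subseteq> insert p E" for S
  proof
    assume "face (2 * k + 1) \<psi>' (insert p E) S"
    then obtain c where c: "\<forall>e\<in>S. lin (2 * k + 1) \<psi>' c e = 0" "\<forall>e\<in>insert p E - S. 0 < lin (2 * k + 1) \<psi>' c e"
      by (rule faceE)
    let ?d = "c(2 * k := c (2 * k) + c 0)"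
    have "lin (2 * k + 1) \<psi> ?d x = 0" if x: "x \<in> \<sigma> ` S" for x
    proof -
      obtain e where e: "e \<in> S" "x = \<sigma> e" using x by blast
      then have eV: "e \<in> insert p E" using S by blast
      then show ?thesis using c(1) e lin[OF eV, of c] wpos[OF \<sigma>[OF eV]] by simp
    qed
    moreover have "0 < lin (2 * k + 1) \<psi> ?d x" if x: "x \<in> insert 0 E - \<sigma> ` S" for x
    proof -
      obtain e where e: "e \<in> insert p E" "x = \<sigma> e" using x im by blast
      then have "e \<in> insert p E - S" using x by blast
      then have "0 < lin (2 * k + 1) \<psi>' c e" using c(2) by blast
      then show ?thesis using e lin[OF e(1), of c] wpos[OF \<sigma>[OF e(1)]] by (simp add: zero_less_divide_iff)
    qed
    moreover have "\<sigma> ` S \<subseteq> insert 0 E" using image_mono[OF S, of \<sigma>] by (simp only: im)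
    ultimately show "face (2 * k + 1) \<psi> (insert 0 E) (\<sigma> ` S)" by (intro faceI[where c = ?d] ballI)
  next
    assume "face (2 * k + 1) \<psi> (insert 0 E) (\<sigma> ` S)"
    then obtain c where c: "\<forall>e\<in>\<sigma> ` S. lin (2 * k + 1) \<psi> c e = 0" "\<forall>e\<in>insert 0 E - \<sigma> ` S. 0 < lin (2 * k + 1) \<psi> c e"
      by (rule faceE)
    let ?d = "c(2 * k := c (2 * k) - c 0)"
    have "lin (2 * k + 1) \<psi>' ?d e = 0" if e: "e \<in> S" for e
    proof -
      have eV: "e \<in> insert p E" using S e by blast
      then show ?thesis using c(1) e lin'[OF eV, of c] wpos[OF \<sigma>[OF eV]] by simp
    qed
    moreover have "0 < lin (2 * k + 1) \<psi>' ?d e" if e: "e \<in> insert p E - S" for e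
    proof -
      have eV: "e \<in> insert p E" using e by blast
      have "\<sigma> e \<notin> \<sigma> ` S" using inj S e by (meson DiffD1 DiffD2 inj_on_image_mem_iff)
      then have "0 < lin (2 * k + 1) \<psi> c (\<sigma> e)" using c(2) \<sigma>[OF eV] by blast
      then show ?thesis using lin'[OF eV, of c] wpos[OF \<sigma>[OF eV]] by (simp add: zero_less_mult_iff)
    qed
    ultimately show "face (2 * k + 1) \<psi>' (insert p E) S" using S by (intro faceI[where c = ?d] ballI)
  qed
  have "generic (2 * k + 1) \<psi>' (insert p E)"
    unfolding generic_def
  proof (intro allI impI, elim conjE)
    fix W t assume W: "finite W" "W \<subseteq> insert p E" "card W \<le> 2 * k + 1"
    have injW: "inj_on \<sigma> W" using inj W(2) inj_on_subset by blast
    have "finite (\<sigma> ` W)" "\<sigma> ` W \<subseteq> insert 0 E" "card (\<sigma> ` W) \<le> 2 * k + 1"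
      using W(1,3) image_mono[OF W(2), of \<sigma>] card_image[OF injW] by (simp_all only: im finite_imageI)
    from genericD[OF g this, of "\<lambda>x. w x * t (the_inv_into W \<sigma> x)"]
    obtain c where c: "\<And>x. x \<in> \<sigma> ` W \<Longrightarrow> lin (2 * k + 1) \<psi> c x = w x * t (the_inv_into W \<sigma> x)" by blast
    have "lin (2 * k + 1) \<psi>' (c(2 * k := c (2 * k) - c 0)) e = t e" if e: "e \<in> W" for e
    proof -
      have eV: "e \<in> insert p E" using W(2) e by blast
      have "lin (2 * k + 1) \<psi> c (\<sigma> e) = w (\<sigma> e) * t e" using c[of "\<sigma> e"] e the_inv_into_f_f[OF injW e] by simp
      then show ?thesis using lin'[OF eV, of c] wpos[OF \<sigma>[OF eV]] by simp
    qed
    then show "\<exists>c. \<forall>e\<in>W. lin (2 * k + 1) \<psi>' c e = t e" by blast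
  qed
  moreover have "all_faces (2 * k + 1) \<psi>' (insert p E) k"
    unfolding all_faces_def
  proof (intro allI impI)
    fix S assume S: "S \<subseteq> insert p E" "card S = k"
    then have "card (\<sigma> ` S) = k" "\<sigma> ` S \<subseteq> insert 0 E"
      using card_image[OF inj_on_subset[OF inj S(1)]] image_mono[OF S(1), of \<sigma>] by (simp_all only: im)
    then show "face (2 * k + 1) \<psi>' (insert p E) S" using nb face[OF S(1)] by (simp add: all_faces_def)
  qed
  moreover have "D = faces_avoiding (2 * k + 1) \<psi>' (insert p E) p"
  proof -
    have "R \<subseteq> insert 0 E - {0} \<and> face (2 * k + 1) \<psi> (insert 0 E) R \<longleftrightarrow>
        R \<subseteq> insert p E - {p} \<and> face (2 * k + 1) \<psi>' (insert p E) R" for R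
    proof -
      have "R \<subseteq> insert 0 E - {0} \<longleftrightarrow> R \<subseteq> E" "R \<subseteq> insert p E - {p} \<longleftrightarrow> R \<subseteq> E" using E by auto
      moreover have "face (2 * k + 1) \<psi>' (insert p E) R \<longleftrightarrow> face (2 * k + 1) \<psi> (insert 0 E) R" if "R \<subseteq> E"
        using face[of R] \<sigma>E[OF that] that by auto
      ultimately show ?thesis by blast
    qed
    then show ?thesis unfolding D faces_avoiding_def by (intro Collect_cong)
  qed
  ultimately show "D \<in> polytope_types k (insert p E) p"
    unfolding polytope_types_def by (auto simp: \<psi>'_def)
qed

lemma cells_iff_facet:
  assumes g: "generic (2 * m + 1) \<psi> V" and V: "finite V" "2 * m + 1 \<le> card V" "p \<in> V"
  shows "R \<in> faces_avoiding (2 * m + 1) \<psi> V p \<longleftrightarrow> (\<exists>F\<in>faces_avoiding (2 * m + 1) \<psi> V p. card F = 2 * m \<and> R \<subseteq> F)"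
proof
  assume R: "R \<in> faces_avoiding (2 * m + 1) \<psi> V p"
  then have "face (2 * m + 1) \<psi> V R" "p \<in> V - R" using V(3) by (auto simp: faces_avoiding_def)
  from extend_to_facet[OF g V(1,2) this] obtain F where
    F: "R \<subseteq> F" "face (2 * m + 1) \<psi> V F" "p \<notin> F" "card F + 1 = 2 * m + 1" by blast
  then have "F \<in> faces_avoiding (2 * m + 1) \<psi> V p" by (auto simp: faces_avoiding_def face_def)
  with F show "\<exists>F\<in>faces_avoiding (2 * m + 1) \<psi> V p. card F = 2 * m \<and> R \<subseteq> F" by auto
next
  assume "\<exists>F\<in>faces_avoiding (2 * m + 1) \<psi> V p. card F = 2 * m \<and> R \<subseteq> F"
  then obtain F where F: "F \<in> faces_avoiding (2 * m + 1) \<psi> V p" "card F = 2 * m" "R \<subseteq> F" by blast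
  then have "face (2 * m + 1) \<psi> V R"
    using face_subset[OF g V(1), of F R] by (simp add: faces_avoiding_def)
  with F show "R \<in> faces_avoiding (2 * m + 1) \<psi> V p" by (auto simp: faces_avoiding_def)
qed

lemma set_take_eq:
  assumes "distinct xs" "distinct ys" "set xs = set ys" "length xs = length ys"
    and "\<And>i. j \<le> i \<Longrightarrow> i < length xs \<Longrightarrow> xs ! i = ys ! i"
  shows "set (take j xs) = set (take j ys)"
proof -
  have "drop j xs = drop j ys"
    using assms(4,5) by (intro nth_equalityI) auto
  moreover have "set (take j zs) = set zs - set (drop j zs)" if "distinct zs" for zs :: "'a list"
    using set_take_disj_set_drop_if_distinct[OF that, of j j] append_take_drop_id[of j zs]
    by (metis Diff_cancel Un_Diff Diff_triv order_refl set_append sup_bot.right_neutral)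
  ultimately show ?thesis using assms(1-3) by simp
qed

lemma unfoldsD:
  assumes "unfolds k xs D' \<psi> D"
  shows "paraboloid k \<psi> (set xs)" "generic (2 * k + 1) \<psi> (insert 0 (set xs))"
    "all_faces (2 * k + 1) \<psi> (insert 0 (set xs)) k"
    "D = faces_avoiding (2 * k + 1) \<psi> (insert 0 (set xs)) 0"
    "2 * k \<le> j \<Longrightarrow> j \<le> length xs \<Longrightarrow>
       faces_avoiding (2 * k + 1) \<psi> (insert 0 (set (take j xs))) 0 = {R \<in> D. R \<subseteq> set (take j xs)}"
    "2 * k \<le> Suc j \<Longrightarrow> Suc j < length xs \<Longrightarrow>
       apex_pair {R \<in> D. R \<subseteq> set (take (Suc (Suc j)) xs)} (set (take (Suc (Suc j)) xs)) k (xs ! Suc j) (xs ! j)"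
    "inseparable (2 * k + 1) \<psi> (insert 0 (set (take (Suc (2 * k)) xs))) (xs ! (2 * k)) 0"
    "R \<subseteq> set (take (length xs - 2) xs) \<Longrightarrow> card R + 2 = 2 * k \<Longrightarrow>
       insert (xs ! (length xs - 2)) (insert (xs ! (length xs - 1)) R) \<in> D \<longleftrightarrow> R \<in> D'"
  using assms unfolding unfolds_def by blast+

text \<open>
  Two lists for the same cells that end in the same label agree from the end down to position \<open>2k\<close>: as
  long as at least \<open>2k + 2\<close> labels remain, the last one has only one partner, in any realization of the
  cells.
\<close>

lemma unfolds_agree:
  assumes k: "1 \<le> k" and x: "unfolds k xs D1 \<psi>1 D" "distinct xs" and y: "unfolds k ys D2 \<psi>2 D" "distinct ys"
    and set: "set xs = set ys" "0 \<notin> set xs" and len: "length xs = N" "2 * k + 2 \<le> N"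
    and last: "xs ! (N - 1) = ys ! (N - 1)" and j: "2 * k \<le> j" "j < N"
  shows "xs ! j = ys ! j"
proof -
  have leny: "length ys = N" using set(1) x(2) y(2) len(1) by (metis distinct_card)
  have "\<forall>i. j \<le> i \<longrightarrow> i < N \<longrightarrow> xs ! i = ys ! i" if "2 * k \<le> j" "j \<le> N - 1" for j
    using that(2,1)
  proof (induction j rule: inc_induct)
    case base
    show ?case
    proof (intro allI impI)
      fix i assume "N - 1 \<le> i" "i < N"
      then have "i = N - 1" by simp
      then show "xs ! i = ys ! i" using last by simp
    qed
  next
    case (step n)
    have IH: "\<forall>i. Suc n \<le> i \<longrightarrow> i < N \<longrightarrow> xs ! i = ys ! i" using step by simp
    have n: "Suc n < N" using step by simp
    let ?T = "set (take (Suc (Suc n)) xs)"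
    have T: "?T = set (take (Suc (Suc n)) ys)"
      using IH len leny by (intro set_take_eq[OF x(2) y(2) set(1)]) auto
    have T0: "0 \<notin> ?T" using set(2) by (auto dest: in_set_takeD)
    then have E: "insert 0 ?T - {0} = ?T" by auto
    have sub: "insert 0 ?T \<subseteq> insert 0 (set xs)" by (auto dest: in_set_takeD)
    have g: "generic (2 * k + 1) \<psi>1 (insert 0 ?T)" and nb: "all_faces (2 * k + 1) \<psi>1 (insert 0 ?T) k"
      using generic_subset[OF unfoldsD(2)[OF x(1)] sub] all_faces_restrict[OF unfoldsD(3)[OF x(1)] sub] by auto
    have cells: "faces_avoiding (2 * k + 1) \<psi>1 (insert 0 ?T) 0 = {R \<in> D. R \<subseteq> ?T}"
      using unfoldsD(5)[OF x(1), of "Suc (Suc n)"] step n len by simp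
    have "card ?T = Suc (Suc n)" using x(2) n len by (simp add: distinct_card)
    then have card: "2 * k + 3 \<le> card (insert 0 ?T)" using T0 step by simp
    have ax: "apex_pair {R \<in> D. R \<subseteq> ?T} ?T k (xs ! Suc n) (xs ! n)"
      using unfoldsD(6)[OF x(1), of n] step n len by simp
    have "apex_pair {R \<in> D. R \<subseteq> ?T} ?T k (ys ! Suc n) (ys ! n)"
      using unfoldsD(6)[OF y(1), of n] step n leny unfolding T by simp
    then have ay: "apex_pair {R \<in> D. R \<subseteq> ?T} ?T k (xs ! Suc n) (ys ! n)"
      using IH n by simp
    have "xs ! n = ys ! n"
      by (rule apex_partner_unique[OF g _ card k nb, of 0 "xs ! Suc n"])
        (use ax ay in \<open>simp_all only: cells E, simp_all\<close>)
    with IH show ?case by (metis Suc_leI le_neq_implies_less)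
  qed
  then show ?thesis using j by simp
qed

text \<open>
  The cells \<open>D'\<close> are determined by their facets, and those form the link of the last two labels.
\<close>

lemma unfolds_lower_unique:
  assumes k: "1 \<le> k" and x: "unfolds k xs D1 \<psi>1 D" "unfolds k xs D2 \<psi>2 D" "distinct xs" "2 * k + 2 \<le> length xs"
    and D1: "D1 \<in> polytope_types (k - 1) (set (butlast xs)) (xs ! (length xs - 2))"
    and D2: "D2 \<in> polytope_types (k - 1) (set (butlast xs)) (xs ! (length xs - 2))"
  shows "D1 = D2"
proof -
  let ?V = "set (butlast xs)" and ?p = "xs ! (length xs - 2)"
  define j where "j = length xs - 2"
  have j: "length xs - 1 = Suc j" "Suc j < length xs" using x(4) by (auto simp: j_def)
  have "butlast xs = take (Suc j) xs" by (simp only: butlast_conv_take j(1))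
  then have V: "?V = insert ?p (set (take j xs))" using j by (simp add: take_Suc_conv_app_nth j_def)
  have p: "?p \<in> ?V" using V by blast
  have cV: "card ?V = length xs - 1" using x(3) by (simp add: distinct_card distinct_butlast)
  have char: "D = {R. \<exists>F\<in>D. F \<subseteq> set (take j xs) \<and> card F + 2 = 2 * k \<and> R \<subseteq> F}"
    if D: "D \<in> polytope_types (k - 1) ?V ?p" for D
  proof -
    obtain \<psi> where \<psi>: "D = faces_avoiding (2 * (k - 1) + 1) \<psi> ?V ?p" "generic (2 * (k - 1) + 1) \<psi> ?V"
      using D by (auto simp: polytope_types_def)
    have "2 * (k - 1) + 1 \<le> card ?V" using cV x(4) by simp
    then have f1: "R \<in> D \<longleftrightarrow> (\<exists>F\<in>D. card F = 2 * (k - 1) \<and> R \<subseteq> F)" for R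
      unfolding \<psi>(1) by (intro cells_iff_facet[OF \<psi>(2) _ _ p] finite_set)
    have f2: "F \<subseteq> set (take j xs)" if "F \<in> D" for F
      using that V by (auto simp: \<psi>(1) faces_avoiding_def)
    have f3: "card F = 2 * (k - 1) \<longleftrightarrow> card F + 2 = 2 * k" for F :: "nat set" using k by auto
    show ?thesis
    proof (rule set_eqI)
      fix R
      have "(\<exists>F\<in>D. card F = 2 * (k - 1) \<and> R \<subseteq> F) \<longleftrightarrow>
          (\<exists>F\<in>D. F \<subseteq> set (take j xs) \<and> card F + 2 = 2 * k \<and> R \<subseteq> F)"
        using f2 f3 by (intro bex_cong) auto
      then show "R \<in> D \<longleftrightarrow> R \<in> {R. \<exists>F\<in>D. F \<subseteq> set (take j xs) \<and> card F + 2 = 2 * k \<and> R \<subseteq> F}"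
        by (simp only: mem_Collect_eq f1[of R])
    qed
  qed
  have "R \<in> D1 \<longleftrightarrow> R \<in> D2" if "R \<subseteq> set (take j xs)" "card R + 2 = 2 * k" for R
    using unfoldsD(8)[OF x(1), of R] unfoldsD(8)[OF x(2), of R] that unfolding j_def by blast
  then have "{R. \<exists>F\<in>D1. F \<subseteq> set (take j xs) \<and> card F + 2 = 2 * k \<and> R \<subseteq> F} =
      {R. \<exists>F\<in>D2. F \<subseteq> set (take j xs) \<and> card F + 2 = 2 * k \<and> R \<subseteq> F}" by blast
  then show ?thesis using char[OF D1] char[OF D2] by simp
qed

text \<open>
  An input is determined by its last label, its label at position \<open>2k - 1\<close> and the order of the labels
  before that position. There are at most \<open>2\<close>, \<open>k\<close> and \<open>(2k - 1)!\<close> choices for these.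
\<close>

lemma unfolds_fibre:
  assumes k: "1 \<le> k" and E: "finite E" "0 \<notin> E" "card E = N" "2 * k + 2 \<le> N"
    and Q: "\<And>xs D'. (xs, D') \<in> Q \<Longrightarrow> distinct xs \<and> set xs = E \<and>
      D' \<in> polytope_types (k - 1) (set (butlast xs)) (xs ! (N - 2)) \<and> (\<exists>\<psi>. unfolds k xs D' \<psi> D)"
  shows "card Q \<le> fact (2 * k)"
proof (cases "Q = {}")
  case False
  define A where "A = {a. \<exists>xs D'. (xs, D') \<in> Q \<and> xs ! (N - 1) = a}"
  have len: "length xs = N" if "(xs, D') \<in> Q" for xs D' using Q[OF that] E(3) by (metis distinct_card)
  have A2: "card A \<le> 2" "finite A"
  proof -
    obtain zs D0 where z: "(zs, D0) \<in> Q" using False by auto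
    then obtain \<psi> where \<psi>: "unfolds k zs D0 \<psi> D" using Q by blast
    have zE: "set zs = E" using Q[OF z] by blast
    have E0: "insert 0 E - {0} = E" using E(2) by auto
    have Dc: "D = faces_avoiding (2 * k + 1) \<psi> (insert 0 E) 0" and g: "generic (2 * k + 1) \<psi> (insert 0 E)"
      and nb: "all_faces (2 * k + 1) \<psi> (insert 0 E) k"
      using unfoldsD(2-4)[OF \<psi>] unfolding zE by auto
    have "2 * k + 3 \<le> card (insert 0 E)" using E by simp
    from apex_at_most_two[OF g _ this k nb, of 0]
    have two: "card {b. \<exists>c. apex_pair D E k b c} \<le> 2" using E Dc[symmetric] E0 by simp
    have "A \<subseteq> {b. \<exists>c. apex_pair D E k b c}"
    proof
      fix a assume "a \<in> A"
      then obtain xs D' where x: "(xs, D') \<in> Q" "xs ! (N - 1) = a" by (auto simp: A_def)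
      then obtain \<psi>' where u: "unfolds k xs D' \<psi>' D" using Q by blast
      have xE: "set xs = E" using Q[OF x(1)] by blast
      have N: "Suc (Suc (N - 2)) = N" "Suc (N - 2) = N - 1" using E(4) by auto
      have "apex_pair {R \<in> D. R \<subseteq> set (take N xs)} (set (take N xs)) k (xs ! (N - 1)) (xs ! (N - 2))"
        using unfoldsD(6)[OF u, of "N - 2"] len[OF x(1)] E(4) unfolding N by simp
      moreover have "{R \<in> D. R \<subseteq> E} = D" using E0 by (auto simp: Dc faces_avoiding_def)
      ultimately show "a \<in> {b. \<exists>c. apex_pair D E k b c}" using len[OF x(1)] xE x(2) by auto
    qed
    moreover have "finite {b. \<exists>c. apex_pair D E k b c}"
      using E(1) by (rule rev_finite_subset) (auto simp: apex_pair_def)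
    ultimately show "card A \<le> 2" "finite A" using two card_mono finite_subset by (meson le_trans)+
  qed
  have "\<forall>a\<in>A. \<exists>xs. \<exists>D'. (xs, D') \<in> Q \<and> xs ! (N - 1) = a" by (auto simp: A_def)
  from bchoice[OF this] obtain rep where rep: "\<forall>a\<in>A. \<exists>D'. (rep a, D') \<in> Q \<and> rep a ! (N - 1) = a" by blast
  \<comment> \<open>By \<open>unfolds_agree\<close>, all inputs with last label \<open>a\<close> share these data with the representative.\<close>
  define T where "T = (\<lambda>a. set (take (Suc (2 * k)) (rep a)))"
  define s where "s = (\<lambda>a. rep a ! (2 * k))"
  define B where "B = (\<lambda>a. {c. apex_pair {R \<in> D. R \<subseteq> T a} (T a) k (s a) c})"
  have Tcard: "card (T a) = Suc (2 * k)" "finite (T a)" "0 \<notin> T a" "s a \<in> T a" if a: "a \<in> A" for a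
  proof -
    obtain D' where r: "(rep a, D') \<in> Q" using rep a by blast
    note q = Q[OF r] len[OF r]
    show "card (T a) = Suc (2 * k)" "finite (T a)" using q E(4) by (simp_all add: T_def distinct_card)
    show "0 \<notin> T a" using q E(2) by (auto simp: T_def dest: in_set_takeD)
    show "s a \<in> T a" using q E(4) by (auto simp: T_def s_def in_set_conv_nth intro!: exI[of _ "2 * k"])
  qed
  have Bcard: "card (B a) \<le> k" "finite (B a)" if a: "a \<in> A" for a
  proof -
    obtain D' where r: "(rep a, D') \<in> Q" using rep a by blast
    then obtain \<psi> where u: "unfolds k (rep a) D' \<psi> D" using Q by blast
    note q = Q[OF r] len[OF r]
    have sub: "insert 0 (T a) \<subseteq> insert 0 (set (rep a))" by (auto simp: T_def dest: in_set_takeD)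
    have g: "generic (2 * k + 1) \<psi> (insert 0 (T a))" and nb: "all_faces (2 * k + 1) \<psi> (insert 0 (T a)) k"
      using generic_subset[OF unfoldsD(2)[OF u] sub] all_faces_restrict[OF unfoldsD(3)[OF u] sub] by auto
    have c: "faces_avoiding (2 * k + 1) \<psi> (insert 0 (T a)) 0 = {R \<in> D. R \<subseteq> T a}"
      using unfoldsD(5)[OF u, of "Suc (2 * k)"] q E(4) unfolding T_def by simp
    have i: "inseparable (2 * k + 1) \<psi> (insert 0 (T a)) (s a) 0" using unfoldsD(7)[OF u] by (simp add: T_def s_def)
    have E0: "insert 0 (T a) - {0} = T a" using Tcard[OF a] by auto
    have cc: "card (insert 0 (T a)) = 2 * k + 2" using Tcard[OF a] by simp
    show "card (B a) \<le> k"
      using apex_partner_candidates[OF g _ cc nb _ _ i] Tcard[OF a] unfolding c E0 B_def by simp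
    show "finite (B a)" using Tcard(2)[OF a] by (rule rev_finite_subset) (auto simp: B_def apex_pair_def)
  qed
  define S where "S = (SIGMA a:A. SIGMA b:B a. permutations_of_set (T a - {s a, b}))"
  have inner: "card (SIGMA b:B a. permutations_of_set (T a - {s a, b})) \<le> k * fact (2 * k - 1)" if a: "a \<in> A" for a
  proof -
    have "card (permutations_of_set (T a - {s a, b})) = fact (2 * k - 1)" if b: "b \<in> B a" for b
    proof -
      have "b \<in> T a" "b \<noteq> s a" using b by (auto simp: B_def apex_pair_def)
      then have "card (T a - {s a, b}) = 2 * k - 1" using Tcard[OF a] by (simp add: card_Diff_subset)
      then show ?thesis using Tcard(2)[OF a] by simp
    qed
    then have "card (SIGMA b:B a. permutations_of_set (T a - {s a, b})) = card (B a) * fact (2 * k - 1)"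
      using Bcard(2)[OF a] by (subst card_SigmaI) auto
    then show ?thesis using Bcard(1)[OF a] by simp
  qed
  have fS: "finite S" unfolding S_def using A2(2) Bcard(2) by (intro finite_SigmaI) auto
  have "card S = (\<Sum>a\<in>A. card (SIGMA b:B a. permutations_of_set (T a - {s a, b})))"
    unfolding S_def using A2(2) Bcard(2) by (intro card_SigmaI) (auto intro!: finite_SigmaI)
  also have "\<dots> \<le> (\<Sum>a\<in>A. k * fact (2 * k - 1))" using inner by (intro sum_mono) auto
  also have "\<dots> \<le> 2 * (k * fact (2 * k - 1))" using A2(1) by simp
  also have "\<dots> = fact (2 * k)" using k by (cases k) (simp_all add: fact_reduce[of "2 * k"])
  finally have cS: "card S \<le> fact (2 * k)" .
  \<comment> \<open>These data determine an input.\<close>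
  define f where "f = (\<lambda>(xs :: nat list, D' :: nat set set). (xs ! (N - 1), xs ! (2 * k - 1), take (2 * k - 1) xs))"
  have "inj_on f Q"
  proof (rule inj_onI)
    fix x y assume xy: "x \<in> Q" "y \<in> Q" "f x = f y"
    obtain xs D1 ys D2 where eq: "x = (xs, D1)" "y = (ys, D2)" by fastforce
    note x = Q[OF xy(1)[unfolded eq]] len[OF xy(1)[unfolded eq]] and y = Q[OF xy(2)[unfolded eq]] len[OF xy(2)[unfolded eq]]
    obtain \<psi>1 \<psi>2 where u: "unfolds k xs D1 \<psi>1 D" "unfolds k ys D2 \<psi>2 D" using x y by blast
    have fe: "xs ! (N - 1) = ys ! (N - 1)" "xs ! (2 * k - 1) = ys ! (2 * k - 1)" "take (2 * k - 1) xs = take (2 * k - 1) ys"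
      using xy(3) by (auto simp: f_def eq)
    have "xs = ys"
    proof (rule nth_equalityI)
      show "length xs = length ys" using x y by simp
      fix i assume i: "i < length xs"
      consider "i < 2 * k - 1" | "i = 2 * k - 1" | "2 * k \<le> i" by linarith
      then show "xs ! i = ys ! i"
      proof cases
        case 1
        then show ?thesis using fe(3) by (metis nth_take)
      next
        case 3
        show ?thesis
          by (rule unfolds_agree[OF k u(1) _ u(2) _ _ _ _ E(4) fe(1) 3]) (use x y i E(2) in auto)
      qed (use fe in simp)
    qed
    then have "D1 = D2"
      using unfolds_lower_unique[OF k u(1), of D2 \<psi>2] u(2) x y E(4) by auto
    with \<open>xs = ys\<close> show "x = y" by (simp add: eq)
  qed
  moreover have "f ` Q \<subseteq> S"
  proof
    fix z assume "z \<in> f ` Q"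
    then obtain xs D' where x: "(xs, D') \<in> Q" "z = f (xs, D')" by auto
    note q = Q[OF x(1)] len[OF x(1)]
    obtain \<psi> where u: "unfolds k xs D' \<psi> D" using q by blast
    define a where "a = xs ! (N - 1)"
    have a: "a \<in> A" using x by (auto simp: A_def a_def)
    obtain D'' where r: "(rep a, D'') \<in> Q" "rep a ! (N - 1) = a" using rep a by blast
    obtain \<psi>' where u': "unfolds k (rep a) D'' \<psi>' D" using Q[OF r(1)] by blast
    note q' = Q[OF r(1)] len[OF r(1)]
    have agree: "xs ! i = rep a ! i" if "2 * k \<le> i" "i < N" for i
      by (rule unfolds_agree[OF k u _ u' _ _ _ _ E(4) _ that]) (use q q' r(2) E(2) in \<open>auto simp: a_def\<close>)
    have T: "set (take (Suc (2 * k)) xs) = T a"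
      unfolding T_def using q q' agree by (intro set_take_eq) auto
    have s: "xs ! (2 * k) = s a" using agree[of "2 * k"] E(4) by (simp add: s_def)
    define b where "b = xs ! (2 * k - 1)"
    have k2: "Suc (2 * k - 1) = 2 * k" using k by simp
    have "apex_pair {R \<in> D. R \<subseteq> set (take (Suc (Suc (2 * k - 1))) xs)} (set (take (Suc (Suc (2 * k - 1))) xs)) k
        (xs ! Suc (2 * k - 1)) (xs ! (2 * k - 1))"
      using unfoldsD(6)[OF u, of "2 * k - 1"] q E(4) k by simp
    then have b: "b \<in> B a" unfolding k2 T s by (simp add: B_def b_def)
    have "take (Suc (2 * k)) xs = take (2 * k - 1) xs @ [b, s a]"
    proof -
      have "take (Suc (2 * k)) xs = take (2 * k) xs @ [s a]"
        using q E(4) s by (simp add: take_Suc_conv_app_nth)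
      moreover have "take (Suc (2 * k - 1)) xs = take (2 * k - 1) xs @ [b]"
        using q E(4) by (subst take_Suc_conv_app_nth) (auto simp: b_def)
      ultimately show ?thesis by (simp only: k2 append_assoc append_Cons append_Nil)
    qed
    moreover have "distinct (take (Suc (2 * k)) xs)" using q by simp
    ultimately have "distinct (take (2 * k - 1) xs)" "set (take (2 * k - 1) xs) = T a - {s a, b}"
      using T by auto
    then have "take (2 * k - 1) xs \<in> permutations_of_set (T a - {s a, b})" by (simp add: permutations_of_set_def)
    then show "z \<in> S" using a b x(2) by (simp add: S_def f_def a_def b_def)
  qed
  ultimately have "card Q \<le> card S" using fS by (metis card_inj_on_le)
  with cS show ?thesis by simp
qed simp

lemma finite_types: "finite V \<Longrightarrow> finite (polytope_types k V p)" "finite E \<Longrightarrow> finite (delaunay_types k E)"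
proof -
  show "finite (polytope_types k V p)" if "finite V"
    by (rule finite_subset[of _ "Pow (Pow V)"]) (use that in \<open>auto simp: polytope_types_def faces_avoiding_def\<close>)
  show "finite (delaunay_types k E)" if "finite E"
    by (rule finite_subset[of _ "Pow (Pow E)"]) (use that in \<open>auto simp: delaunay_types_def faces_avoiding_def\<close>)
qed

lemma delaunay_types_step:
  assumes k: "1 \<le> k" and E: "finite E" "0 \<notin> E" "card E = N" "2 * k + 2 \<le> N"
    and M: "\<And>V p. finite V \<Longrightarrow> 0 \<notin> V \<Longrightarrow> p \<in> V \<Longrightarrow> card V = N - 1 \<Longrightarrow> M \<le> card (polytope_types (k - 1) V p)"
  shows "fact N * M \<le> card (delaunay_types k E) * fact (2 * k)"
proof -
  define X where "X = permutations_of_set E"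
  define Y where "Y = (\<lambda>xs. polytope_types (k - 1) (set (butlast xs)) (xs ! (N - 2)))"
  define I where "I = Sigma X Y"
  have X: "distinct xs" "set xs = E" "length xs = N" if "xs \<in> X" for xs
    using that E(3) by (auto simp: X_def permutations_of_set_def distinct_card)
  have fX: "finite X" "card X = fact N" using E by (auto simp: X_def)
  have fY: "finite (Y xs)" for xs by (simp add: Y_def finite_types)
  have "M \<le> card (Y xs)" if "xs \<in> X" for xs
    unfolding Y_def
  proof (rule M)
    note x = X[OF that]
    show "0 \<notin> set (butlast xs)" using x E(2) by (auto dest: in_set_butlastD)
    show "card (set (butlast xs)) = N - 1" using x by (simp add: distinct_card distinct_butlast)
    have "xs ! (N - 2) = butlast xs ! (N - 2)" using x E(4) by (simp add: nth_butlast)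
    then show "xs ! (N - 2) \<in> set (butlast xs)" using x E(4) by simp
  qed simp
  then have "(\<Sum>xs\<in>X. M) \<le> (\<Sum>xs\<in>X. card (Y xs))" by (rule sum_mono)
  then have "fact N * M \<le> card I" unfolding I_def using fX fY by (simp add: card_SigmaI)
  have "\<forall>x\<in>I. \<exists>D. \<exists>\<psi>. unfolds k (fst x) (snd x) \<psi> D"
  proof
    fix x assume "x \<in> I"
    then have x: "fst x \<in> X" "snd x \<in> Y (fst x)" by (auto simp: I_def)
    then show "\<exists>D. \<exists>\<psi>. unfolds k (fst x) (snd x) \<psi> D"
      using unfolds_exists[OF k, of "fst x" "snd x"] X[OF x(1)] E by (auto simp: Y_def)
  qed
  from bchoice[OF this] obtain \<Phi> where \<Phi>: "\<forall>x\<in>I. \<exists>\<psi>. unfolds k (fst x) (snd x) \<psi> (\<Phi> x)" by blast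
  have mem: "\<Phi> x \<in> delaunay_types k E" if x: "x \<in> I" for x
  proof -
    obtain \<psi> where "unfolds k (fst x) (snd x) \<psi> (\<Phi> x)" using \<Phi> x by blast
    moreover have "set (fst x) = E" using x X by (auto simp: I_def)
    ultimately show ?thesis using unfoldsD(2-4)[of k "fst x" "snd x"] unfoldsD(1)[of k "fst x" "snd x"]
      unfolding delaunay_types_def by blast
  qed
  have "I \<subseteq> (\<Union>D\<in>delaunay_types k E. {x \<in> I. \<Phi> x = D})" using mem by blast
  moreover have "finite I" unfolding I_def using fX fY by auto
  moreover have fD: "finite (delaunay_types k E)" using finite_types(2)[OF E(1)] .
  ultimately have "card I \<le> card (\<Union>D\<in>delaunay_types k E. {x \<in> I. \<Phi> x = D})"
    by (intro card_mono) auto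
  also have "\<dots> \<le> (\<Sum>D\<in>delaunay_types k E. card {x \<in> I. \<Phi> x = D})"
    using fD by (rule card_UN_le)
  also have "\<dots> \<le> (\<Sum>D\<in>delaunay_types k E. fact (2 * k))"
  proof (rule sum_mono)
    fix D assume "D \<in> delaunay_types k E"
    show "card {x \<in> I. \<Phi> x = D} \<le> fact (2 * k)"
    proof (rule unfolds_fibre[OF k E])
      fix xs D' assume "(xs, D') \<in> {x \<in> I. \<Phi> x = D}"
      then have x: "xs \<in> X" "D' \<in> Y xs" "(xs, D') \<in> I" "\<Phi> (xs, D') = D" by (auto simp: I_def)
      with \<Phi> X[OF x(1)] show "distinct xs \<and> set xs = E \<and>
        D' \<in> polytope_types (k - 1) (set (butlast xs)) (xs ! (N - 2)) \<and> (\<exists>\<psi>. unfolds k xs D' \<psi> D)"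
        by (force simp: Y_def)
    qed
  qed
  finally show ?thesis using \<open>fact N * M \<le> card I\<close> by simp
qed

definition type_bound :: "nat \<Rightarrow> nat \<Rightarrow> real" where
  "type_bound k q = (\<Prod>i = 1..k. fact (q + 2 * i) / fact (2 * i))"

text \<open>
  The two bounds depend on each other: a lifting starts from a polytope type in lower rank, and
  polytope types are obtained from Delaunay types by stereographic projection.
\<close>

lemma type_counts:
  assumes q: "2 \<le> q"
  shows "finite V \<Longrightarrow> 0 \<notin> V \<Longrightarrow> p \<in> V \<Longrightarrow> card V = q + 2 * k + 1 \<Longrightarrow>
      type_bound k q \<le> real (card (polytope_types k V p))"
    and "1 \<le> k \<Longrightarrow> finite E \<Longrightarrow> 0 \<notin> E \<Longrightarrow> card E = q + 2 * k \<Longrightarrow>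
      type_bound k q \<le> real (card (delaunay_types k E))"
proof (induction k arbitrary: V p E)
  case 0
  {
    case 1
    define \<psi> where "\<psi> = (\<lambda>(i::nat) (e::nat). 1 :: real)"
    have lin: "lin 1 \<psi> c e = c 0" for c e by (simp add: lin_def \<psi>_def)
    have "generic 1 \<psi> V"
      unfolding generic_def
    proof (intro allI impI, elim conjE)
      fix W :: "nat set" and t :: "nat \<Rightarrow> real" assume W: "finite W" "card W \<le> 1"
      have "\<exists>x. W \<subseteq> {x}"
      proof (cases "W = {}")
        case False
        then have "card W = 1" using W by (simp add: le_antisym Suc_leI card_gt_0_iff)
        then show ?thesis using card_1_singletonE by blast
      qed simp
      then obtain x where "W \<subseteq> {x}" by blast
      then show "\<exists>c. \<forall>e\<in>W. lin 1 \<psi> c e = t e" unfolding lin by (intro exI[of _ "\<lambda>i. t x"]) auto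
    qed
    moreover have "all_faces 1 \<psi> V 0"
      unfolding all_faces_def face_def lin
    proof (intro allI impI conjI exI[of _ "\<lambda>i. 1"] ballI)
      fix S e assume "S \<subseteq> V" "card S = 0" "e \<in> S"
      then show "(1::real) = 0" using 1(1) finite_subset by fastforce
    qed auto
    ultimately have "faces_avoiding (2 * 0 + 1) \<psi> V p \<in> polytope_types 0 V p"
      unfolding polytope_types_def by (auto simp: \<psi>_def)
    then have "card (polytope_types 0 V p) \<noteq> 0" using finite_types(1)[OF 1(1)] by auto
    then show ?case by (simp add: type_bound_def)
  next
    case 2
    then show ?case by simp
  }
next
  case (Suc k)
  have delaunay: "type_bound (Suc k) q \<le> real (card (delaunay_types (Suc k) E))"
    if E: "finite E" "0 \<notin> E" "card E = q + 2 * Suc k" for E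
  proof -
    \<comment> \<open>Rounding up makes the real bound usable in the integer count.\<close>
    define M where "M = nat \<lceil>type_bound k q\<rceil>"
    have M: "M \<le> card (polytope_types k V p)" if "finite V" "0 \<notin> V" "p \<in> V" "card V = q + 2 * Suc k - 1" for V p
    proof -
      have "type_bound k q \<le> real (card (polytope_types k V p))" using Suc.IH(1)[OF that(1-3)] that(4) by simp
      then have "\<lceil>type_bound k q\<rceil> \<le> int (card (polytope_types k V p))" by (simp add: ceiling_le_iff)
      then show ?thesis unfolding M_def by (simp add: nat_le_iff)
    qed
    have "fact (q + 2 * Suc k) * M \<le> card (delaunay_types (Suc k) E) * fact (2 * Suc k)"
      by (rule delaunay_types_step[OF _ E]) (use q M in auto)
    then have "real (fact (q + 2 * Suc k) * M) \<le> real (card (delaunay_types (Suc k) E) * fact (2 * Suc k))"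
      by (simp only: of_nat_le_iff)
    moreover have "type_bound k q \<le> real M" unfolding M_def by (simp add: real_nat_ceiling_ge)
    then have "fact (q + 2 * Suc k) * type_bound k q \<le> fact (q + 2 * Suc k) * real M" by (intro mult_left_mono) auto
    ultimately have le: "fact (q + 2 * Suc k) * type_bound k q \<le> real (card (delaunay_types (Suc k) E)) * fact (2 * Suc k)"
      by (simp only: of_nat_mult of_nat_fact)
    have "type_bound (Suc k) q = fact (q + 2 * Suc k) * type_bound k q / fact (2 * Suc k)"
      unfolding type_bound_def by (simp add: atLeastAtMostSuc_conv)
    also have "\<dots> \<le> real (card (delaunay_types (Suc k) E))" using le by (simp only: pos_divide_le_eq fact_gt_zero)
    finally show ?thesis .
  qed
  {
    case 1
    have "card (V - {p}) = q + 2 * Suc k" using 1 by simp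
    then have "type_bound (Suc k) q \<le> real (card (delaunay_types (Suc k) (V - {p})))"
      using 1 by (intro delaunay) auto
    also have "delaunay_types (Suc k) (V - {p}) \<subseteq> polytope_types (Suc k) V p"
      using delaunay_types_subset_polytope_types[of "Suc k" "V - {p}" p] 1 by (simp add: insert_absorb)
    then have "real (card (delaunay_types (Suc k) (V - {p}))) \<le> real (card (polytope_types (Suc k) V p))"
      using card_mono[OF finite_types(1)[OF 1(1)]] by simp
    finally show ?case .
  next
    case 2
    then show ?case using delaunay by blast
  }
qed

section \<open>Delaunay triangulations of generic point sets\<close>

text \<open>
  A convex combination on which a nonnegative affine function vanishes only uses points where it
  vanishes.
\<close>

lemma hull_on_hyperplane:
  fixes S :: "'a::euclidean_space set"
  assumes S: "finite S" and x: "x \<in> convex hull S"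
    and nonneg: "\<And>y. y \<in> S \<Longrightarrow> 0 \<le> a + v \<bullet> y"
  shows "0 \<le> a + v \<bullet> x" "a + v \<bullet> x = 0 \<Longrightarrow> x \<in> convex hull {y \<in> S. a + v \<bullet> y = 0}"
proof -
  obtain u where u: "\<forall>y\<in>S. 0 \<le> u y" "sum u S = 1" "(\<Sum>y\<in>S. u y *\<^sub>R y) = x"
    using x unfolding convex_hull_finite[OF S] by blast
  have eq: "(\<Sum>y\<in>S. u y * (a + v \<bullet> y)) = a + v \<bullet> x"
  proof -
    have "(\<Sum>y\<in>S. u y * (a + v \<bullet> y)) = (\<Sum>y\<in>S. u y) * a + v \<bullet> (\<Sum>y\<in>S. u y *\<^sub>R y)"
      unfolding inner_sum_right sum_distrib_right sum.distrib[symmetric]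
      by (rule sum.cong) (auto simp: algebra_simps)
    then show ?thesis using u by simp
  qed
  have nn: "0 \<le> u y * (a + v \<bullet> y)" if "y \<in> S" for y using u nonneg that by simp
  show "0 \<le> a + v \<bullet> x" using sum_nonneg[of S "\<lambda>y. u y * (a + v \<bullet> y)"] nn eq by simp
  assume "a + v \<bullet> x = 0"
  then have "\<forall>y\<in>S. u y * (a + v \<bullet> y) = 0"
    using eq sum_nonneg_eq_0_iff[OF S, of "\<lambda>y. u y * (a + v \<bullet> y)"] nn by simp
  then have z: "u y = 0" if "y \<in> S - {y \<in> S. a + v \<bullet> y = 0}" for y using that by auto
  let ?T = "{y \<in> S. a + v \<bullet> y = 0}"
  have "sum u ?T = 1" using u(2) z S sum.mono_neutral_right[of S ?T u] by auto
  moreover have "(\<Sum>y\<in>?T. u y *\<^sub>R y) = x"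
    using u(3) z S sum.mono_neutral_right[of S ?T "\<lambda>y. u y *\<^sub>R y"] by auto
  ultimately show "x \<in> convex hull ?T"
    using u(1) S by (subst convex_hull_finite) (auto intro!: exI[of _ u])
qed

text \<open>
  Points without affine dependencies among at most \<open>DIM('a) + 1\<close> of them, and the label sets of their
  Delaunay cells. An empty sphere is given by its power function \<open>a + v \<bullet> x + |x|\<^sup>2\<close>.
\<close>

locale generic_sites =
  fixes E :: "nat set" and p :: "nat \<Rightarrow> 'a::euclidean_space" and D :: "nat set set"
  assumes fin: "finite E" and big: "DIM('a) + 1 \<le> card E"
    and interpolate: "\<And>W t. W \<subseteq> E \<Longrightarrow> card W \<le> DIM('a) + 1 \<Longrightarrow> \<exists>a v. \<forall>e\<in>W. a + v \<bullet> p e = (t e :: real)"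
    and D: "\<And>R. R \<in> D \<longleftrightarrow> R \<subseteq> E \<and> (\<exists>a v. (\<forall>e\<in>R. a + v \<bullet> p e + (norm (p e))\<^sup>2 = 0) \<and>
      (\<forall>e\<in>E - R. 0 < a + v \<bullet> p e + (norm (p e))\<^sup>2))"
    and closed_down: "\<And>R S. R \<in> D \<Longrightarrow> S \<subseteq> R \<Longrightarrow> S \<in> D"
    and small: "\<And>R. R \<in> D \<Longrightarrow> card R \<le> DIM('a) + 1"
begin

lemma D_subset: "R \<in> D \<Longrightarrow> R \<subseteq> E" "R \<in> D \<Longrightarrow> finite R"
  using D[of R] finite_subset[OF _ fin, of R] by simp_all

lemma inj: "inj_on p E"
proof (rule inj_onI, rule ccontr)
  fix e f assume ef: "e \<in> E" "f \<in> E" "p e = p f" "e \<noteq> f"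
  have "1 \<le> DIM('a)" by (simp add: Suc_leI)
  then have "card {e, f} \<le> DIM('a) + 1" using ef by simp
  then obtain a v where "\<forall>x\<in>{e, f}. a + v \<bullet> p x = (if x = e then 0 else 1 :: real)"
    using interpolate[of "{e, f}" "\<lambda>x. if x = e then 0 else 1"] ef by auto
  with ef show False by auto
qed

lemma independent:
  assumes R: "R \<subseteq> E" "card R \<le> DIM('a) + 1"
  shows "\<not> affine_dependent (p ` R)"
proof
  assume dep: "affine_dependent (p ` R)"
  have fR: "finite R" using R fin finite_subset by blast
  have injR: "inj_on p R" using inj R(1) by (rule inj_on_subset)
  obtain u where u: "sum u (p ` R) = 0" "\<exists>v\<in>p ` R. u v \<noteq> 0" "(\<Sum>v\<in>p ` R. u v *\<^sub>R v) = 0"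
    using dep affine_dependent_explicit_finite[of "p ` R"] fR by blast
  obtain a v where av: "\<forall>e\<in>R. a + v \<bullet> p e = u (p e)"
    using interpolate[OF R, of "\<lambda>e. u (p e)"] by blast
  have "(\<Sum>x\<in>p ` R. u x * u x) = (\<Sum>x\<in>p ` R. u x * (a + v \<bullet> x))"
    using av by (intro sum.cong) auto
  also have "\<dots> = sum u (p ` R) * a + v \<bullet> (\<Sum>x\<in>p ` R. u x *\<^sub>R x)"
    unfolding inner_sum_right sum_distrib_right sum.distrib[symmetric]
    by (rule sum.cong) (auto simp: algebra_simps)
  also have "\<dots> = 0" using u by simp
  finally have "\<forall>x\<in>p ` R. u x * u x = 0" using fR by (subst (asm) sum_nonneg_eq_0_iff) auto
  with u(2) show False by auto
qed

lemma D_independent: "R \<in> D \<Longrightarrow> \<not> affine_dependent (p ` R)"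
  using independent D_subset(1) small by blast

text \<open>
  The power function is \<open>|c - x|\<^sup>2 - \<rho>\<close>. If \<open>\<rho>\<close> is positive it is the squared radius. Otherwise the cell
  has at most one vertex, and a sphere is found far away from all points or close to that vertex.
\<close>

lemma sphere_of_cell:
  assumes R: "R \<in> D"
  shows "\<exists>c r. 0 < r \<and> p ` R \<subseteq> sphere c r \<and> (\<forall>x\<in>p ` E - p ` R. x \<notin> cball c r)"
proof -
  obtain b :: 'a where b: "norm b = 1" using vector_choose_size[of 1] by auto
  obtain a v where av: "\<forall>e\<in>R. a + v \<bullet> p e + (norm (p e))\<^sup>2 = 0"
      "\<forall>e\<in>E - R. 0 < a + v \<bullet> p e + (norm (p e))\<^sup>2" and RE: "R \<subseteq> E" using R D[of R] by blast
  define c where "c = (- 1 / 2) *\<^sub>R v"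
  define \<rho> where "\<rho> = (norm c)\<^sup>2 - a"
  have sq: "a + v \<bullet> x + (norm x)\<^sup>2 = (dist c x)\<^sup>2 - \<rho>" for x
    unfolding dist_norm power2_norm_eq_inner \<rho>_def c_def
    by (simp add: inner_diff_left inner_diff_right inner_commute algebra_simps)
  consider "R = {}" | "R \<noteq> {}" "\<rho> \<le> 0" | "0 < \<rho>" by fastforce
  then show ?thesis
  proof cases
    case 1
    have "bounded (p ` E)" using fin finite_imp_bounded by blast
    then obtain B where B: "0 < B" "\<forall>x\<in>p ` E. norm x \<le> B" using bounded_pos by blast
    have "x \<notin> cball ((B + 2) *\<^sub>R b) 1" if "x \<in> p ` E" for x
    proof -
      have "B + 2 = norm ((B + 2) *\<^sub>R b)" using b B by simp
      also have "\<dots> \<le> norm ((B + 2) *\<^sub>R b - x) + norm x"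
        using norm_triangle_sub[of "(B + 2) *\<^sub>R b" x] by (simp add: add.commute)
      finally have "2 \<le> dist ((B + 2) *\<^sub>R b) x" using B(2) that by (simp add: dist_norm) fastforce
      then show ?thesis by simp
    qed
    then show ?thesis using 1 by (intro exI[of _ "(B + 2) *\<^sub>R b"] exI[of _ 1]) auto
  next
    case 2
    have pc: "p e = c" if "e \<in> R" for e
    proof -
      have "(dist c (p e))\<^sup>2 = \<rho>" using av(1) that sq[of "p e"] by simp
      then have "(dist c (p e))\<^sup>2 \<le> 0" using 2 by simp
      then show ?thesis by simp
    qed
    with 2 have pR: "p ` R = {c}" by auto
    obtain \<delta> where \<delta>: "0 < \<delta>" "\<forall>x\<in>p ` E. x \<noteq> c \<longrightarrow> \<delta> \<le> dist c x"
      using finite_set_avoid[of "p ` E" c] fin by blast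
    let ?c = "c + (\<delta> / 3) *\<^sub>R b"
    have dc: "dist ?c c = \<delta> / 3" using b \<delta> by (simp add: dist_norm)
    have "x \<notin> cball ?c (\<delta> / 3)" if "x \<in> p ` E - p ` R" for x
    proof -
      have "\<delta> \<le> dist c x" using \<delta> that pR by auto
      also have "\<dots> \<le> dist c ?c + dist ?c x" by (rule dist_triangle)
      finally show ?thesis using dc \<delta> by (simp add: dist_commute)
    qed
    then show ?thesis using pR dc \<delta> by (intro exI[of _ ?c] exI[of _ "\<delta> / 3"]) auto
  next
    case 3
    have "dist c (p e) = sqrt \<rho>" if "e \<in> R" for e
      using av(1) that sq[of "p e"] by (simp add: real_sqrt_unique)
    moreover have "sqrt \<rho> < dist c (p e)" if "e \<in> E - R" for e
    proof -
      have "0 < a + v \<bullet> p e + (norm (p e))\<^sup>2" using av(2) that by blast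
      then have "\<rho> < (dist c (p e))\<^sup>2" unfolding sq by simp
      then have "sqrt \<rho> < sqrt ((dist c (p e))\<^sup>2)" by (rule real_sqrt_less_mono)
      then show ?thesis by simp
    qed
    ultimately show ?thesis using 3 by (intro exI[of _ c] exI[of _ "sqrt \<rho>"]) (auto simp: not_le)
  qed
qed

lemma cell_of_sphere:
  assumes S: "S \<subseteq> p ` E" and r: "0 < r" "S \<subseteq> sphere c r" "\<forall>x\<in>p ` E - S. x \<notin> cball c r"
  shows "\<exists>R\<in>D. S = p ` R"
proof -
  define R where "R = {e \<in> E. p e \<in> S}"
  have SR: "S = p ` R" using S by (auto simp: R_def)
  have sq: "((norm c)\<^sup>2 - r\<^sup>2) + ((-2) *\<^sub>R c) \<bullet> x + (norm x)\<^sup>2 = (dist c x)\<^sup>2 - r\<^sup>2" for x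
    unfolding dist_norm power2_norm_eq_inner
    by (simp add: inner_diff_left inner_diff_right inner_commute algebra_simps)
  have "(dist c (p e))\<^sup>2 - r\<^sup>2 = 0" if "e \<in> R" for e
    using that r(2) by (auto simp: R_def)
  moreover have "0 < (dist c (p e))\<^sup>2 - r\<^sup>2" if "e \<in> E - R" for e
  proof -
    have "r < dist c (p e)" using that r(3) by (auto simp: R_def not_le)
    then show ?thesis using r(1) by (simp add: power_strict_mono)
  qed
  ultimately have "R \<in> D" unfolding D sq[symmetric]
    by (intro conjI exI[of _ "(norm c)\<^sup>2 - r\<^sup>2"] exI[of _ "(-2) *\<^sub>R c"]) (auto simp: R_def)
  with SR show ?thesis by blast
qed

lemma subdivision: "delaunay_subdivision (p ` E) = (\<lambda>R. convex hull (p ` R)) ` D"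
proof (intro subset_antisym subsetI)
  fix C assume "C \<in> delaunay_subdivision (p ` E)"
  then obtain S c r where "C = convex hull S" "S \<subseteq> p ` E" "0 < r" "S \<subseteq> sphere c r"
    "\<forall>x\<in>p ` E - S. x \<notin> cball c r"
    by (auto simp: delaunay_subdivision_def)
  then show "C \<in> (\<lambda>R. convex hull (p ` R)) ` D" using cell_of_sphere[of S r c] by blast
next
  fix C assume "C \<in> (\<lambda>R. convex hull (p ` R)) ` D"
  then obtain R where R: "R \<in> D" "C = convex hull (p ` R)" by blast
  then show "C \<in> delaunay_subdivision (p ` E)"
    using sphere_of_cell[OF R(1)] D_subset(1)[OF R(1)] unfolding delaunay_subdivision_def by blast
qed

text \<open>
  The difference of the power functions of the two cells is affine, nonnegative on one cell and
  nonpositive on the other. So a common point lies on its zero set, which meets the vertices of each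
  cell only in common vertices.
\<close>

lemma cell_Int:
  assumes "R1 \<in> D" "R2 \<in> D"
  shows "convex hull (p ` R1) \<inter> convex hull (p ` R2) = convex hull (p ` (R1 \<inter> R2))"
proof
  show "convex hull (p ` (R1 \<inter> R2)) \<subseteq> convex hull (p ` R1) \<inter> convex hull (p ` R2)"
    by (simp add: hull_mono image_mono)
  obtain a1 v1 where 1: "R1 \<subseteq> E" "\<forall>e\<in>R1. a1 + v1 \<bullet> p e + (norm (p e))\<^sup>2 = 0"
    "\<forall>e\<in>E - R1. 0 < a1 + v1 \<bullet> p e + (norm (p e))\<^sup>2" using assms(1) D[of R1] by blast
  obtain a2 v2 where 2: "R2 \<subseteq> E" "\<forall>e\<in>R2. a2 + v2 \<bullet> p e + (norm (p e))\<^sup>2 = 0"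
    "\<forall>e\<in>E - R2. 0 < a2 + v2 \<bullet> p e + (norm (p e))\<^sup>2" using assms(2) D[of R2] by blast
  define a v where "a = a2 - a1" and "v = v2 - v1"
  have l: "a + v \<bullet> x = (a2 + v2 \<bullet> x + (norm x)\<^sup>2) - (a1 + v1 \<bullet> x + (norm x)\<^sup>2)" for x
    by (simp add: a_def v_def inner_diff_left)
  have l': "- a + (- v) \<bullet> x = - (a + v \<bullet> x)" for x by simp
  have p1: "0 \<le> a + v \<bullet> p e" if "e \<in> R1" for e
  proof (cases "e \<in> R2")
    case True
    then show ?thesis using that 1(2) 2(2) unfolding l by simp
  next
    case False
    then have "0 < a2 + v2 \<bullet> p e + (norm (p e))\<^sup>2" using 1(1) 2(3) that by blast
    then show ?thesis using that 1(2) unfolding l by simp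
  qed
  have p1': "e \<in> R2" if "e \<in> R1" "a + v \<bullet> p e = 0" for e
  proof (rule ccontr)
    assume "e \<notin> R2"
    then have "0 < a2 + v2 \<bullet> p e + (norm (p e))\<^sup>2" using 1(1) 2(3) that(1) by blast
    then show False using that 1(2) unfolding l by simp
  qed
  have p2: "0 \<le> - a + (- v) \<bullet> p e" if "e \<in> R2" for e
  proof (cases "e \<in> R1")
    case True
    then show ?thesis using that 1(2) 2(2) unfolding l' l by simp
  next
    case False
    then have "0 < a1 + v1 \<bullet> p e + (norm (p e))\<^sup>2" using 1(3) 2(1) that by blast
    then show ?thesis using that 2(2) unfolding l' l by simp
  qed
  show "convex hull (p ` R1) \<inter> convex hull (p ` R2) \<subseteq> convex hull (p ` (R1 \<inter> R2))"
  proof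
    fix x assume x: "x \<in> convex hull (p ` R1) \<inter> convex hull (p ` R2)"
    have f: "finite (p ` R1)" "finite (p ` R2)" using D_subset(2) assms by auto
    have "0 \<le> - a + (- v) \<bullet> x"
      by (rule hull_on_hyperplane(1)[OF f(2)]) (use x p2 in auto)
    moreover have "0 \<le> a + v \<bullet> x"
      by (rule hull_on_hyperplane(1)[OF f(1)]) (use x p1 in auto)
    ultimately have "a + v \<bullet> x = 0" by simp
    then have "x \<in> convex hull {y \<in> p ` R1. a + v \<bullet> y = 0}"
      by (intro hull_on_hyperplane(2)[OF f(1)]) (use x p1 in auto)
    moreover have "{y \<in> p ` R1. a + v \<bullet> y = 0} \<subseteq> p ` (R1 \<inter> R2)" using p1' by auto
    ultimately show "x \<in> convex hull (p ` (R1 \<inter> R2))" using hull_mono by blast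
  qed
qed

lemma simplicial: "simplicial_complex ((\<lambda>R. convex hull (p ` R)) ` D)"
  unfolding simplicial_complex_def
proof (intro conjI ballI allI impI)
  have "D \<subseteq> Pow E" using D_subset(1) by blast
  then show "finite ((\<lambda>R. convex hull (p ` R)) ` D)" using fin by (meson finite_Pow_iff finite_imageI finite_subset)
next
  fix C assume "C \<in> (\<lambda>R. convex hull (p ` R)) ` D"
  then obtain R where "R \<in> D" "C = convex hull (p ` R)" by blast
  then show "\<exists>n. n simplex C"
    using D_independent[of R] unfolding simplex_def by (intro exI[of _ "int (card (p ` R)) - 1"] exI[of _ "p ` R"]) auto
next
  fix F C assume "C \<in> (\<lambda>R. convex hull (p ` R)) ` D \<and> F face_of C"
  then obtain R where R: "R \<in> D" "F face_of convex hull (p ` R)" by blast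
  then obtain c where c: "c \<subseteq> p ` R" "F = convex hull c"
    using face_of_convex_hull_affine_independent[OF D_independent[OF R(1)]] by blast
  then obtain S where "S \<subseteq> R" "c = p ` S" by (auto simp: subset_image_iff)
  then show "F \<in> (\<lambda>R. convex hull (p ` R)) ` D" using c closed_down[OF R(1)] by blast
next
  fix C C' assume "C \<in> (\<lambda>R. convex hull (p ` R)) ` D \<and> C' \<in> (\<lambda>R. convex hull (p ` R)) ` D"
  then obtain R R' where R: "R \<in> D" "R' \<in> D" "C = convex hull (p ` R)" "C' = convex hull (p ` R')" by blast
  have "convex hull (p ` (R \<inter> R')) face_of convex hull (p ` R)"
    using face_of_convex_hull_affine_independent[OF D_independent[OF R(1)]] by (metis image_mono inf_le1)
  then show "C \<inter> C' face_of C" using cell_Int[OF R(1,2)] R(3,4) by simp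
qed

text \<open>
  Over \<open>x\<close>, the lowest point of the convex hull of the lifted points lies on a supporting hyperplane. It
  is not vertical because \<open>x\<close> is an interior point, and the lifted points on it project to a
  Delaunay cell containing \<open>x\<close>.
\<close>

lemma interior_covered:
  assumes x: "x \<in> interior (convex hull (p ` E))"
  shows "\<exists>R\<in>D. x \<in> convex hull (p ` R)"
proof -
  define q where "q = (\<lambda>e. (p e, (norm (p e))\<^sup>2))"
  define K where "K = convex hull (q ` E)"
  have fq: "finite (q ` E)" using fin by simp
  have K: "convex K" "compact K" using fq by (auto simp: K_def finite_imp_compact_convex_hull)
  have fstK: "fst ` K = convex hull (p ` E)"
  proof -
    have "fst ` K = convex hull (fst ` (q ` E))"
      unfolding K_def by (rule convex_hull_linear_image) (simp add: linear_fst)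
    also have "fst ` (q ` E) = p ` E" by (simp add: q_def image_image)
    finally show ?thesis .
  qed
  have xh: "x \<in> convex hull (p ` E)" using x interior_subset by blast
  have cp: "compact (K \<inter> {y. fst y = x})"
    using K(2) by (intro compact_Int_closed closed_Collect_eq continuous_intros)
  have ne: "K \<inter> {y. fst y = x} \<noteq> {}" using xh fstK by force
  have "continuous_on (K \<inter> {y. fst y = x}) snd" by (intro continuous_intros)
  from continuous_attains_inf[OF cp ne this]
  obtain y where y: "y \<in> K \<inter> {y. fst y = x}" "\<forall>z\<in>K \<inter> {y. fst y = x}. snd y \<le> snd z" by blast
  define \<mu> where "\<mu> = snd y"
  have xK: "(x, \<mu>) \<in> K" using y by (auto simp: \<mu>_def)
  have min: "\<mu> \<le> z" if "(x, z) \<in> K" for z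
    using y(2)[rule_format, of "(x, z)"] that by (simp add: \<mu>_def)
  have "{x} \<times> {..<\<mu>} \<inter> K = {}" using min by force
  moreover have "convex ({x} \<times> {..<\<mu>})" by (intro convex_Times) auto
  moreover have "{x} \<times> {..<\<mu>} \<noteq> {}" by auto
  ultimately obtain w b where w: "w \<noteq> 0" "\<forall>z\<in>{x} \<times> {..<\<mu>}. w \<bullet> z \<le> b" "\<forall>z\<in>K. b \<le> w \<bullet> z"
    using separating_hyperplane_sets[of "{x} \<times> {..<\<mu>}" K] K(1) xK by blast
  obtain v s where vs: "w = (v, s)" by fastforce
  have up: "v \<bullet> x + s * z \<le> b" if "z < \<mu>" for z using w(2) that by (auto simp: vs)
  have lo: "b \<le> v \<bullet> x' + s * z" if "(x', z) \<in> K" for x' z using w(3) that by (auto simp: vs)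
  have "s * (\<mu> - 1) \<le> s * \<mu>" using up[of "\<mu> - 1"] lo[OF xK] by simp
  then have s0: "0 \<le> s" by (simp add: algebra_simps)
  have "s \<noteq> 0"
  proof
    assume s: "s = 0"
    then have v0: "v \<noteq> 0" using w(1) vs by (simp add: zero_prod_def)
    obtain \<epsilon> where e: "0 < \<epsilon>" "ball x \<epsilon> \<subseteq> convex hull (p ` E)" using x by (auto simp: mem_interior)
    define x' where "x' = x - (\<epsilon> / (2 * norm v)) *\<^sub>R v"
    have "dist x x' = \<epsilon> / 2" using v0 e by (simp add: x'_def dist_norm)
    then have "x' \<in> fst ` K" using e fstK by auto
    then obtain z where "(x', z) \<in> K" by auto
    from lo[OF this] s have "b \<le> v \<bullet> x'" by simp
    moreover have "v \<bullet> x' = v \<bullet> x - \<epsilon> / (2 * norm v) * (v \<bullet> v)" by (simp add: x'_def inner_diff_right)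
    moreover have "0 < \<epsilon> / (2 * norm v) * (v \<bullet> v)" using v0 e by simp
    moreover have "v \<bullet> x \<le> b" using up[of "\<mu> - 1"] s by simp
    ultimately show False by linarith
  qed
  with s0 have s: "0 < s" by simp
  have "v \<bullet> x + s * \<mu> \<le> b"
  proof (rule ccontr)
    assume "\<not> ?thesis"
    define h where "h = v \<bullet> x + s * \<mu> - b"
    then have h: "0 < h" using \<open>\<not> v \<bullet> x + s * \<mu> \<le> b\<close> by simp
    have "\<mu> - h / (2 * s) < \<mu>" using h s by simp
    from up[OF this] have "v \<bullet> x + s * (\<mu> - h / (2 * s)) \<le> b" .
    moreover have "s * (\<mu> - h / (2 * s)) = s * \<mu> - h / 2" using s by (simp add: right_diff_distrib)
    ultimately have "h \<le> h / 2" unfolding h_def by linarith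
    with h show False by simp
  qed
  with lo[OF xK] have xb: "v \<bullet> x + s * \<mu> = b" by simp
  define R where "R = {e \<in> E. - b + w \<bullet> q e = 0}"
  have qK: "0 \<le> - b + w \<bullet> z" if "z \<in> q ` E" for z
    using w(3) that hull_subset[of "q ` E" convex] by (auto simp: K_def)
  have wq: "- b + w \<bullet> q e = s * ((- b / s) + (v /\<^sub>R s) \<bullet> p e + (norm (p e))\<^sup>2)" for e
    using s by (simp add: vs q_def field_simps)
  have "R \<in> D"
    unfolding D
  proof (intro conjI exI[of _ "- b / s"] exI[of _ "v /\<^sub>R s"] ballI)
    show "- b / s + (v /\<^sub>R s) \<bullet> p e + (norm (p e))\<^sup>2 = 0" if "e \<in> R" for e
      using that wq[of e] s by (auto simp: R_def)
    show "0 < - b / s + (v /\<^sub>R s) \<bullet> p e + (norm (p e))\<^sup>2" if "e \<in> E - R" for e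
    proof -
      have "0 < - b + w \<bullet> q e" using that qK[of "q e"] by (force simp: R_def)
      then show ?thesis unfolding wq using s by (simp add: zero_less_mult_iff)
    qed
  qed (auto simp: R_def)
  moreover have "(x, \<mu>) \<in> convex hull {z \<in> q ` E. - b + w \<bullet> z = 0}"
    by (rule hull_on_hyperplane(2)[OF fq _ qK]) (use xK xb in \<open>auto simp: K_def vs\<close>)
  then have "(x, \<mu>) \<in> convex hull (q ` R)" by (rule rev_subsetD) (auto simp: R_def intro!: hull_mono)
  then have "x \<in> fst ` (convex hull (q ` R))" by force
  then have "x \<in> convex hull (fst ` (q ` R))"
    using convex_hull_linear_image[of fst "q ` R"] by (simp add: linear_fst)
  then have "x \<in> convex hull (p ` R)" by (simp add: q_def image_image)
  ultimately show ?thesis by blast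
qed

text \<open>
  The union of the cells is closed, so it suffices to cover the interior, which is dense in the
  convex hull.
\<close>

lemma covering: "\<Union> ((\<lambda>R. convex hull (p ` R)) ` D) = convex hull (p ` E)"
proof
  show "\<Union> ((\<lambda>R. convex hull (p ` R)) ` D) \<subseteq> convex hull (p ` E)"
    by (intro UN_least hull_mono image_mono D_subset(1))
  obtain W where W: "W \<subseteq> E" "card W = DIM('a) + 1" "finite W"
    by (rule obtain_subset_with_card_n[OF big])
  have "card (p ` W) = Suc DIM('a)" using W card_image[OF inj_on_subset[OF inj W(1)]] by simp
  from interior_convex_hull_eq_empty[OF this] have "interior (convex hull (p ` W)) \<noteq> {}"
    using independent[OF W(1)] W(2) by simp
  moreover have "interior (convex hull (p ` W)) \<subseteq> interior (convex hull (p ` E))"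
    using W(1) by (intro interior_mono hull_mono image_mono)
  ultimately have ne: "interior (convex hull (p ` E)) \<noteq> {}" by blast
  have fE: "finite (p ` E)" using fin by simp
  have "convex hull (p ` E) = closure (interior (convex hull (p ` E)))"
    using convex_closure_interior[OF convex_convex_hull ne] finite_imp_compact_convex_hull[OF fE]
    by (simp add: compact_imp_closed closure_closed)
  also have "\<dots> \<subseteq> \<Union> ((\<lambda>R. convex hull (p ` R)) ` D)"
  proof (rule closure_minimal)
    show "interior (convex hull (p ` E)) \<subseteq> \<Union> ((\<lambda>R. convex hull (p ` R)) ` D)"
      using interior_covered by blast
    have "D \<subseteq> Pow E" using D_subset(1) by blast
    then have "finite D" using fin by (meson finite_Pow_iff finite_subset)
    then show "closed (\<Union> ((\<lambda>R. convex hull (p ` R)) ` D))"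
      using D_subset(2) by (intro closed_UN ballI compact_imp_closed finite_imp_compact_convex_hull) auto
  qed
  finally show "convex hull (p ` E) \<subseteq> \<Union> ((\<lambda>R. convex hull (p ` R)) ` D)" .
qed

lemma delaunay: "delaunay_triangulation (p ` E) ((\<lambda>R. convex hull (p ` R)) ` D)"
proof -
  have "v \<in> p ` E" if "R \<in> D" "v extreme_point_of (convex hull (p ` R))" for R v
    using extreme_point_of_convex_hull[OF that(2)] D_subset(1)[OF that(1)] by auto
  then show ?thesis
    unfolding delaunay_triangulation_def triangulation_of_def using subdivision simplicial covering by auto
qed

lemma extreme_labels:
  assumes R: "R \<in> D"
  shows "{e \<in> E. p e extreme_point_of (convex hull (p ` R))} = R"
proof -
  have "p e extreme_point_of (convex hull (p ` R)) \<longleftrightarrow> e \<in> R" if "e \<in> E" for e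
    unfolding extreme_point_of_convex_hull_affine_independent[OF D_independent[OF R]]
    by (rule inj_on_image_mem_iff[OF inj that D_subset(1)[OF R]])
  then show ?thesis using D_subset(1)[OF R] by blast
qed

end

section \<open>The numerical estimates\<close>

lemma ln_Suc_bound:
  fixes x :: real
  assumes "0 < x"
  shows "((x + 1) * ln (x + 1) - (x + 1)) - (x * ln x - x) \<le> ln (x + 1)"
proof -
  have "1 + 1 / x = (x + 1) / x" using assms by (simp add: field_simps)
  then have "ln (x + 1) - ln x = ln (1 + 1 / x)" using assms by (simp add: ln_div)
  also have "\<dots> \<le> 1 / x" using assms by (intro ln_add_one_self_le_self) auto
  finally have "x * (ln (x + 1) - ln x) \<le> x * (1 / x)" using assms by (intro mult_left_mono) auto
  then show ?thesis using assms by (simp add: algebra_simps)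
qed

text \<open>
  The left hand side is the integral of \<open>ln\<close> from \<open>m\<close> to \<open>m + q\<close>, and the right hand side is an upper
  Riemann sum of it.
\<close>

lemma ln_fact_bound:
  assumes "1 \<le> m"
  shows "((real m + real q) * ln (real m + real q) - (real m + real q)) - (real m * ln (real m) - real m)
    \<le> ln (fact (m + q)) - ln (fact m)"
proof (induction q)
  case (Suc q)
  have e: "real m + real (Suc q) = (real m + real q) + 1" by simp
  have "fact (m + Suc q) = ((real m + real q) + 1) * fact (m + q)" by (simp add: algebra_simps)
  moreover have "0 < (real m + real q) + 1" by simp
  ultimately have "ln (fact (m + Suc q)) = ln ((real m + real q) + 1) + ln (fact (m + q))"
    by (simp only: ln_mult_pos fact_gt_zero)
  moreover have "0 < real m + real q" using assms by simp
  note ln_Suc_bound[OF this]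
  ultimately show ?case unfolding e using Suc by linarith
qed simp

text \<open>
  A primitive of \<open>(x ln x - x) / 2\<close>; the closed form in the theorem is the exponential of
  \<open>entropy (q + d) - entropy q - entropy d\<close> with \<open>q = n - d - 1\<close>.
\<close>

definition entropy :: "real \<Rightarrow> real" where
  "entropy x = x\<^sup>2 / 4 * ln x - 3 / 8 * x\<^sup>2"

lemma entropy_deriv:
  assumes "0 < x"
  shows "(entropy has_real_derivative (x * ln x - x) / 2) (at x)"
  unfolding entropy_def using assms
  by (auto intro!: derivative_eq_intros simp: field_simps power2_eq_square)

text \<open>
  Continuity at \<open>0\<close> lets the mean value theorem reach the interval that starts at \<open>0\<close>.
\<close>

lemma continuous_entropy: "continuous_on {0..} entropy"
  unfolding continuous_on_eq_continuous_within
proof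
  fix x :: real assume x: "x \<in> {0..}"
  show "continuous (at x within {0..}) entropy"
  proof (cases "x = 0")
    case False
    then have "0 < x" using x by simp
    from DERIV_isCont[OF entropy_deriv[OF this]] show ?thesis
      by (rule continuous_at_imp_continuous_at_within)
  next
    case True
    have b: "\<bar>entropy y\<bar> \<le> y + y ^ 3 + y\<^sup>2" if "0 \<le> y" for y
    proof (cases "y = 0")
      case False
      then have y: "0 < y" using that by simp
      have "ln y \<le> y" using ln_bound[OF y] .
      then have 1: "y\<^sup>2 * ln y \<le> y\<^sup>2 * y" by (intro mult_left_mono) auto
      have "- ln y = ln (1 / y)" using y by (simp add: ln_div)
      also have "\<dots> \<le> 1 / y" using y by (intro ln_bound) auto
      finally have "y\<^sup>2 * (- ln y) \<le> y\<^sup>2 * (1 / y)" by (intro mult_left_mono) auto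
      also have "\<dots> = y" using y by (simp add: power2_eq_square)
      finally have 2: "y\<^sup>2 * (- ln y) \<le> y" .
      have 3: "y\<^sup>2 * y = y ^ 3" by (simp add: power2_eq_square power3_eq_cube)
      have 4: "0 \<le> y ^ 3" "0 \<le> y\<^sup>2" using y by auto
      define z where "z = y\<^sup>2 * ln y"
      have z: "z \<le> y ^ 3" "- z \<le> y" using 1 2 3 by (simp_all add: z_def)
      have e: "entropy y = z / 4 - 3 / 8 * y\<^sup>2" by (simp add: entropy_def z_def)
      have "z / 4 - 3 / 8 * y\<^sup>2 \<le> y + y ^ 3 + y\<^sup>2" "- (z / 4 - 3 / 8 * y\<^sup>2) \<le> y + y ^ 3 + y\<^sup>2"
        using z 4 y by linarith+
      then show ?thesis unfolding e by (rule abs_leI)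
    qed (simp add: entropy_def)
    have "((\<lambda>y. y + y ^ 3 + y\<^sup>2) \<longlongrightarrow> 0 + 0 ^ 3 + (0::real)\<^sup>2) (at 0 within {0..})"
      by (intro tendsto_intros)
    then have "((\<lambda>y::real. y + y ^ 3 + y\<^sup>2) \<longlongrightarrow> 0) (at 0 within {0..})" by simp
    moreover have "\<forall>\<^sub>F y in at 0 within {0..}. norm (entropy y) \<le> y + y ^ 3 + y\<^sup>2"
      unfolding eventually_at_filter using b by (auto intro!: always_eventually)
    ultimately have "(entropy \<longlongrightarrow> 0) (at 0 within {0..})" by (rule Lim_null_comparison[rotated])
    then show ?thesis using True by (simp add: continuous_within entropy_def)
  qed
qed

text \<open>
  The derivative of \<open>entropy (q + x) - entropy x\<close> increases with \<open>x\<close>, so by the mean value theorem its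
  increase over an interval of length \<open>2\<close> is at most twice the derivative at the right end.
\<close>

lemma entropy_step:
  fixes m q :: real
  assumes "2 \<le> m" "0 < q"
  shows "(entropy (q + m) - entropy m) - (entropy (q + (m - 2)) - entropy (m - 2))
    \<le> ((q + m) * ln (q + m) - (q + m)) - (m * ln m - m)"
proof -
  let ?f = "\<lambda>x. entropy (q + x) - entropy x"
  let ?g = "\<lambda>x. ((q + x) * ln (q + x) - (q + x)) - (x * ln x - x)"
  have d: "(?f has_real_derivative ?g x / 2) (at x)" if "0 < x" for x
  proof -
    have "((\<lambda>x. entropy (q + x)) has_real_derivative ((q + x) * ln (q + x) - (q + x)) / 2) (at x)"
      using DERIV_shift[of entropy "((q + x) * ln (q + x) - (q + x)) / 2" x q] entropy_deriv[of "q + x"] that assms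
      by (simp add: add.commute)
    from DERIV_diff[OF this entropy_deriv[OF that]] show ?thesis
      by (rule DERIV_cong) (simp only: diff_divide_distrib)
  qed
  have "continuous_on {m - 2..m} (\<lambda>x. entropy (q + x))"
    using assms by (intro continuous_on_compose2[OF continuous_entropy]) (auto intro!: continuous_intros)
  moreover have "continuous_on {m - 2..m} entropy"
    using assms by (intro continuous_on_subset[OF continuous_entropy]) auto
  ultimately have c: "continuous_on {m - 2..m} ?f" by (rule continuous_on_diff)
  have "\<exists>l z. m - 2 < z \<and> z < m \<and> DERIV ?f z :> l \<and> ?f m - ?f (m - 2) = (m - (m - 2)) * l"
  proof (rule MVT[of "m - 2" m ?f])
    fix x assume "m - 2 < x" "x < m"
    then show "?f differentiable (at x)" using d[of x] assms real_differentiable_def by auto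
  qed (use c in auto)
  then obtain l z where z: "m - 2 < z" "z < m" "DERIV ?f z :> l" "?f m - ?f (m - 2) = 2 * l" by auto
  have z0: "0 < z" using z assms by simp
  have "l = ?g z / 2" using DERIV_unique[OF z(3) d[OF z0]] .
  moreover have "?g z \<le> ?g m"
  proof (rule DERIV_nonneg_imp_nondecreasing[of z m ?g])
    show "z \<le> m" using z by simp
    fix x assume x: "z \<le> x" "x \<le> m"
    then have x0: "0 < x" using z0 by simp
    have x_ln: "((\<lambda>x. x * ln x - x) has_real_derivative ln y) (at y)" if "0 < y" for y :: real
      using that by (auto intro!: derivative_eq_intros)
    have "((\<lambda>x. (q + x) * ln (q + x) - (q + x)) has_real_derivative ln (q + x)) (at x)"
      using DERIV_shift[of "\<lambda>x. x * ln x - x" "ln (q + x)" x q] x_ln[of "q + x"] x0 assms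
      by (simp add: add.commute)
    from DERIV_diff[OF this x_ln[OF x0]] have "DERIV ?g x :> ln (q + x) - ln x" .
    moreover have "0 \<le> ln (q + x) - ln x" using x0 assms by simp
    ultimately show "\<exists>y. DERIV ?g x :> y \<and> 0 \<le> y" by blast
  qed
  ultimately show ?thesis using z(4) by simp
qed

lemma sum_ln_fact_bound:
  fixes q :: nat
  assumes q: "1 \<le> q"
  shows "entropy (real q + 2 * real k) - entropy (real q) - entropy (2 * real k)
    \<le> (\<Sum>i = 1..k. ln (fact (q + 2 * i)) - ln (fact (2 * i)))"
proof (induction k)
  case 0
  then show ?case by (simp add: entropy_def)
next
  case (Suc k)
  define m where "m = 2 * Suc k"
  have "((real m + real q) * ln (real m + real q) - (real m + real q)) - (real m * ln (real m) - real m)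
    \<le> ln (fact (m + q)) - ln (fact m)" by (rule ln_fact_bound) (simp add: m_def)
  moreover have "(entropy (real q + real m) - entropy (real m)) - (entropy (real q + (real m - 2)) - entropy (real m - 2))
    \<le> ((real q + real m) * ln (real q + real m) - (real q + real m)) - (real m * ln (real m) - real m)"
    using q by (intro entropy_step) (auto simp: m_def)
  ultimately have "(entropy (real q + real m) - entropy (real m)) - (entropy (real q + (real m - 2)) - entropy (real m - 2))
      \<le> ln (fact (q + m)) - ln (fact m)" by (simp add: add.commute)
  moreover have "real m - 2 = 2 * real k" "real m = 2 * real (Suc k)" by (simp_all add: m_def)
  ultimately show ?case using Suc by (simp add: m_def)
qed

lemma product_bounds:
  fixes q k :: nat
  assumes q: "1 \<le> q" and k: "1 \<le> k"
  defines "d \<equiv> 2 * real k" and "N \<equiv> real q + 2 * real k"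
  shows "N powr ((N / 2)\<^sup>2) / (real q powr ((real q / 2)\<^sup>2) * d powr ((d / 2)\<^sup>2) * exp (3 * d * real q / 4))
      \<le> (\<Prod>i = 1..k. fact (q + 2 * i) / fact (2 * i))" (is "?X \<le> ?P")
    and "(N / exp (3 / 2)) powr (d * real q / 2)
      \<le> N powr ((N / 2)\<^sup>2) / (real q powr ((real q / 2)\<^sup>2) * d powr ((d / 2)\<^sup>2) * exp (3 * d * real q / 4))"
proof -
  have pos: "0 < real q" "0 < d" "0 < N" using q k by (auto simp: d_def N_def)
  have Nd: "N = real q + d" by (simp add: N_def d_def)
  have X: "?X = exp ((N / 2)\<^sup>2 * ln N - (real q / 2)\<^sup>2 * ln (real q) - (d / 2)\<^sup>2 * ln d - 3 * d * real q / 4)"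
    using pos by (simp add: powr_def exp_diff exp_add[symmetric] exp_minus field_simps)
  have "(N / 2)\<^sup>2 * ln N - (real q / 2)\<^sup>2 * ln (real q) - (d / 2)\<^sup>2 * ln d - 3 * d * real q / 4
      = entropy N - entropy (real q) - entropy d"
    unfolding entropy_def by (simp add: Nd power2_eq_square algebra_simps)
  also have "\<dots> \<le> (\<Sum>i = 1..k. ln (fact (q + 2 * i)) - ln (fact (2 * i)))"
    using sum_ln_fact_bound[OF q, of k] by (simp add: N_def d_def)
  finally have "?X \<le> exp (\<Sum>i = 1..k. ln (fact (q + 2 * i)) - ln (fact (2 * i)))" unfolding X by simp
  also have "\<dots> = ?P" by (subst exp_sum) (auto simp: exp_diff)
  finally show "?X \<le> ?P" .
  have "(N / exp (3 / 2)) powr (d * real q / 2) = exp (d * real q / 2 * (ln N - 3 / 2))"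
    using pos by (simp add: powr_def ln_div)
  also have "\<dots> \<le> exp ((N / 2)\<^sup>2 * ln N - (real q / 2)\<^sup>2 * ln (real q) - (d / 2)\<^sup>2 * ln d - 3 * d * real q / 4)"
  proof -
    have "0 \<le> (real q / 2)\<^sup>2 * (ln N - ln (real q))" "0 \<le> (d / 2)\<^sup>2 * (ln N - ln d)"
      using pos Nd by (auto intro!: mult_nonneg_nonneg)
    moreover have "(N / 2)\<^sup>2 = (real q / 2)\<^sup>2 + (d / 2)\<^sup>2 + d * real q / 2"
      by (simp add: Nd power2_eq_square algebra_simps)
    ultimately show ?thesis by (simp add: algebra_simps)
  qed
  finally show "(N / exp (3 / 2)) powr (d * real q / 2) \<le> ?X" unfolding X .
qed

section \<open>The lower bound\<close>

lemma paraboloid_lin: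
  fixes site :: "nat \<Rightarrow> real ^ 'm::finite" and \<pi> :: "'m \<Rightarrow> nat"
  assumes k: "1 \<le> k" and par: "paraboloid k \<psi> E" and e: "e \<in> E"
    and \<pi>: "bij_betw \<pi> UNIV {1..<2 * k}" and site: "site = (\<lambda>e. \<chi> i. \<psi> (\<pi> i) e)"
  shows "lin (2 * k + 1) \<psi> c e = c 0 + (\<chi> i. c (\<pi> i)) \<bullet> site e + c (2 * k) * (norm (site e))\<^sup>2"
proof -
  have re: "(\<Sum>i\<in>UNIV. f (\<pi> i)) = (\<Sum>i\<in>{1..<2 * k}. f i)" for f :: "nat \<Rightarrow> real"
    using sum.reindex_bij_betw[OF \<pi>] .
  have "(norm (site e))\<^sup>2 = (\<Sum>i\<in>{1..<2 * k}. (\<psi> i e)\<^sup>2)"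
    unfolding power2_norm_eq_inner inner_vec_def site using re[of "\<lambda>i. (\<psi> i e)\<^sup>2"]
    by (simp add: power2_eq_square)
  then have "\<psi> (2 * k) e = (norm (site e))\<^sup>2" using par e by (simp add: paraboloid_def)
  moreover have "(\<chi> i. c (\<pi> i)) \<bullet> site e = (\<Sum>i\<in>{1..<2 * k}. c i * \<psi> i e)"
    unfolding inner_vec_def site using re[of "\<lambda>i. c i * \<psi> i e"] by simp
  moreover have "{..<2 * k + 1} = insert 0 (insert (2 * k) {1..<2 * k})" using k by auto
  then have "lin (2 * k + 1) \<psi> c e = c 0 * \<psi> 0 e + c (2 * k) * \<psi> (2 * k) e + (\<Sum>i\<in>{1..<2 * k}. c i * \<psi> i e)"
    unfolding lin_def using k by simp
  ultimately show ?thesis using par e by (simp add: paraboloid_def)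
qed

lemma paraboloid_lin_infinity:
  assumes par: "paraboloid k \<psi> E"
  shows "lin (2 * k + 1) \<psi> c 0 = c (2 * k)"
proof -
  have "(\<Sum>i<2 * k. c i * \<psi> i 0) = 0" using par by (intro sum.neutral) (auto simp: paraboloid_def)
  then show ?thesis using par by (simp add: lin_def paraboloid_def)
qed

text \<open>
  The middle coordinates of a configuration on the paraboloid are the coordinates of the points, and
  functionals with value \<open>1\<close> at infinity are the power functions of spheres.
\<close>

lemma delaunay_types_realized:
  assumes k: "1 \<le> k" and m: "CARD('m::finite) = 2 * k - 1" and N: "2 * k \<le> N"
  shows "delaunay_types k {1..N} \<subseteq> neighborly_delaunay_types TYPE(real ^ 'm) N"
proof
  fix D assume "D \<in> delaunay_types k {1..N}"
  then obtain \<psi> where Dc: "D = faces_avoiding (2 * k + 1) \<psi> (insert 0 {1..N}) 0" and par: "paraboloid k \<psi> {1..N}"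
    and g: "generic (2 * k + 1) \<psi> (insert 0 {1..N})" and nb: "all_faces (2 * k + 1) \<psi> (insert 0 {1..N}) k"
    by (auto simp: delaunay_types_def)
  let ?E = "{1..N}" and ?r = "2 * k + 1"
  have "card (UNIV :: 'm set) = card {1..<2 * k}" using m by simp
  then obtain \<pi> :: "'m \<Rightarrow> nat" where \<pi>: "bij_betw \<pi> UNIV {1..<2 * k}"
    using finite_same_card_bij[of "UNIV :: 'm set" "{1..<2 * k}"] by auto
  define site :: "nat \<Rightarrow> real ^ 'm" where "site = (\<lambda>e. \<chi> i. \<psi> (\<pi> i) e)"
  note lin = paraboloid_lin[OF k par _ \<pi> site_def] and lin0 = paraboloid_lin_infinity[OF par]
  have dim: "DIM(real ^ 'm) + 1 = 2 * k" using m k by simp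
  have V: "finite (insert 0 ?E)" "card (insert 0 ?E) = N + 1" by simp_all
  have sphere_coeffs: "\<exists>c. c 0 = a \<and> (\<chi> i. c (\<pi> i)) = v \<and> c (2 * k) = 1" for a :: real and v :: "real ^ 'm"
  proof -
    have inj: "inj \<pi>" and rng: "\<pi> i \<in> {1..<2 * k}" for i using \<pi> by (auto simp: bij_betw_def)
    define c where "c = (\<lambda>n. if n = 0 then a else if n = 2 * k then 1 else v $ (inv \<pi> n))"
    have "c (\<pi> i) = v $ i" for i using rng[of i] inv_f_f[OF inj] by (auto simp: c_def)
    then show ?thesis using k by (intro exI[of _ c]) (auto simp: c_def vec_eq_iff)
  qed
  have small: "card R \<le> 2 * k" if "R \<in> D" for R
  proof -
    have "face ?r \<psi> (insert 0 ?E) R" "0 \<in> insert 0 ?E - R" using that by (auto simp: Dc faces_avoiding_def)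
    from face_card[OF g V(1) this] show ?thesis by simp
  qed
  have closed: "S \<in> D" if "R \<in> D" "S \<subseteq> R" for R S
  proof -
    have f: "face ?r \<psi> (insert 0 ?E) R" using that(1) by (simp add: Dc faces_avoiding_def)
    from face_subset[OF g V(1) f that(2)] small[OF that(1)] that show ?thesis by (auto simp: Dc faces_avoiding_def)
  qed
  interpret generic_sites ?E site D
  proof
    show "finite ?E" by simp
    show "DIM(real ^ 'm) + 1 \<le> card ?E" using N unfolding dim by simp
    show "\<exists>a v. \<forall>e\<in>W. a + v \<bullet> site e = t e"
      if W: "W \<subseteq> ?E" "card W \<le> DIM(real ^ 'm) + 1" for W and t :: "nat \<Rightarrow> real"
    proof -
      have fW: "finite (insert 0 W)" "insert 0 W \<subseteq> insert 0 ?E" "card (insert 0 W) \<le> ?r"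
        using W finite_subset[OF W(1)] unfolding dim by (auto simp: card_insert_if)
      obtain c where c: "\<And>e. e \<in> insert 0 W \<Longrightarrow> lin ?r \<psi> c e = (if e = 0 then 0 else t e)"
        using genericD[OF g fW, of "\<lambda>e. if e = 0 then 0 else t e"] by blast
      have c0: "c (2 * k) = 0" using c[of 0] lin0[of c] by simp
      have "c 0 + (\<chi> i. c (\<pi> i)) \<bullet> site e = t e" if e: "e \<in> W" for e
      proof -
        have "e \<in> ?E" "e \<noteq> 0" using W(1) e by auto
        then show ?thesis using lin[of e c] c[of e] c0 e by simp
      qed
      then show ?thesis by blast
    qed
    show "R \<in> D \<longleftrightarrow> R \<subseteq> ?E \<and> (\<exists>a v. (\<forall>e\<in>R. a + v \<bullet> site e + (norm (site e))\<^sup>2 = 0) \<and>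
      (\<forall>e\<in>?E - R. 0 < a + v \<bullet> site e + (norm (site e))\<^sup>2))" for R
    proof
      assume R: "R \<in> D"
      then have RE: "R \<subseteq> ?E" by (auto simp: Dc faces_avoiding_def)
      have "face ?r \<psi> (insert 0 ?E) R" using R by (simp add: Dc faces_avoiding_def)
      then obtain c where c: "\<forall>e\<in>R. lin ?r \<psi> c e = 0" "\<forall>e\<in>insert 0 ?E - R. 0 < lin ?r \<psi> c e"
        by (rule faceE)
      have "0 \<in> insert 0 ?E - R" using RE by auto
      then have "0 < lin ?r \<psi> c 0" using c(2) by blast
      then have s: "0 < c (2 * k)" by (simp only: lin0)
      define a v where "a = c 0 / c (2 * k)" and "v = (\<chi> i. c (\<pi> i)) /\<^sub>R c (2 * k)"
      have scale: "lin ?r \<psi> c e = c (2 * k) * (a + v \<bullet> site e + (norm (site e))\<^sup>2)" if "e \<in> ?E" for e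
        using lin[OF that, of c] s by (simp add: a_def v_def field_simps)
      have "a + v \<bullet> site e + (norm (site e))\<^sup>2 = 0" if "e \<in> R" for e
      proof -
        have "c (2 * k) * (a + v \<bullet> site e + (norm (site e))\<^sup>2) = 0"
          using c(1) scale[of e] that RE by (metis subsetD)
        then show ?thesis using s by simp
      qed
      moreover have "0 < a + v \<bullet> site e + (norm (site e))\<^sup>2" if "e \<in> ?E - R" for e
      proof -
        have "0 < c (2 * k) * (a + v \<bullet> site e + (norm (site e))\<^sup>2)"
          using c(2) scale[of e] that by (metis DiffD1 DiffD2 DiffI insertI2)
        then show ?thesis using s by (simp add: zero_less_mult_iff)
      qed
      ultimately show "R \<subseteq> ?E \<and> (\<exists>a v. (\<forall>e\<in>R. a + v \<bullet> site e + (norm (site e))\<^sup>2 = 0) \<and>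
        (\<forall>e\<in>?E - R. 0 < a + v \<bullet> site e + (norm (site e))\<^sup>2))" using RE by blast
    next
      assume "R \<subseteq> ?E \<and> (\<exists>a v. (\<forall>e\<in>R. a + v \<bullet> site e + (norm (site e))\<^sup>2 = 0) \<and>
        (\<forall>e\<in>?E - R. 0 < a + v \<bullet> site e + (norm (site e))\<^sup>2))"
      then obtain a v where RE: "R \<subseteq> ?E" and av: "\<forall>e\<in>R. a + v \<bullet> site e + (norm (site e))\<^sup>2 = 0"
        "\<forall>e\<in>?E - R. 0 < a + v \<bullet> site e + (norm (site e))\<^sup>2" by blast
      obtain c where c: "c 0 = a" "(\<chi> i. c (\<pi> i)) = v" "c (2 * k) = 1" using sphere_coeffs by blast
      have l: "lin ?r \<psi> c e = a + v \<bullet> site e + (norm (site e))\<^sup>2" if "e \<in> ?E" for e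
        using lin[OF that, of c] c by simp
      have "face ?r \<psi> (insert 0 ?E) R"
      proof (rule faceI[of _ _ _ _ c])
        show "R \<subseteq> insert 0 ?E" using RE by blast
        show "\<forall>e\<in>R. lin ?r \<psi> c e = 0" using av(1) l RE by (metis subsetD)
        show "\<forall>e\<in>insert 0 ?E - R. 0 < lin ?r \<psi> c e"
        proof
          fix e assume "e \<in> insert 0 ?E - R"
          then consider "e = 0" | "e \<in> ?E - R" by blast
          then show "0 < lin ?r \<psi> c e"
            by cases (use av(2) l lin0[of c] c in auto)
        qed
      qed
      then show "R \<in> D" using RE by (auto simp: Dc faces_avoiding_def)
    qed
    show "\<And>R S. R \<in> D \<Longrightarrow> S \<subseteq> R \<Longrightarrow> S \<in> D" by (rule closed)
    show "\<And>R. R \<in> D \<Longrightarrow> card R \<le> DIM(real ^ 'm) + 1" unfolding dim by (rule small)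
  qed
  define T where "T = (\<lambda>R. convex hull (site ` R)) ` D"
  have "neighborly (site ` ?E) T"
    unfolding neighborly_def
  proof (intro allI impI)
    fix S assume S: "S \<subseteq> site ` ?E" "card S = (DIM(real ^ 'm) + 1) div 2"
    then obtain R where R: "R \<subseteq> ?E" "S = site ` R" by (auto simp: subset_image_iff)
    have "card S = k" using S(2) unfolding dim by simp
    then have "card R = k" using R card_image[OF inj_on_subset[OF inj R(1)]] by simp
    then have "face ?r \<psi> (insert 0 ?E) R" using nb R(1) by (auto simp: all_faces_def)
    then have "R \<in> D" using R(1) by (auto simp: Dc faces_avoiding_def)
    then show "convex hull S \<in> T" using R(2) by (auto simp: T_def)
  qed
  moreover have "labeled_configuration N site" using inj by (simp add: labeled_configuration_def)
  moreover have "delaunay_triangulation (site ` ?E) T" using delaunay by (simp add: T_def)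
  moreover have "D = labeled_type N site T"
  proof -
    have "labeled_type N site T = (\<lambda>R. R) ` D"
      unfolding labeled_type_def T_def image_image
      by (rule image_cong) (simp_all only: cell_labels_def extreme_labels)
    then show ?thesis by simp
  qed
  ultimately show "D \<in> neighborly_delaunay_types TYPE(real ^ 'm) N"
    unfolding neighborly_delaunay_types_def by blast
qed

theorem mainTheorem4:
  fixes d n :: nat
  assumes "d \<ge> 2" and "even d" and "n > d + 2"
    and "CARD('m::finite) = d - 1"
  shows "real (card (neighborly_delaunay_types TYPE(real ^ 'm) (n - 1)))
           \<ge> (\<Prod>i = 1..d div 2. fact (n - d - 1 + 2 * i) / fact (2 * i))
       \<and> (\<Prod>i = 1..d div 2. fact (n - d - 1 + 2 * i) / fact (2 * i) :: real)
           \<ge> (real n - 1) powr (((real n - 1) / 2)\<^sup>2)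
              / ((real n - real d - 1) powr (((real n - real d - 1) / 2)\<^sup>2)
                 * real d powr ((real d / 2)\<^sup>2)
                 * exp (3 * real d * (real n - real d - 1) / 4))
       \<and> (real n - 1) powr (((real n - 1) / 2)\<^sup>2)
              / ((real n - real d - 1) powr (((real n - real d - 1) / 2)\<^sup>2)
                 * real d powr ((real d / 2)\<^sup>2)
                 * exp (3 * real d * (real n - real d - 1) / 4))
           \<ge> ((real n - 1) / exp (3 / 2)) powr (real d * (real n - real d - 1) / 2)"
proof -
  define k q where "k = d div 2" and "q = n - d - 1"
  have d: "d = 2 * k" "1 \<le> k" using assms by (auto simp: k_def)
  have q: "2 \<le> q" "n - 1 = q + 2 * k" using assms(3) d by (auto simp: q_def)
  have reals: "real n - 1 = real q + 2 * real k" "real n - real d - 1 = real q" "real d = 2 * real k"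
    using assms(3) d q by (auto simp: q_def of_nat_diff)
  have "finite (neighborly_delaunay_types TYPE(real ^ 'm) (n - 1))"
    by (rule finite_subset[of _ "Pow (Pow {1..n - 1})"])
      (auto simp: neighborly_delaunay_types_def labeled_type_def cell_labels_def)
  moreover have "delaunay_types k {1..n - 1} \<subseteq> neighborly_delaunay_types TYPE(real ^ 'm) (n - 1)"
    by (rule delaunay_types_realized) (use d q assms(4) in auto)
  ultimately have "card (delaunay_types k {1..n - 1}) \<le> card (neighborly_delaunay_types TYPE(real ^ 'm) (n - 1))"
    by (rule card_mono)
  moreover have "type_bound k q \<le> real (card (delaunay_types k {1..n - 1}))"
    by (rule type_counts(2)[OF q(1) d(2)]) (use q in auto)
  ultimately have "type_bound k q \<le> real (card (neighborly_delaunay_types TYPE(real ^ 'm) (n - 1)))" by simp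
  moreover have "1 \<le> q" using q by simp
  ultimately show ?thesis
    using product_bounds[OF \<open>1 \<le> q\<close> d(2)]
    unfolding reals(1,2) unfolding reals(3) type_bound_def k_def[symmetric] q_def[symmetric] by blast
qed

end
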